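(* Let $\varphi$ be a minimal counterexample to Vaught's conjecture. For every $\lambda\in S^\circ=\mathfrak F\cap C_{5.3}\cap(\mathrm{qr}(\varphi),\omega_1)$ such that $y_g(\lambda)$ holds, $\mathrm{trace}(K_{\lambda+1})\neq\emptyset$; that is, $K_{\lambda+1}$ realizes some non-principal $n$-type of $T_\lambda$.
   Context: Structures are countable structures in a countable vocabulary; classes of models are counted up to isomorphism. $\Sigma^{\mathrm{in}}_0=\Pi^{\mathrm{in}}_0$ is the set of finitary quantifier-free formulas; for $\alpha>0$, $\Sigma^{\mathrm{in}}_\alpha$ consists of countable disjunctions of formulas $\exists\bar x\,\psi$ with $\psi\in\Pi^{\mathrm{in}}_\beta$, $\beta<\alpha$, and $\Pi^{\mathrm{in}}_\alpha$ is dual. $M\equiv_\alpha N$: $M,N$ satisfy the same $\Pi^{\mathrm{in}}_\alpha$ (equivalently $\Sigma^{\mathrm{in}}_\alpha$) sentences. A Scott sentence of $M$ is an $L_{\omega_1\omega}$ sentence whose countable models are exactly the copies of $M$. $\mathrm{cSR}(M)$: the least $\alpha$ such that $M$ has a $\Pi^{\mathrm{in}}_{\alpha+1}$ Scott sentence. $\omega_1^A=\min\{\omega_1^X: X\in 2^\omega\text{ computes a copy of }A\}$. $\mathrm{qr}(S)$: the least $\beta$ with $S\in\Pi^{\mathrm{in}}_\beta\cup\Sigma^{\mathrm{in}}_\beta$. Standing hypotheses: Vaught's conjecture fails, and $\varphi$ is a minimal counterexample: an $L_{\omega_1\omega}$ sentence with exactly $\aleph_1$ countable models up to isomorphism, scattered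 (for each $\alpha<\omega_1$ at most countably many $\equiv_\alpha$-classes among its models), and such that for every $L_{\omega_1\omega}$ sentence $\psi$ one of $\varphi\wedge\psi$, $\varphi\wedge\neg\psi$ has only countably many models. Moreover for each $\alpha<\omega_1$ only countably many $\Sigma^{\mathrm{in}}_\alpha$-types are realized in models of $\varphi$. For each $\beta<\omega_1$ exactly one $\equiv_\beta$-class of models of $\varphi$ is uncountable, denoted $\mathcal C_\beta$. For $\beta\ge\mathrm{qr}(\varphi)$ the label $K_\beta$ is the unique (up to isomorphism) member of $\mathcal C_\beta$ of least $\mathrm{cSR}$ (it exists). $f(\alpha)=\min\{\beta:(\forall M\models\varphi)(M\notin\mathcal C_\alpha\Rightarrow\mathrm{cSR}(M)<\beta)\}$, $\mathfrak F=\{\alpha<\omega_1:f(\alpha)\le\alpha\}$. $W^{\mathrm{high}}_\lambda=\{A\models\varphi:\omega_1^A=\lambda,\ \mathrm{cSR}(A)=\lambda+1\}$. $y_g(\lambda)$: some $A\in W^{\mathrm{high}}_\lambda$ lies in $\mathcal C_{\lambda+1}$ (equivalently $\omega_1^{K_{\lambda+1}}=\lambda$). Sacks rank. A fragment is a countable set of $L_{\omega_1\omega}$ formulas closed under subformulas, substitution and the finitary connectives and quantifiers. For a structure $A$: $L^A_0$ is the finitary language; $T^A_\delta=\mathrm{Th}_{L^A_\delta}(A)$; $L^A_{\delta+1}$ is the least fragment containing $L^A_\delta$ and $\bigwedge p$ for every non-principal complete $L^A_\delta$-type $p$ realized in $A$; unions at limits. $\mathrm{sr}_{\mathrm{Sacks}}(A)$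 is the least $\delta$ such that $A$ is the atomic model of $T^A_\delta$. Tree of nodes. $L_0$ is the fragment generated by $\varphi$, and $T$ is $\{\varphi\}$ together with the tautologies of $L_0$. A theory $T'$ in a fragment $L'$ is $\omega$-complete if for each sentence $F\in L'$, $F\in T'$ or $\neg F\in T'$, and whenever $\bigvee_iF_i\in T'$, some $F_i\in T'$; it is finitarily consistent if no contradiction is derivable from it by finite-length deductions. Nodes on level $0$: finitarily consistent $\omega$-complete extensions of $T$ in $L_0$. An $n$-type of a node $S$ (in fragment $L_S$) is a maximal set of $L_S(\bar x)$-formulas finitarily consistent with $S$; it is principal if generated over $S$ by one of its formulas. Nodes on level $\delta+1$: finitarily consistent $\omega$-complete extensions of a level-$\delta$ node $S$ in $L'_S$, the least fragment containing $L_S$ and $\bigwedge p$ for each non-principal $n$-type $p$ of $S$. Nodes on limit levels: unions along chains. Every model of a node is a model of $\varphi$. Fixed data, supplied by a theorem of Sacks (Bounds on weak scattering, Prop. 5.2 and Thm. 5.3): an increasing branch $(T_\delta)_{\delta<\omega_1}$ of nodes, $T_\delta$ on level $\delta$, unions at limits, $\Delta_1$ over $L(\omega_1,T)$, such that every $T_\delta$ has an atomic model of $\mathrm{sr}_{\mathrm{Sacks}}$ exactly $\delta$; and a club $C_{5.3}\subseteq\omega_1$ (the ordinals $\omega_1^{L(\beta_\delta,T)}$ for the transitive collapses $L(\beta_\delta,T)$ of the $\Sigma_1$-hulls in Sacks' proof) such that for each $\lambda\in C_{5.3}$: $\lambda>\omega$ and $L(\lambda,T)$ is $\Sigma_1$-admissible;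 the set of non-principal $n$-types of $T_\lambda$ is non-empty and countable; $B_\lambda\models T_\lambda$ realizes every non-principal $n$-type of $T_\lambda$, $\omega_1^{B_\lambda}=\lambda$ and $\mathrm{sr}_{\mathrm{Sacks}}(B_\lambda)=\lambda+1$. For $\lambda\in S^\circ$, $N$ is the set of non-principal $n$-types (all $n\ge1$) of $T_\lambda$, and for a countable $M\models T_\lambda$ with $\omega_1^M=\lambda$, $\mathrm{trace}(M)=\{p\in N:M\text{ realizes }p\}$. (Under $y_g(\lambda)$, $K_{\lambda+1}$ is such an $M$.) *)

theory Defs
  imports "HOL-Library.Countable_Set_Type" "HOL-Library.Nat_Bijection"
begin

section \<open>Countable ordinals\<close>

typedef om1 = "Field (cardSuc natLeq)"
  using Field_cardSuc_not_empty[OF natLeq_Card_order] by blast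

lemma om1_wo: "Well_order (cardSuc natLeq)"
  by (rule cardSuc_Well_order[OF natLeq_Card_order])

instantiation om1 :: wellorder
begin

definition less_eq_om1 :: "om1 \<Rightarrow> om1 \<Rightarrow> bool" where
  "\<alpha> \<le> \<beta> \<longleftrightarrow> (Rep_om1 \<alpha>, Rep_om1 \<beta>) \<in> cardSuc natLeq"

definition less_om1 :: "om1 \<Rightarrow> om1 \<Rightarrow> bool" where
  "\<alpha> < \<beta> \<longleftrightarrow> \<alpha> \<le> \<beta> \<and> \<alpha> \<noteq> (\<beta> :: om1)"

instance
proof
  let ?r = "cardSuc natLeq"
  have lin: "refl_on (Field ?r) ?r" "trans ?r" "antisym ?r" "total_on (Field ?r) ?r" "wf (?r - Id)"
    using om1_wo
    by (auto simp: well_order_on_def linear_order_on_def partial_order_on_def preorder_on_def)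
  fix x y z :: om1
  show "x \<le> x"
    using lin(1) Rep_om1[of x] by (auto simp: less_eq_om1_def refl_on_def)
  show "x \<le> y \<Longrightarrow> y \<le> z \<Longrightarrow> x \<le> z"
    using lin(2) by (auto simp: less_eq_om1_def dest: transD)
  show antis: "x \<le> y \<Longrightarrow> y \<le> x \<Longrightarrow> x = y"
    using lin(3) by (auto simp: less_eq_om1_def Rep_om1_inject dest: antisymD)
  show "x < y \<longleftrightarrow> x \<le> y \<and> \<not> y \<le> x"
    using lin(3) lin(1) Rep_om1[of x]
    by (auto simp: less_om1_def less_eq_om1_def Rep_om1_inject refl_on_def dest: antisymD)
  show "x \<le> y \<or> y \<le> x"
    using lin(1,4) Rep_om1[of x] Rep_om1[of y]
    by (cases "x = y") (auto simp: less_eq_om1_def refl_on_def total_on_def Rep_om1_inject)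
next
  fix P :: "om1 \<Rightarrow> bool" and a :: om1
  assume step: "\<And>x. (\<And>y. y < x \<Longrightarrow> P y) \<Longrightarrow> P x"
  have "wf (cardSuc natLeq - Id)"
    using om1_wo by (auto simp: well_order_on_def)
  then have "wf (inv_image (cardSuc natLeq - Id) Rep_om1)"
    by (rule wf_inv_image)
  then show "P a"
  proof (induction a rule: wf_induct_rule)
    case (less x)
    show ?case
      by (rule step, rule less)
        (auto simp: less_om1_def less_eq_om1_def inv_image_def Rep_om1_inject)
  qed
qed

end

lemma om1_countable_below: "countable {..<\<alpha> :: om1}"
proof -
  have "(card_of (underS (cardSuc natLeq) (Rep_om1 \<alpha>)), cardSuc natLeq) \<in> ordLess"
    by (rule card_of_underS[OF cardSuc_Card_order[OF natLeq_Card_order] Rep_om1])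
  then have "(card_of (underS (cardSuc natLeq) (Rep_om1 \<alpha>)), natLeq) \<in> ordLeq"
    using cardSuc_ordLeq_ordLess[OF natLeq_Card_order card_of_Card_order] by blast
  then have c: "countable (underS (cardSuc natLeq) (Rep_om1 \<alpha>))"
    by (simp add: countable_card_le_natLeq)
  have "Rep_om1 ` {..<\<alpha>} \<subseteq> underS (cardSuc natLeq) (Rep_om1 \<alpha>)"
    by (auto simp: underS_def less_om1_def less_eq_om1_def Rep_om1_inject)
  then have "countable (Rep_om1 ` {..<\<alpha>})"
    using c countable_subset by blast
  then show ?thesis
    by (rule countable_image_inj_on) (auto simp: inj_on_def Rep_om1_inject)
qed

lemma om1_uncountable: "uncountable (UNIV :: om1 set)"
proof
  assume "countable (UNIV :: om1 set)"
  then have "countable (range Rep_om1)" by simp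
  then have "countable (Field (cardSuc natLeq))"
    using type_definition.Rep_range[OF type_definition_om1] by simp
  then have "(card_of (Field (cardSuc natLeq)), natLeq) \<in> ordLeq"
    by (simp add: countable_card_le_natLeq)
  then have "(cardSuc natLeq, natLeq) \<in> ordLeq"
    using card_of_Field_ordIso[OF cardSuc_Card_order[OF natLeq_Card_order]]
      ordIso_symmetric ordIso_ordLeq_trans by blast
  then show False
    using cardSuc_greater[OF natLeq_Card_order] not_ordLess_ordLeq by blast
qed

instantiation om1 :: zero
begin
definition zero_om1 :: om1 where "0 = (LEAST \<alpha> :: om1. True)"
instance ..
end

definition osuc :: "om1 \<Rightarrow> om1" where
  "osuc \<alpha> = (LEAST \<beta>. \<alpha> < \<beta>)"

definition is_limit :: "om1 \<Rightarrow> bool" where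
  "is_limit \<kappa> \<longleftrightarrow> \<kappa> \<noteq> 0 \<and> (\<forall>\<alpha><\<kappa>. osuc \<alpha> < \<kappa>)"

definition omega :: om1 where
  "omega = (LEAST \<kappa>. is_limit \<kappa>)"

definition opred :: "om1 \<Rightarrow> om1" where
  "opred \<alpha> = (LEAST \<beta>. \<alpha> \<le> osuc \<beta>)"

definition club :: "om1 set \<Rightarrow> bool" where
  "club C \<longleftrightarrow> (\<forall>\<alpha>. \<exists>\<beta>\<in>C. \<alpha> < \<beta>) \<and>
     (\<forall>\<kappa>. is_limit \<kappa> \<and> (\<forall>\<alpha><\<kappa>. \<exists>\<beta>\<in>C. \<alpha> < \<beta> \<and> \<beta> < \<kappa>) \<longrightarrow> \<kappa> \<in> C)"

lemma opred_less: "\<alpha> \<noteq> 0 \<Longrightarrow> \<not> is_limit \<alpha> \<Longrightarrow> opred \<alpha> < \<alpha>"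
  unfolding opred_def is_limit_def by (metis Least_le le_less_trans linorder_not_less)

function (domintros) orec :: "'a \<Rightarrow> ('a \<Rightarrow> 'a) \<Rightarrow> ('a set \<Rightarrow> 'a) \<Rightarrow> om1 \<Rightarrow> 'a" where
  "orec z s l \<alpha> =
     (if \<alpha> = 0 then z
      else if is_limit \<alpha> then l ((\<lambda>\<beta>. orec z s l \<beta>) ` {..<\<alpha>})
      else s (orec z s l (opred \<alpha>)))"
  by pat_completeness auto
termination
proof (relation "inv_image {(x, y :: om1). x < y} (\<lambda>(_, _, _, \<alpha>). \<alpha>)")
  show "wf (inv_image {(x, y :: om1). x < y} (\<lambda>(_, _, _, \<alpha>). \<alpha>))"
    by (rule wf_inv_image) (rule wf)
qed (auto simp: opred_less)

declare orec.simps [simp del]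


section \<open>Infinitary formulas\<close>

text \<open>Variables are de Bruijn indices: in \<^term>\<open>Exi F\<close> the bound variable is index 0 of F.
  Symbols are coded by natural numbers.\<close>

record vocab =
  fun_ar :: "nat \<Rightarrow> nat option"
  rel_ar :: "nat \<Rightarrow> nat option"

datatype trm = Var nat | App nat "trm list"

datatype fml =
    Equal trm trm
  | Atom nat "trm list"
  | Neg fml
  | Conj "fml cset"
  | Disj "fml cset"
  | Exi fml
  | Forall fml

primrec wf_trm :: "vocab \<Rightarrow> trm \<Rightarrow> bool" where
  "wf_trm V (Var i) = True"
| "wf_trm V (App f ts) = (fun_ar V f = Some (length ts) \<and> list_all id (map (wf_trm V) ts))"

primrec wf_symbols :: "vocab \<Rightarrow> fml \<Rightarrow> bool" where
  "wf_symbols V (Equal s t) = (wf_trm V s \<and> wf_trm V t)"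
| "wf_symbols V (Atom r ts) = (rel_ar V r = Some (length ts) \<and> list_all (wf_trm V) ts)"
| "wf_symbols V (Neg F) = wf_symbols V F"
| "wf_symbols V (Conj \<Phi>) = (\<forall>b \<in> rcset (cimage (wf_symbols V) \<Phi>). b)"
| "wf_symbols V (Disj \<Phi>) = (\<forall>b \<in> rcset (cimage (wf_symbols V) \<Phi>). b)"
| "wf_symbols V (Exi F) = wf_symbols V F"
| "wf_symbols V (Forall F) = wf_symbols V F"

primrec fv_trm :: "trm \<Rightarrow> nat set" where
  "fv_trm (Var i) = {i}"
| "fv_trm (App f ts) = \<Union> (set (map fv_trm ts))"

primrec fv :: "fml \<Rightarrow> nat set" where
  "fv (Equal s t) = fv_trm s \<union> fv_trm t"
| "fv (Atom r ts) = \<Union> (set (map fv_trm ts))"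
| "fv (Neg F) = fv F"
| "fv (Conj \<Phi>) = \<Union> (rcset (cimage fv \<Phi>))"
| "fv (Disj \<Phi>) = \<Union> (rcset (cimage fv \<Phi>))"
| "fv (Exi F) = {i. Suc i \<in> fv F}"
| "fv (Forall F) = {i. Suc i \<in> fv F}"

text \<open>As usual, formulas of \<open>L\<^sub>\<omega>\<^sub>1\<^sub>\<omega>\<close> have only finitely many free variables.\<close>

definition formulas :: "vocab \<Rightarrow> fml set" where
  "formulas V = {F. wf_symbols V F \<and> finite (fv F)}"

definition sentences :: "vocab \<Rightarrow> fml set" where
  "sentences V = {F \<in> formulas V. fv F = {}}"

primrec subst_trm :: "(nat \<Rightarrow> trm) \<Rightarrow> trm \<Rightarrow> trm" where
  "subst_trm \<sigma> (Var i) = \<sigma> i"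
| "subst_trm \<sigma> (App f ts) = App f (map (subst_trm \<sigma>) ts)"

definition lift_subst :: "(nat \<Rightarrow> trm) \<Rightarrow> nat \<Rightarrow> trm" where
  "lift_subst \<sigma> i = (case i of 0 \<Rightarrow> Var 0 | Suc j \<Rightarrow> subst_trm (\<lambda>k. Var (Suc k)) (\<sigma> j))"

primrec subst :: "fml \<Rightarrow> (nat \<Rightarrow> trm) \<Rightarrow> fml" where
  "subst (Equal s t) = (\<lambda>\<sigma>. Equal (subst_trm \<sigma> s) (subst_trm \<sigma> t))"
| "subst (Atom r ts) = (\<lambda>\<sigma>. Atom r (map (subst_trm \<sigma>) ts))"
| "subst (Neg F) = (\<lambda>\<sigma>. Neg (subst F \<sigma>))"
| "subst (Conj \<Phi>) = (\<lambda>\<sigma>. Conj (cimage (\<lambda>g. g \<sigma>) (cimage subst \<Phi>)))"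
| "subst (Disj \<Phi>) = (\<lambda>\<sigma>. Disj (cimage (\<lambda>g. g \<sigma>) (cimage subst \<Phi>)))"
| "subst (Exi F) = (\<lambda>\<sigma>. Exi (subst F (lift_subst \<sigma>)))"
| "subst (Forall F) = (\<lambda>\<sigma>. Forall (subst F (lift_subst \<sigma>)))"

definition shift :: "fml \<Rightarrow> fml" where
  "shift F = subst F (\<lambda>i. Var (Suc i))"

definition inst :: "fml \<Rightarrow> trm \<Rightarrow> fml" where
  "inst F t = subst F (\<lambda>i. case i of 0 \<Rightarrow> t | Suc j \<Rightarrow> Var j)"

primrec finitary :: "fml \<Rightarrow> bool" where
  "finitary (Equal s t) = True"
| "finitary (Atom r ts) = True"
| "finitary (Neg F) = finitary F"
| "finitary (Conj \<Phi>) = (finite (rcset \<Phi>) \<and> (\<forall>b \<in> rcset (cimage finitary \<Phi>). b))"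
| "finitary (Disj \<Phi>) = (finite (rcset \<Phi>) \<and> (\<forall>b \<in> rcset (cimage finitary \<Phi>). b))"
| "finitary (Exi F) = finitary F"
| "finitary (Forall F) = finitary F"

primrec quantifier_free :: "fml \<Rightarrow> bool" where
  "quantifier_free (Equal s t) = True"
| "quantifier_free (Atom r ts) = True"
| "quantifier_free (Neg F) = quantifier_free F"
| "quantifier_free (Conj \<Phi>) = (\<forall>b \<in> rcset (cimage quantifier_free \<Phi>). b)"
| "quantifier_free (Disj \<Phi>) = (\<forall>b \<in> rcset (cimage quantifier_free \<Phi>). b)"
| "quantifier_free (Exi F) = False"
| "quantifier_free (Forall F) = False"

inductive Sigma_in :: "vocab \<Rightarrow> om1 \<Rightarrow> fml \<Rightarrow> bool" and Pi_in :: "vocab \<Rightarrow> om1 \<Rightarrow> fml \<Rightarrow> bool"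
  for V where
  Sigma_in_0: "F \<in> formulas V \<Longrightarrow> finitary F \<Longrightarrow> quantifier_free F \<Longrightarrow> Sigma_in V 0 F"
| Pi_in_0: "F \<in> formulas V \<Longrightarrow> finitary F \<Longrightarrow> quantifier_free F \<Longrightarrow> Pi_in V 0 F"
| Sigma_in_pos: "0 < \<alpha> \<Longrightarrow> Disj \<Phi> \<in> formulas V \<Longrightarrow>
    (\<forall>F \<in> rcset \<Phi>. \<exists>\<beta><\<alpha>. \<exists>k G. F = (Exi ^^ k) G \<and> Pi_in V \<beta> G) \<Longrightarrow> Sigma_in V \<alpha> (Disj \<Phi>)"
| Pi_in_pos: "0 < \<alpha> \<Longrightarrow> Conj \<Phi> \<in> formulas V \<Longrightarrow>
    (\<forall>F \<in> rcset \<Phi>. \<exists>\<beta><\<alpha>. \<exists>k G. F = (Forall ^^ k) G \<and> Sigma_in V \<beta> G) \<Longrightarrow> Pi_in V \<alpha> (Conj \<Phi>)"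

text \<open>Placement of an arbitrary formula, not necessarily in the normal form demanded by
  \<^const>\<open>Sigma_in\<close> and \<^const>\<open>Pi_in\<close>, in the hierarchy: negations are dualised, and the classes are closed
  under the operations under which the normal-form classes are closed up to equivalence.
  Every formula of \<open>L\<^sub>\<omega>\<^sub>1\<^sub>\<omega>\<close> is placed at some level.\<close>

inductive in_Sigma :: "om1 \<Rightarrow> fml \<Rightarrow> bool" and in_Pi :: "om1 \<Rightarrow> fml \<Rightarrow> bool" where
  "finitary F \<Longrightarrow> quantifier_free F \<Longrightarrow> in_Sigma \<alpha> F"
| "finitary F \<Longrightarrow> quantifier_free F \<Longrightarrow> in_Pi \<alpha> F"
| "in_Pi \<beta> F \<Longrightarrow> \<beta> < \<alpha> \<Longrightarrow> in_Sigma \<alpha> F"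
| "in_Sigma \<beta> F \<Longrightarrow> \<beta> < \<alpha> \<Longrightarrow> in_Pi \<alpha> F"
| "in_Pi \<alpha> F \<Longrightarrow> in_Sigma \<alpha> (Neg F)"
| "in_Sigma \<alpha> F \<Longrightarrow> in_Pi \<alpha> (Neg F)"
| "0 < \<alpha> \<Longrightarrow> (\<forall>F \<in> rcset \<Phi>. in_Sigma \<alpha> F) \<Longrightarrow> in_Sigma \<alpha> (Disj \<Phi>)"
| "0 < \<alpha> \<Longrightarrow> (\<forall>F \<in> rcset \<Phi>. in_Pi \<alpha> F) \<Longrightarrow> in_Pi \<alpha> (Conj \<Phi>)"
| "0 < \<alpha> \<Longrightarrow> finite (rcset \<Phi>) \<Longrightarrow> (\<forall>F \<in> rcset \<Phi>. in_Sigma \<alpha> F) \<Longrightarrow> in_Sigma \<alpha> (Conj \<Phi>)"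
| "0 < \<alpha> \<Longrightarrow> finite (rcset \<Phi>) \<Longrightarrow> (\<forall>F \<in> rcset \<Phi>. in_Pi \<alpha> F) \<Longrightarrow> in_Pi \<alpha> (Disj \<Phi>)"
| "0 < \<alpha> \<Longrightarrow> in_Sigma \<alpha> F \<Longrightarrow> in_Sigma \<alpha> (Exi F)"
| "0 < \<alpha> \<Longrightarrow> in_Pi \<alpha> F \<Longrightarrow> in_Pi \<alpha> (Forall F)"

definition qr :: "fml \<Rightarrow> om1" where
  "qr S = (LEAST \<beta>. in_Pi \<beta> S \<or> in_Sigma \<beta> S)"


section \<open>Countable structures\<close>

text \<open>The universe is a non-empty set of natural numbers, so that every countable structure has an
  isomorphic copy here. The values of \<open>fun_val\<close> and \<open>rel_val\<close> outside the universe and the vocabulary are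
  irrelevant.\<close>

record struct =
  univ :: "nat set"
  fun_val :: "nat \<Rightarrow> nat list \<Rightarrow> nat"
  rel_val :: "nat \<Rightarrow> nat list \<Rightarrow> bool"

definition structures :: "vocab \<Rightarrow> struct set" where
  "structures V = {M. univ M \<noteq> {} \<and>
     (\<forall>f as. fun_ar V f = Some (length as) \<and> set as \<subseteq> univ M \<longrightarrow> fun_val M f as \<in> univ M)}"

primrec tval :: "struct \<Rightarrow> (nat \<Rightarrow> nat) \<Rightarrow> trm \<Rightarrow> nat" where
  "tval M e (Var i) = e i"
| "tval M e (App f ts) = fun_val M f (map (tval M e) ts)"

primrec sat :: "struct \<Rightarrow> fml \<Rightarrow> (nat \<Rightarrow> nat) \<Rightarrow> bool" where
  "sat M (Equal s t) = (\<lambda>e. tval M e s = tval M e t)"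
| "sat M (Atom r ts) = (\<lambda>e. rel_val M r (map (tval M e) ts))"
| "sat M (Neg F) = (\<lambda>e. \<not> sat M F e)"
| "sat M (Conj \<Phi>) = (\<lambda>e. \<forall>P \<in> rcset (cimage (sat M) \<Phi>). P e)"
| "sat M (Disj \<Phi>) = (\<lambda>e. \<exists>P \<in> rcset (cimage (sat M) \<Phi>). P e)"
| "sat M (Exi F) = (\<lambda>e. \<exists>a \<in> univ M. sat M F (case_nat a e))"
| "sat M (Forall F) = (\<lambda>e. \<forall>a \<in> univ M. sat M F (case_nat a e))"

definition envs :: "struct \<Rightarrow> (nat \<Rightarrow> nat) set" where
  "envs M = {e. range e \<subseteq> univ M}"

definition holds :: "struct \<Rightarrow> fml \<Rightarrow> bool" (infix "\<Turnstile>" 50) where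
  "M \<Turnstile> F \<longleftrightarrow> (\<forall>e \<in> envs M. sat M F e)"

definition models :: "vocab \<Rightarrow> fml \<Rightarrow> struct set" where
  "models V F = {M \<in> structures V. M \<Turnstile> F}"

definition isomorphic :: "vocab \<Rightarrow> struct \<Rightarrow> struct \<Rightarrow> bool" where
  "isomorphic V M N \<longleftrightarrow> (\<exists>h. bij_betw h (univ M) (univ N) \<and>
     (\<forall>f as. fun_ar V f = Some (length as) \<and> set as \<subseteq> univ M \<longrightarrow> h (fun_val M f as) = fun_val N f (map h as)) \<and>
     (\<forall>r as. rel_ar V r = Some (length as) \<and> set as \<subseteq> univ M \<longrightarrow> rel_val M r as = rel_val N r (map h as)))"

definition iso_types :: "vocab \<Rightarrow> struct set \<Rightarrow> struct set set" where
  "iso_types V X = (\<lambda>M. {N \<in> structures V. isomorphic V M N}) ` X"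

definition equiv_lvl :: "vocab \<Rightarrow> om1 \<Rightarrow> struct \<Rightarrow> struct \<Rightarrow> bool" where
  "equiv_lvl V \<alpha> M N \<longleftrightarrow> (\<forall>F \<in> sentences V. Pi_in V \<alpha> F \<longrightarrow> (M \<Turnstile> F \<longleftrightarrow> N \<Turnstile> F))"

definition equiv_classes :: "vocab \<Rightarrow> fml \<Rightarrow> om1 \<Rightarrow> struct set set" where
  "equiv_classes V \<phi> \<alpha> = (\<lambda>M. {N \<in> models V \<phi>. equiv_lvl V \<alpha> M N}) ` models V \<phi>"

definition scott_sentence :: "vocab \<Rightarrow> struct \<Rightarrow> fml \<Rightarrow> bool" where
  "scott_sentence V M F \<longleftrightarrow> F \<in> sentences V \<and> (\<forall>N \<in> structures V. N \<Turnstile> F \<longleftrightarrow> isomorphic V M N)"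

definition cSR :: "vocab \<Rightarrow> struct \<Rightarrow> om1" where
  "cSR V M = (LEAST \<alpha>. \<exists>F. Pi_in V (osuc \<alpha>) F \<and> scott_sentence V M F)"


section \<open>Relative computability\<close>

datatype recf = Rf_zero | Rf_succ | Proj nat | Oracle | Comp recf "recf list" | Prec recf recf | Mn recf

inductive reval :: "nat set \<Rightarrow> recf \<Rightarrow> nat list \<Rightarrow> nat \<Rightarrow> bool" for X where
  "reval X Rf_zero xs 0"
| "reval X Rf_succ (x # xs) (Suc x)"
| "i < length xs \<Longrightarrow> reval X (Proj i) xs (xs ! i)"
| "reval X Oracle (x # xs) (if x \<in> X then 1 else 0)"
| "list_all2 (\<lambda>g y. reval X g xs y) gs ys \<Longrightarrow> reval X f ys z \<Longrightarrow> reval X (Comp f gs) xs z"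
| "reval X f xs y \<Longrightarrow> reval X (Prec f g) (0 # xs) y"
| "reval X (Prec f g) (n # xs) y \<Longrightarrow> reval X g (n # y # xs) z \<Longrightarrow> reval X (Prec f g) (Suc n # xs) z"
| "reval X f (n # xs) 0 \<Longrightarrow> (\<forall>m<n. \<exists>y. 0 < y \<and> reval X f (m # xs) y) \<Longrightarrow> reval X (Mn f) xs n"

definition computable_from :: "nat set \<Rightarrow> nat set \<Rightarrow> bool" where
  "computable_from X A \<longleftrightarrow> (\<exists>f. \<forall>n. reval X f [n] (if n \<in> A then 1 else 0))"

text \<open>The least ordinal that is not the order type of an X-computable well-ordering of a set of
  natural numbers; well-orderings are reflexive, as in the library.\<close>

definition omega1_real :: "nat set \<Rightarrow> om1" where
  "omega1_real X = (LEAST \<alpha>. \<not> (\<exists>r :: nat rel. Well_order r \<and> computable_from X (prod_encode ` r) \<and>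
      (r, {(\<beta>, \<gamma>). \<beta> \<le> \<gamma> \<and> \<gamma> < \<alpha>}) \<in> ordIso))"

definition atomic_diagram :: "vocab \<Rightarrow> struct \<Rightarrow> nat set" where
  "atomic_diagram V M =
     {prod_encode (0, a) | a. a \<in> univ M} \<union>
     {prod_encode (1, prod_encode (r, list_encode as)) | r as.
        rel_ar V r = Some (length as) \<and> set as \<subseteq> univ M \<and> rel_val M r as} \<union>
     {prod_encode (2, prod_encode (f, list_encode (fun_val M f as # as))) | f as.
        fun_ar V f = Some (length as) \<and> set as \<subseteq> univ M}"

definition computes_copy :: "vocab \<Rightarrow> nat set \<Rightarrow> struct \<Rightarrow> bool" where
  "computes_copy V X M \<longleftrightarrow>
     (\<exists>N \<in> structures V. isomorphic V M N \<and> computable_from X (atomic_diagram V N))"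

definition omega1 :: "vocab \<Rightarrow> struct \<Rightarrow> om1" where
  "omega1 V M = (LEAST \<alpha>. \<exists>X. computes_copy V X M \<and> \<alpha> = omega1_real X)"


section \<open>Minimal counterexamples\<close>

definition minimal_counterexample :: "vocab \<Rightarrow> fml \<Rightarrow> bool" where
  "minimal_counterexample V \<phi> \<longleftrightarrow>
     \<phi> \<in> sentences V \<and>
     (card_of (iso_types V (models V \<phi>)), cardSuc natLeq) \<in> ordIso \<and>
     (\<forall>\<alpha>. countable (equiv_classes V \<phi> \<alpha>)) \<and>
     (\<forall>\<psi> \<in> sentences V.
        countable (iso_types V (models V (Conj (acset {\<phi>, \<psi>})))) \<or>
        countable (iso_types V (models V (Conj (acset {\<phi>, Neg \<psi>}))))) \<and>
     (\<forall>\<alpha>. countable {{F. Sigma_in V \<alpha> F \<and> fv F \<subseteq> {..<n} \<and> sat M F e} | n M e.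
        M \<in> models V \<phi> \<and> e \<in> envs M})"

definition big_class :: "vocab \<Rightarrow> fml \<Rightarrow> om1 \<Rightarrow> struct set" where
  "big_class V \<phi> \<beta> = (THE C. C \<in> equiv_classes V \<phi> \<beta> \<and> uncountable (iso_types V C))"

definition K_label :: "vocab \<Rightarrow> fml \<Rightarrow> om1 \<Rightarrow> struct" where
  "K_label V \<phi> \<beta> = (SOME M. M \<in> big_class V \<phi> \<beta> \<and> (\<forall>N \<in> big_class V \<phi> \<beta>. cSR V M \<le> cSR V N))"

definition f_bound :: "vocab \<Rightarrow> fml \<Rightarrow> om1 \<Rightarrow> om1" where
  "f_bound V \<phi> \<alpha> =
     (LEAST \<beta>. \<forall>M \<in> models V \<phi>. M \<notin> big_class V \<phi> \<alpha> \<longrightarrow> cSR V M < \<beta>)"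

definition F_set :: "vocab \<Rightarrow> fml \<Rightarrow> om1 set" where
  "F_set V \<phi> = {\<alpha>. f_bound V \<phi> \<alpha> \<le> \<alpha>}"

definition W_high :: "vocab \<Rightarrow> fml \<Rightarrow> om1 \<Rightarrow> struct set" where
  "W_high V \<phi> \<kappa> = {A \<in> models V \<phi>. omega1 V A = \<kappa> \<and> cSR V A = osuc \<kappa>}"

definition y_g :: "vocab \<Rightarrow> fml \<Rightarrow> om1 \<Rightarrow> bool" where
  "y_g V \<phi> \<kappa> \<longleftrightarrow> (\<exists>A \<in> W_high V \<phi> \<kappa>. A \<in> big_class V \<phi> (osuc \<kappa>))"


section \<open>Fragments, deductions and types\<close>

text \<open>As usual, a fragment contains all atomic formulas of the vocabulary.\<close>

definition fragment :: "vocab \<Rightarrow> fml set \<Rightarrow> bool" where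
  "fragment V L \<longleftrightarrow>
     countable L \<and> L \<subseteq> formulas V \<and>
     (\<forall>s t. wf_trm V s \<and> wf_trm V t \<longrightarrow> Equal s t \<in> L) \<and>
     (\<forall>r ts. rel_ar V r = Some (length ts) \<and> list_all (wf_trm V) ts \<longrightarrow> Atom r ts \<in> L) \<and>
     (\<forall>F. Neg F \<in> L \<longleftrightarrow> F \<in> L) \<and>
     (\<forall>F. Exi F \<in> L \<longleftrightarrow> F \<in> L) \<and>
     (\<forall>F. Forall F \<in> L \<longleftrightarrow> F \<in> L) \<and>
     (\<forall>\<Phi>. Conj \<Phi> \<in> L \<longrightarrow> rcset \<Phi> \<subseteq> L) \<and>
     (\<forall>\<Phi>. Disj \<Phi> \<in> L \<longrightarrow> rcset \<Phi> \<subseteq> L) \<and>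
     (\<forall>\<Phi>. finite (rcset \<Phi>) \<and> rcset \<Phi> \<subseteq> L \<longrightarrow> Conj \<Phi> \<in> L \<and> Disj \<Phi> \<in> L) \<and>
     (\<forall>F \<sigma>. F \<in> L \<and> (\<forall>i. wf_trm V (\<sigma> i)) \<longrightarrow> subst F \<sigma> \<in> L)"

definition gen_fragment :: "vocab \<Rightarrow> fml set \<Rightarrow> fml set" where
  "gen_fragment V X = \<Inter> {L. fragment V L \<and> X \<subseteq> L}"

text \<open>Natural deduction for \<open>L\<^sub>\<omega>\<^sub>1\<^sub>\<omega>\<close>; k bounds the height of the derivation. Introduction of
  conjunctions and elimination of disjunctions have one premise for each member, hence possibly
  infinitely many. Without them p would remain consistent with the negation of \<open>\<And>p\<close>
  for a non-principal p, so there would be maximal consistent sets that no structure realizes.\<close>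

inductive prov :: "vocab \<Rightarrow> nat \<Rightarrow> fml set \<Rightarrow> fml \<Rightarrow> bool" for V where
  assm: "F \<in> \<Gamma> \<Longrightarrow> prov V k \<Gamma> F"
| NegI: "prov V k (insert F \<Gamma>) G \<Longrightarrow> prov V k (insert F \<Gamma>) (Neg G) \<Longrightarrow> prov V (Suc k) \<Gamma> (Neg F)"
| NegE: "prov V k (insert (Neg F) \<Gamma>) G \<Longrightarrow> prov V k (insert (Neg F) \<Gamma>) (Neg G) \<Longrightarrow>
    prov V (Suc k) \<Gamma> F"
| ConjI: "(\<forall>F \<in> rcset \<Phi>. prov V k \<Gamma> F) \<Longrightarrow> prov V (Suc k) \<Gamma> (Conj \<Phi>)"
| ConjE: "prov V k \<Gamma> (Conj \<Phi>) \<Longrightarrow> F \<in> rcset \<Phi> \<Longrightarrow> prov V (Suc k) \<Gamma> F"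
| DisjI: "prov V k \<Gamma> F \<Longrightarrow> F \<in> rcset \<Phi> \<Longrightarrow> prov V (Suc k) \<Gamma> (Disj \<Phi>)"
| DisjE: "prov V k \<Gamma> (Disj \<Phi>) \<Longrightarrow> (\<forall>F \<in> rcset \<Phi>. prov V k (insert F \<Gamma>) G) \<Longrightarrow>
    prov V (Suc k) \<Gamma> G"
| ExI: "wf_trm V t \<Longrightarrow> prov V k \<Gamma> (inst F t) \<Longrightarrow> prov V (Suc k) \<Gamma> (Exi F)"
| ExE: "prov V k \<Gamma> (Exi F) \<Longrightarrow> prov V k (insert F (shift ` \<Gamma>)) (shift G) \<Longrightarrow> prov V (Suc k) \<Gamma> G"
| AllI: "prov V k (shift ` \<Gamma>) F \<Longrightarrow> prov V (Suc k) \<Gamma> (Forall F)"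
| AllE: "wf_trm V t \<Longrightarrow> prov V k \<Gamma> (Forall F) \<Longrightarrow> prov V (Suc k) \<Gamma> (inst F t)"
| Refl: "wf_trm V t \<Longrightarrow> prov V k \<Gamma> (Equal t t)"
| Leibniz: "wf_trm V s \<Longrightarrow> wf_trm V t \<Longrightarrow> prov V k \<Gamma> (Equal s t) \<Longrightarrow> prov V k \<Gamma> (inst F s) \<Longrightarrow>
    prov V (Suc k) \<Gamma> (inst F t)"

definition derivable :: "vocab \<Rightarrow> fml set \<Rightarrow> fml \<Rightarrow> bool" where
  "derivable V \<Gamma> F \<longleftrightarrow> (\<exists>k. prov V k \<Gamma> F)"

definition fin_consistent :: "vocab \<Rightarrow> fml set \<Rightarrow> bool" where
  "fin_consistent V \<Gamma> \<longleftrightarrow> \<not> (\<exists>F. derivable V \<Gamma> F \<and> derivable V \<Gamma> (Neg F))"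

definition omega_complete :: "fml set \<Rightarrow> fml set \<Rightarrow> bool" where
  "omega_complete L S \<longleftrightarrow>
     S \<subseteq> {F \<in> L. fv F = {}} \<and>
     (\<forall>F \<in> L. fv F = {} \<longrightarrow> F \<in> S \<or> Neg F \<in> S) \<and>
     (\<forall>\<Phi>. Disj \<Phi> \<in> S \<longrightarrow> (\<exists>F \<in> rcset \<Phi>. F \<in> S))"

definition ntype :: "vocab \<Rightarrow> fml set \<Rightarrow> fml set \<Rightarrow> nat \<Rightarrow> fml set \<Rightarrow> bool" where
  "ntype V L S n p \<longleftrightarrow>
     p \<subseteq> {F \<in> L. fv F \<subseteq> {..<n}} \<and> fin_consistent V (S \<union> p) \<and>
     (\<forall>q. p \<subseteq> q \<and> q \<subseteq> {F \<in> L. fv F \<subseteq> {..<n}} \<and> fin_consistent V (S \<union> q) \<longrightarrow> q = p)"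

definition principal :: "vocab \<Rightarrow> fml set \<Rightarrow> fml set \<Rightarrow> bool" where
  "principal V S p \<longleftrightarrow> (\<exists>F \<in> p. \<forall>G \<in> p. derivable V (insert F S) G)"

definition nonprincipal_types :: "vocab \<Rightarrow> fml set \<Rightarrow> fml set \<Rightarrow> fml set set" where
  "nonprincipal_types V L S = {p. \<exists>n\<ge>1. ntype V L S n p \<and> \<not> principal V S p}"

definition ctype :: "fml set \<Rightarrow> struct \<Rightarrow> nat \<Rightarrow> (nat \<Rightarrow> nat) \<Rightarrow> fml set" where
  "ctype L M n e = {F \<in> L. fv F \<subseteq> {..<n} \<and> sat M F e}"

definition realizes :: "struct \<Rightarrow> fml set \<Rightarrow> bool" where
  "realizes M p \<longleftrightarrow> (\<exists>e \<in> envs M. \<forall>F \<in> p. sat M F e)"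

definition theory_of :: "fml set \<Rightarrow> struct \<Rightarrow> fml set" where
  "theory_of L M = {F \<in> L. fv F = {} \<and> M \<Turnstile> F}"

definition atomic_model :: "vocab \<Rightarrow> fml set \<Rightarrow> fml set \<Rightarrow> struct \<Rightarrow> bool" where
  "atomic_model V L S M \<longleftrightarrow>
     M \<in> structures V \<and> (\<forall>F \<in> S. M \<Turnstile> F) \<and>
     (\<forall>n. \<forall>e \<in> envs M. principal V S (ctype L M n e))"

definition sacks_lang :: "vocab \<Rightarrow> struct \<Rightarrow> om1 \<Rightarrow> fml set" where
  "sacks_lang V A = orec {F \<in> formulas V. finitary F}
     (\<lambda>L. gen_fragment V (L \<union> {Conj (acset p) | p. \<exists>n. \<exists>e \<in> envs A.
        p = ctype L A n e \<and> \<not> principal V (theory_of L A) p}))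
     \<Union>"

definition sr_sacks :: "vocab \<Rightarrow> struct \<Rightarrow> om1" where
  "sr_sacks V A = (LEAST \<delta>. atomic_model V (sacks_lang V A \<delta>) (theory_of (sacks_lang V A \<delta>) A) A)"


section \<open>The tree of nodes\<close>

definition base_theory :: "vocab \<Rightarrow> fml \<Rightarrow> fml set" where
  "base_theory V \<phi> =
     insert \<phi> {F \<in> gen_fragment V {\<phi>}. fv F = {} \<and> (\<forall>M \<in> structures V. M \<Turnstile> F)}"

text \<open>\<open>node V \<phi> \<delta> L S\<close>: S is a node on level \<open>\<delta>\<close>, with fragment L. On limit levels \<open>l\<close> and \<open>s\<close> give
  the fragments and the theories of the chain.\<close>

inductive node :: "vocab \<Rightarrow> fml \<Rightarrow> om1 \<Rightarrow> fml set \<Rightarrow> fml set \<Rightarrow> bool" for V \<phi> where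
  node_0: "L = gen_fragment V {\<phi>} \<Longrightarrow> base_theory V \<phi> \<subseteq> S \<Longrightarrow> omega_complete L S \<Longrightarrow>
    fin_consistent V S \<Longrightarrow> node V \<phi> 0 L S"
| node_suc: "node V \<phi> \<delta> L S \<Longrightarrow>
    L' = gen_fragment V (L \<union> {Conj (acset p) | p. p \<in> nonprincipal_types V L S}) \<Longrightarrow>
    fragment V L' \<Longrightarrow> S \<subseteq> S' \<Longrightarrow> omega_complete L' S' \<Longrightarrow> fin_consistent V S' \<Longrightarrow>
    node V \<phi> (osuc \<delta>) L' S'"
| node_lim: "is_limit \<delta> \<Longrightarrow> (\<forall>\<gamma><\<delta>. node V \<phi> \<gamma> (l \<gamma>) (s \<gamma>)) \<Longrightarrow>
    (\<forall>\<gamma> \<gamma>'. \<gamma> \<le> \<gamma>' \<and> \<gamma>' < \<delta> \<longrightarrow> l \<gamma> \<subseteq> l \<gamma>' \<and> s \<gamma> \<subseteq> s \<gamma>') \<Longrightarrow>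
    node V \<phi> \<delta> (\<Union>\<gamma><\<delta>. l \<gamma>) (\<Union>\<gamma><\<delta>. s \<gamma>)"


section \<open>The constructible hierarchy over a theory\<close>

text \<open>By extensionality of \<^typ>\<open>'a cset\<close>, the type \<open>hc\<close> is the universe of (pure, well-founded)
  hereditarily countable sets.\<close>

datatype hc = HC (elts: "hc cset")

definition hset :: "hc set \<Rightarrow> hc" where "hset A = HC (acset A)"

definition hmem :: "hc \<Rightarrow> hc \<Rightarrow> bool" where "hmem x y \<longleftrightarrow> x \<in> rcset (elts y)"

definition hpair :: "hc \<Rightarrow> hc \<Rightarrow> hc" where "hpair x y = hset {hset {x}, hset {x, y}}"

primrec hnat :: "nat \<Rightarrow> hc" where
  "hnat 0 = hset {}"
| "hnat (Suc n) = hset (insert (hnat n) {x. hmem x (hnat n)})"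

primrec hlist :: "hc list \<Rightarrow> hc" where
  "hlist [] = hset {}"
| "hlist (x # xs) = hpair x (hlist xs)"

function (domintros) von_neumann :: "om1 \<Rightarrow> hc" where
  "von_neumann \<alpha> = hset (von_neumann ` {..<\<alpha>})"
  by pat_completeness auto
termination
  by (relation "{(x, y :: om1). x < y}") (auto intro: wf)

declare von_neumann.simps [simp del]

primrec code_trm :: "trm \<Rightarrow> hc" where
  "code_trm (Var i) = hpair (hnat 0) (hnat i)"
| "code_trm (App f ts) = hpair (hnat 1) (hpair (hnat f) (hlist (map code_trm ts)))"

primrec code :: "fml \<Rightarrow> hc" where
  "code (Equal s t) = hpair (hnat 0) (hpair (code_trm s) (code_trm t))"
| "code (Atom r ts) = hpair (hnat 1) (hpair (hnat r) (hlist (map code_trm ts)))"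
| "code (Neg F) = hpair (hnat 2) (code F)"
| "code (Conj \<Phi>) = hpair (hnat 3) (HC (cimage code \<Phi>))"
| "code (Disj \<Phi>) = hpair (hnat 4) (HC (cimage code \<Phi>))"
| "code (Exi F) = hpair (hnat 5) (code F)"
| "code (Forall F) = hpair (hnat 6) (code F)"

definition code_set :: "fml set \<Rightarrow> hc" where
  "code_set S = hset (code ` S)"

text \<open>First-order formulas of set theory, with named variables.\<close>

datatype sform = SMem nat nat | SEq nat nat | SNeg sform | SAnd sform sform | SEx nat sform

primrec ssat :: "hc set \<Rightarrow> sform \<Rightarrow> (nat \<Rightarrow> hc) \<Rightarrow> bool" where
  "ssat A (SMem x y) e = hmem (e x) (e y)"
| "ssat A (SEq x y) e = (e x = e y)"
| "ssat A (SNeg f) e = (\<not> ssat A f e)"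
| "ssat A (SAnd f g) e = (ssat A f e \<and> ssat A g e)"
| "ssat A (SEx x f) e = (\<exists>a \<in> A. ssat A f (e(x := a)))"

inductive Delta0 :: "sform \<Rightarrow> bool" where
  "Delta0 (SMem x y)"
| "Delta0 (SEq x y)"
| "Delta0 f \<Longrightarrow> Delta0 (SNeg f)"
| "Delta0 f \<Longrightarrow> Delta0 g \<Longrightarrow> Delta0 (SAnd f g)"
| "Delta0 f \<Longrightarrow> x \<noteq> y \<Longrightarrow> Delta0 (SEx x (SAnd (SMem x y) f))"

inductive Sigma1 :: "sform \<Rightarrow> bool" where
  "Delta0 f \<Longrightarrow> Sigma1 f"
| "Sigma1 f \<Longrightarrow> Sigma1 (SEx x f)"

definition definable_subsets :: "hc set \<Rightarrow> hc set" where
  "definable_subsets A = {hset {a \<in> A. ssat A f (e(0 := a))} | f e. range e \<subseteq> A}"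

inductive_set trcl :: "hc \<Rightarrow> hc set" for T where
  "T \<in> trcl T"
| "y \<in> trcl T \<Longrightarrow> hmem x y \<Longrightarrow> x \<in> trcl T"

definition L_hier :: "hc \<Rightarrow> om1 \<Rightarrow> hc set" where
  "L_hier T = orec (trcl T) definable_subsets \<Union>"

definition L_omega1 :: "hc \<Rightarrow> hc set" where
  "L_omega1 T = (\<Union>\<alpha>. L_hier T \<alpha>)"

text \<open>Admissibility in the sense of Kripke--Platek set theory. The remaining axioms,
  extensionality and foundation, hold in every transitive set.\<close>

definition KP_admissible :: "hc set \<Rightarrow> bool" where
  "KP_admissible A \<longleftrightarrow>
     A \<noteq> {} \<and>
     (\<forall>x y. y \<in> A \<and> hmem x y \<longrightarrow> x \<in> A) \<and>
     (\<forall>x \<in> A. \<forall>y \<in> A. \<exists>z \<in> A. hmem x z \<and> hmem y z) \<and>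
     (\<forall>x \<in> A. \<exists>z \<in> A. \<forall>y w. hmem y x \<and> hmem w y \<longrightarrow> hmem w z) \<and>
     (\<forall>f e. \<forall>a \<in> A. Delta0 f \<and> range e \<subseteq> A \<longrightarrow>
        (\<exists>b \<in> A. \<forall>u. hmem u b \<longleftrightarrow> hmem u a \<and> ssat A f (e(0 := u)))) \<and>
     (\<forall>f e. \<forall>a \<in> A. Delta0 f \<and> range e \<subseteq> A \<longrightarrow>
        (\<forall>u. hmem u a \<longrightarrow> (\<exists>v \<in> A. ssat A f (e(0 := u, 1 := v)))) \<longrightarrow>
        (\<exists>b \<in> A. \<forall>u. hmem u a \<longrightarrow> (\<exists>v. hmem v b \<and> ssat A f (e(0 := u, 1 := v)))))"

text \<open>The graph of g, as a relation on A, is both \<open>\<Sigma>\<^sub>1\<close> and \<open>\<Pi>\<^sub>1\<close> over A, with parameters from A.\<close>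

definition Delta1_over :: "hc set \<Rightarrow> (om1 \<Rightarrow> hc) \<Rightarrow> bool" where
  "Delta1_over A g \<longleftrightarrow>
     (\<forall>\<delta>. von_neumann \<delta> \<in> A \<and> g \<delta> \<in> A) \<and>
     (\<exists>f f' e e'. Sigma1 f \<and> Sigma1 f' \<and> range e \<subseteq> A \<and> range e' \<subseteq> A \<and>
        (\<forall>x \<in> A. \<forall>y \<in> A.
           ((\<exists>\<delta>. x = von_neumann \<delta> \<and> y = g \<delta>) \<longleftrightarrow> ssat A f (e(0 := x, 1 := y))) \<and>
           ((\<exists>\<delta>. x = von_neumann \<delta> \<and> y = g \<delta>) \<longleftrightarrow> \<not> ssat A f' (e'(0 := x, 1 := y)))))"


section \<open>The data supplied by Sacks' theorem\<close>

text \<open>\<open>Tb \<delta>\<close> is the node of level \<open>\<delta>\<close> on the branch and \<open>Lb \<delta>\<close> its fragment.\<close>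

definition sacks_branch :: "vocab \<Rightarrow> fml \<Rightarrow> (om1 \<Rightarrow> fml set) \<Rightarrow> (om1 \<Rightarrow> fml set) \<Rightarrow> bool" where
  "sacks_branch V \<phi> Lb Tb \<longleftrightarrow>
     (\<forall>\<delta>. node V \<phi> \<delta> (Lb \<delta>) (Tb \<delta>)) \<and>
     (\<forall>\<gamma> \<delta>. \<gamma> \<le> \<delta> \<longrightarrow> Lb \<gamma> \<subseteq> Lb \<delta> \<and> Tb \<gamma> \<subseteq> Tb \<delta>) \<and>
     (\<forall>\<delta>. is_limit \<delta> \<longrightarrow> Lb \<delta> = (\<Union>\<gamma><\<delta>. Lb \<gamma>) \<and> Tb \<delta> = (\<Union>\<gamma><\<delta>. Tb \<gamma>)) \<and>
     Delta1_over (L_omega1 (code_set (base_theory V \<phi>))) (\<lambda>\<delta>. code_set (Tb \<delta>)) \<and>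
     (\<forall>\<delta>. \<exists>A. atomic_model V (Lb \<delta>) (Tb \<delta>) A \<and> sr_sacks V A = \<delta>)"

definition sacks_club ::
    "vocab \<Rightarrow> fml \<Rightarrow> (om1 \<Rightarrow> fml set) \<Rightarrow> (om1 \<Rightarrow> fml set) \<Rightarrow> om1 set \<Rightarrow> bool" where
  "sacks_club V \<phi> Lb Tb C \<longleftrightarrow>
     club C \<and>
     (\<forall>\<kappa> \<in> C.
        omega < \<kappa> \<and>
        KP_admissible (L_hier (code_set (base_theory V \<phi>)) \<kappa>) \<and>
        nonprincipal_types V (Lb \<kappa>) (Tb \<kappa>) \<noteq> {} \<and>
        countable (nonprincipal_types V (Lb \<kappa>) (Tb \<kappa>)) \<and>
        (\<exists>B \<in> structures V.
           (\<forall>F \<in> Tb \<kappa>. B \<Turnstile> F) \<and>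
           (\<forall>p \<in> nonprincipal_types V (Lb \<kappa>) (Tb \<kappa>). realizes B p) \<and>
           omega1 V B = \<kappa> \<and> sr_sacks V B = osuc \<kappa>))"

definition S_circ :: "vocab \<Rightarrow> fml \<Rightarrow> om1 set \<Rightarrow> om1 set" where
  "S_circ V \<phi> C = F_set V \<phi> \<inter> C \<inter> {qr \<phi><..}"

definition trace_of :: "vocab \<Rightarrow> fml set \<Rightarrow> fml set \<Rightarrow> struct \<Rightarrow> fml set set" where
  "trace_of V L S M = {p \<in> nonprincipal_types V L S. realizes M p}"

end

theory Submission
  imports Defs
begin

text \<open>Let A be the atomic model of \<open>T\<^sub>\<kappa>\<close> and B the model of \<open>T\<^sub>\<kappa>\<close> that realizes its
  non-principal types. Equality of types over the fragment of level \<open>\<delta>\<close> implies equality of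
  \<open>\<Sigma>\<^sub>\<delta>\<close>-types, so a Scott sentence of A below level \<open>\<kappa>\<close> would be true in B, which is not
  isomorphic to A. Hence the Scott rank of A is at least \<open>\<kappa>\<close>, and A lies in \<open>C\<^sub>\<kappa>\<close> because
  \<open>f(\<kappa>) \<le> \<kappa>\<close>.

  Formulas in the fragment of level \<open>\<kappa>\<close> have rank below \<open>\<kappa>\<close>. This needs that \<open>\<kappa>\<close> is closed
  under \<open>\<delta> \<mapsto> qr(\<phi>) + \<omega>(1 + \<delta>)\<close>, which follows from \<open>\<kappa> = \<omega>\<^sub>1\<^sup>X\<close> for a real X,
  since X-computable well-orderings are closed under lexicographic products and initial segments.
  Consequently atomicity over \<open>T\<^sub>\<kappa>\<close> is expressed by a Scott sentence in \<open>\<Pi>\<close> of level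
  \<open>\<kappa> + 1\<close>, and the label K of level \<open>\<kappa> + 1\<close>, which lies in \<open>C\<^sub>\<kappa>\<close> together with A, is a model
  of \<open>T\<^sub>\<kappa>\<close>. If K realized no non-principal type, it would be atomic, and its Scott sentence would
  hold throughout the uncountable class \<open>C\<close> of level \<open>\<kappa> + 1\<close>.\<close>

section \<open>Countable ordinals\<close>

text \<open>The two comparisons between fragments and the hierarchy have different costs. From the
  hierarchy to fragments nothing is lost: the fragment of level \<delta> contains an isolating
  formula for every realized type of a nonempty tuple over a lower level, so a witness for a
  quantifier block can be copied into another model within level \<delta>. In the other direction
  one level of the tree can cost infinitely many ranks, since a fragment is closed under arbitrarily
  long finite chains of connectives and quantifiers; hence the block of length \<omega> for each
  level and the closure demanded of \<kappa>. Ordinal arithmetic is replaced by lexicographic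
  products of computable orderings.

  The level \<kappa> + 1 matters twice. Saying that every tuple satisfies one of countably many
  generators puts a universal block in front of a \<Sigma> disjunction of level \<kappa>, and
  \<kappa> + 1 is also the level at which K agrees with all of its class. The role of B is to be a
  second model of the theory that is not isomorphic to A: no sentence of a level below \<kappa>
  separates the two.\<close>

text \<open>Regularity of \<open>\<omega>\<^sub>1\<close>: without a strict bound, the countable
  initial segments given by A would cover everything. The successor and all suprema of countably
  many levels rest on this.\<close>

lemma om1_bounded:
  assumes "countable (A :: om1 set)"
  shows "\<exists>\<beta>. \<forall>\<alpha>\<in>A. \<alpha> < \<beta>"
proof (rule ccontr)
  assume "\<nexists>\<beta>. \<forall>\<alpha>\<in>A. \<alpha> < \<beta>"
  then have "UNIV \<subseteq> (\<Union>\<alpha>\<in>A. insert \<alpha> {..<\<alpha>})"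
    by (fastforce simp: not_less le_less)
  moreover have "countable (\<Union>\<alpha>\<in>A. insert \<alpha> {..<\<alpha>})"
    using assms om1_countable_below by auto
  ultimately show False
    using om1_uncountable countable_subset by blast
qed

lemma zero_le_om1 [simp]: "(0 :: om1) \<le> \<alpha>"
  unfolding zero_om1_def by (simp add: Least_le)

lemma not_less_zero_om1 [simp]: "\<not> \<alpha> < (0 :: om1)"
  by (simp add: not_less)

lemma less_osuc [simp]: "\<alpha> < osuc \<alpha>"
proof -
  obtain \<beta> where "\<alpha> < \<beta>"
    using om1_bounded[of "{\<alpha>}"] by auto
  then show ?thesis
    unfolding osuc_def by (rule LeastI)
qed

lemma osuc_le: "\<alpha> < \<beta> \<Longrightarrow> osuc \<alpha> \<le> \<beta>"
  unfolding osuc_def by (rule Least_le)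

lemma less_osuc_iff: "\<beta> < osuc \<alpha> \<longleftrightarrow> \<beta> \<le> \<alpha>"
  by (meson le_less_trans less_osuc linorder_not_less osuc_le)

lemma osuc_inject [simp]: "osuc \<alpha> = osuc \<beta> \<longleftrightarrow> \<alpha> = \<beta>"
  by (metis less_osuc less_osuc_iff order.antisym)

lemma osuc_pos [simp]: "0 < osuc \<alpha>"
  by (rule le_less_trans[OF zero_le_om1 less_osuc])

lemma osuc_neq_zero [simp]: "osuc \<alpha> \<noteq> 0" "0 \<noteq> osuc \<alpha>"
  by (metis less_irrefl osuc_pos)+

lemma not_is_limit_osuc [simp]: "\<not> is_limit (osuc \<alpha>)"
  unfolding is_limit_def by (metis less_irrefl less_osuc)

lemma om1_cases:
  obtains "\<alpha> = 0" | \<beta> where "\<alpha> = osuc \<beta>" | "is_limit \<alpha>"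
proof (cases "\<alpha> = 0 \<or> is_limit \<alpha>")
  case False
  then obtain \<beta> where "\<beta> < \<alpha>" "\<not> osuc \<beta> < \<alpha>"
    unfolding is_limit_def by auto
  then have "\<alpha> = osuc \<beta>"
    using osuc_le by (meson order.antisym not_less)
  then show ?thesis
    using that by blast
qed (use that in blast)

section \<open>The finite ordinals and \<omega>\<close>

definition fin_ord :: "nat \<Rightarrow> om1" where
  "fin_ord n = (osuc ^^ n) 0"

lemma fin_ord_strict_mono: "m < n \<Longrightarrow> fin_ord m < fin_ord n"
proof -
  have "fin_ord k < fin_ord (Suc k)" for k
    by (simp add: fin_ord_def)
  then have "strict_mono fin_ord"
    by (simp add: strict_mono_Suc_iff)
  then show "m < n \<Longrightarrow> fin_ord m < fin_ord n"
    by (rule strict_monoD)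
qed

text \<open>\<open>omega\<close> is a least limit by definition, so some limit must be exhibited.
  The least strict bound of the finite ordinals is one: anything below it fails to be a bound, so it
  lies at or below a finite ordinal, and its successor at or below the next.\<close>

lemma is_limit_omega: "is_limit omega"
proof -
  define \<sigma> where "\<sigma> = (LEAST \<sigma>. \<forall>\<alpha>\<in>range fin_ord. \<alpha> < \<sigma>)"
  have above: "fin_ord n < \<sigma>" for n
    using LeastI_ex[OF om1_bounded[of "range fin_ord"]] unfolding \<sigma>_def by auto
  have "osuc \<alpha> < \<sigma>" if "\<alpha> < \<sigma>" for \<alpha>
  proof -
    have "\<not> (\<forall>\<beta>\<in>range fin_ord. \<beta> < \<alpha>)"
      using that unfolding \<sigma>_def by (rule not_less_Least)
    then obtain n where "\<alpha> \<le> fin_ord n"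
      by (auto simp: not_less)
    then have "osuc \<alpha> \<le> fin_ord (Suc n)"
      by (simp add: fin_ord_def osuc_le less_osuc_iff)
    then show ?thesis
      using above[of "Suc n"] by simp
  qed
  then have "is_limit \<sigma>"
    using above[of 0] unfolding is_limit_def by (metis not_less_zero_om1)
  then show ?thesis
    unfolding omega_def by (rule LeastI)
qed

lemma fin_ord_less_omega: "fin_ord n < omega"
proof (induction n)
  case 0
  then show ?case
    using is_limit_omega unfolding is_limit_def fin_ord_def by (simp add: order.not_eq_order_implies_strict)
qed (use is_limit_omega in \<open>auto simp: fin_ord_def is_limit_def\<close>)

section \<open>Initial segments of the countable ordinals as well-orderings\<close>

definition seg_rel :: "om1 \<Rightarrow> om1 rel" where
  "seg_rel \<alpha> = {(\<beta>, \<gamma>). \<beta> \<le> \<gamma> \<and> \<gamma> < \<alpha>}"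

lemma Field_seg_rel: "Field (seg_rel \<alpha>) = {..<\<alpha>}"
  by (auto simp: seg_rel_def Field_def Domain_iff Range_iff)

lemma Well_order_seg_rel: "Well_order (seg_rel \<alpha>)"
proof -
  have "wf (seg_rel \<alpha> - Id)"
    by (rule wf_subset[OF wf[where 'a = om1]]) (auto simp: seg_rel_def)
  moreover have "Refl (seg_rel \<alpha>)" "trans (seg_rel \<alpha>)" "antisym (seg_rel \<alpha>)" "Total (seg_rel \<alpha>)"
    unfolding refl_on_def trans_def antisym_def total_on_def Field_seg_rel
    by (auto simp: seg_rel_def)
  ultimately show ?thesis
    unfolding well_order_on_def linear_order_on_def partial_order_on_def preorder_on_def
    by (auto simp: Field_def)
qed

text \<open>Rigidity of well-orderings: if f x < x, then f (f x) < f x contradicts the induction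
  hypothesis at f x. Monotonicity is asked below \<alpha> only, since it is available for maps on a
  segment.\<close>

lemma strict_mono_ge:
  fixes f :: "om1 \<Rightarrow> om1"
  assumes "\<And>x y. x < y \<Longrightarrow> y < \<alpha> \<Longrightarrow> f x < f y" and "x < \<alpha>"
  shows "x \<le> f x"
  using assms(2)
proof (induction x rule: less_induct)
  case (less x)
  show ?case
  proof (rule ccontr)
    assume "\<not> x \<le> f x"
    then have "f x < x" by simp
    then have "f x \<le> f (f x)" "f (f x) < f x"
      using less assms(1)[of "f x" x] by auto
    then show False by simp
  qed
qed

lemma seg_rel_ordIso_iff:
  "(r, seg_rel \<alpha>) \<in> ordIso \<longleftrightarrow> Well_order r \<and>
     (\<exists>f. bij_betw f (Field r) {..<\<alpha>} \<and> (\<forall>a \<in> Field r. \<forall>b \<in> Field r. (a, b) \<in> r \<longleftrightarrow> f a \<le> f b))"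
proof -
  have "(f a, f b) \<in> seg_rel \<alpha> \<longleftrightarrow> f a \<le> f b"
    if "bij_betw f (Field r) {..<\<alpha>}" "b \<in> Field r" for f a b
    using that by (auto simp: seg_rel_def dest!: bij_betw_imp_surj_on)
  then show ?thesis
    unfolding ordIso_def iso_iff2 mem_Collect_eq split_conv
    using Well_order_seg_rel[of \<alpha>] unfolding Field_seg_rel by meson
qed

text \<open>An isomorphism from a longer segment onto the ordinals below \<alpha> is strictly
  increasing, so it sends \<alpha> to something at least \<alpha>, which lies outside its
  range.\<close>

lemma seg_rel_ordIso_eq:
  assumes "(seg_rel \<alpha>, seg_rel \<beta>) \<in> ordIso"
  shows "\<alpha> = \<beta>"
proof -
  have "\<not> \<alpha> < \<beta>" if "(seg_rel \<beta>, seg_rel \<alpha>) \<in> ordIso" for \<alpha> \<beta>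
  proof
    assume "\<alpha> < \<beta>"
    from that obtain f where f: "bij_betw f {..<\<beta>} {..<\<alpha>}"
      and mono: "\<forall>a<\<beta>. \<forall>b<\<beta>. (a, b) \<in> seg_rel \<beta> \<longleftrightarrow> f a \<le> f b"
      unfolding seg_rel_ordIso_iff Field_seg_rel by auto
    have "f x < f y" if "x < y" "y < \<beta>" for x y
    proof -
      have "\<not> f y \<le> f x"
        using mono[rule_format, of y x] that less_trans[OF that] by (auto simp: seg_rel_def)
      then show ?thesis by simp
    qed
    then have "\<alpha> \<le> f \<alpha>"
      using strict_mono_ge \<open>\<alpha> < \<beta>\<close> by blast
    moreover have "f \<alpha> < \<alpha>"
      using f \<open>\<alpha> < \<beta>\<close> by (auto dest!: bij_betw_imp_surj_on)
    ultimately show False by simp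
  qed
  from this[OF assms] this[OF ordIso_symmetric[OF assms]] show ?thesis
    by simp
qed

section \<open>Relative computability\<close>

text \<open>Induction on the first evaluation while inverting the second. A program therefore
  determines the set that it decides, which bounds the computable orderings by the programs.\<close>

lemma reval_deterministic:
  "reval X f xs y \<Longrightarrow> reval X f xs z \<Longrightarrow> y = z"
proof (induction arbitrary: z rule: reval.induct)
  case (5 xs gs ys f y z')
  from 5(4) obtain ys' where ys': "list_all2 (\<lambda>g y. reval X g xs y) gs ys'" "reval X f ys' z'"
    by (auto elim: reval.cases)
  have "ys = ys'"
    using 5(1) ys'(1) by (auto simp: list_all2_conv_all_nth intro!: nth_equalityI)
  then show ?case
    using 5 ys' by auto
next
  case (6 f xs y g z)
  from 6(3) have "reval X f xs z"
    by (auto elim: reval.cases)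
  then show ?case using 6 by auto
next
  case (7 f g n xs y z z')
  from 7(5) obtain y' where "reval X (Prec f g) (n # xs) y'" "reval X g (n # y' # xs) z'"
    by (cases rule: reval.cases) auto
  then show ?case using 7 by auto
next
  case (8 f n xs z)
  from 8(4) have *: "reval X f (z # xs) 0" "\<forall>m<z. \<exists>y>0. reval X f (m # xs) y"
    by (auto elim: reval.cases)
  show ?case
  proof (rule ccontr)
    assume "n \<noteq> z"
    \<comment> \<open>Of two distinct results of a search, the smaller one is a zero by one
      evaluation and positive by the other.\<close>
    then consider "n < z" | "z < n" by linarith
    then show False
    proof cases
      case 1
      then show False using * 8(2) by blast
    next
      case 2
      then show False using * 8(3) by blast
    qed
  qed
qed (auto elim: reval.cases)

text \<open>Computability is attached to functions on argument lists of a fixed length k, so that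
  programs are assembled by closure lemmas and need not be written out. Values on lists of other
  lengths are irrelevant.\<close>

definition rcomp :: "nat set \<Rightarrow> nat \<Rightarrow> (nat list \<Rightarrow> nat) \<Rightarrow> bool" where
  "rcomp X k F \<longleftrightarrow> (\<exists>f. \<forall>xs. length xs = k \<longrightarrow> reval X f xs (F xs))"

lemma rcomp_cong: "rcomp X k F \<Longrightarrow> (\<And>xs. length xs = k \<Longrightarrow> F xs = G xs) \<Longrightarrow> rcomp X k G"
  unfolding rcomp_def by force

lemma rcomp_nth: "i < k \<Longrightarrow> rcomp X k (\<lambda>xs. xs ! i)"
  unfolding rcomp_def by (auto intro: reval.intros)

lemma rcomp_zero: "rcomp X k (\<lambda>xs. 0)"
  unfolding rcomp_def by (auto intro: reval.intros)

lemma rcomp_comp1: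
  assumes "rcomp X 1 (\<lambda>xs. u (xs ! 0))" "rcomp X k F"
  shows "rcomp X k (\<lambda>xs. u (F xs))"
proof -
  obtain f where f: "\<And>x. reval X f [x] (u x)"
    using assms(1) unfolding rcomp_def by (metis One_nat_def length_0_conv length_Suc_conv nth_Cons_0)
  obtain g where g: "\<forall>xs. length xs = k \<longrightarrow> reval X g xs (F xs)"
    using assms(2) unfolding rcomp_def by blast
  have "reval X (Comp f [g]) xs (u (F xs))" if "length xs = k" for xs
    by (rule reval.intros(5)[of _ _ _ "[F xs]"]) (use f g that in auto)
  then show ?thesis
    unfolding rcomp_def by blast
qed

lemma rcomp_comp2:
  assumes "rcomp X 2 (\<lambda>xs. u (xs ! 0) (xs ! 1))" "rcomp X k F" "rcomp X k G"
  shows "rcomp X k (\<lambda>xs. u (F xs) (G xs))"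
proof -
  obtain f0 where "\<forall>xs. length xs = 2 \<longrightarrow> reval X f0 xs (u (xs ! 0) (xs ! 1))"
    using assms(1) unfolding rcomp_def by blast
  from this[rule_format, of "[x, y]" for x y] have f: "\<And>x y. reval X f0 [x, y] (u x y)"
    by simp
  obtain g where g: "\<forall>xs. length xs = k \<longrightarrow> reval X g xs (F xs)"
    using assms(2) unfolding rcomp_def by blast
  obtain h where h: "\<forall>xs. length xs = k \<longrightarrow> reval X h xs (G xs)"
    using assms(3) unfolding rcomp_def by blast
  have "reval X (Comp f0 [g, h]) xs (u (F xs) (G xs))" if "length xs = k" for xs
    by (rule reval.intros(5)[of _ _ _ "[F xs, G xs]"]) (use f g h that in auto)
  then show ?thesis
    unfolding rcomp_def by blast
qed

lemma rcomp_Prec: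
  assumes "rcomp X k F" "rcomp X (Suc (Suc k)) G"
  shows "rcomp X (Suc k) (\<lambda>xs. rec_nat (F (tl xs)) (\<lambda>n y. G (n # y # tl xs)) (hd xs))"
proof -
  obtain f where f: "\<forall>xs. length xs = k \<longrightarrow> reval X f xs (F xs)"
    using assms(1) unfolding rcomp_def by blast
  obtain g where g: "\<forall>xs. length xs = Suc (Suc k) \<longrightarrow> reval X g xs (G xs)"
    using assms(2) unfolding rcomp_def by blast
  have "reval X (Prec f g) (n # xs) (rec_nat (F xs) (\<lambda>n y. G (n # y # xs)) n)"
    if "length xs = k" for n xs
    by (induction n) (use f g that in \<open>auto intro: reval.intros\<close>)
  then have "reval X (Prec f g) xs (rec_nat (F (tl xs)) (\<lambda>n y. G (n # y # tl xs)) (hd xs))"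
    if "length xs = Suc k" for xs
    using that by (cases xs) auto
  then show ?thesis
    unfolding rcomp_def by blast
qed

lemma rcomp_Suc:
  assumes "rcomp X k F"
  shows "rcomp X k (\<lambda>xs. Suc (F xs))"
proof (rule rcomp_comp1[OF _ assms])
  show "rcomp X 1 (\<lambda>xs. Suc (xs ! 0))"
    unfolding rcomp_def using reval.intros(2) by (metis One_nat_def length_Suc_conv nth_Cons_0)
qed

lemma rcomp_const: "rcomp X k (\<lambda>xs. c)"
  by (induction c) (auto intro: rcomp_zero rcomp_Suc)

lemma rcomp_oracle: "rcomp X 1 (\<lambda>xs. if xs ! 0 \<in> X then 1 else 0)"
  unfolding rcomp_def using reval.intros(4) by (metis One_nat_def length_Suc_conv nth_Cons_0)

text \<open>The parameter of the recursion is a single value, which suffices to obtain addition,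
  subtraction and triangle numbers by instantiating a and b.\<close>

lemma rcomp_rec_nat:
  assumes a: "rcomp X 1 (\<lambda>xs. a (xs ! 0))"
    and b: "rcomp X (Suc (Suc 1)) (\<lambda>xs. b (xs ! 0) (xs ! 1) (xs ! 2))"
    and "rcomp X k F" "rcomp X k G"
  shows "rcomp X k (\<lambda>xs. rec_nat (a (G xs)) (\<lambda>n y. b n y (G xs)) (F xs))"
proof (rule rcomp_comp2[where u = "\<lambda>x z. rec_nat (a z) (\<lambda>n y. b n y z) x", OF _ assms(3,4)])
  have "rcomp X 2 (\<lambda>xs. rec_nat (a (tl xs ! 0))
      (\<lambda>n y. b ((n # y # tl xs) ! 0) ((n # y # tl xs) ! 1) ((n # y # tl xs) ! 2)) (hd xs))"
    using rcomp_Prec[OF a b] by (simp add: numeral_2_eq_2)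
  then show "rcomp X 2 (\<lambda>xs. rec_nat (a (xs ! 1)) (\<lambda>n y. b n y (xs ! 1)) (xs ! 0))"
    by (rule rcomp_cong) (auto simp: numeral_2_eq_2 length_Suc_conv)
qed

lemma rcomp_add:
  assumes "rcomp X k F" "rcomp X k G"
  shows "rcomp X k (\<lambda>xs. F xs + G xs)"
proof -
  have "rec_nat z (\<lambda>n y. Suc y) x = x + z" for x z :: nat
    by (induction x) simp_all
  then show ?thesis
    using rcomp_rec_nat[OF rcomp_nth rcomp_Suc[OF rcomp_nth[of 1]] assms] by simp
qed

lemma rcomp_pred:
  assumes "rcomp X k F"
  shows "rcomp X k (\<lambda>xs. F xs - 1)"
proof -
  have "rec_nat 0 (\<lambda>n y. n) x = x - 1" for x :: nat
    by (cases x) simp_all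
  then show ?thesis
    using rcomp_rec_nat[OF rcomp_zero rcomp_nth[of 0] assms assms] by simp
qed

lemma rcomp_diff:
  assumes "rcomp X k F" "rcomp X k G"
  shows "rcomp X k (\<lambda>xs. F xs - G xs)"
proof -
  have "rec_nat z (\<lambda>n y. y - 1) x = z - x" for x z :: nat
    by (induction x) simp_all
  then show ?thesis
    using rcomp_rec_nat[OF rcomp_nth rcomp_pred[OF rcomp_nth[of 1]] assms(2,1)] by simp
qed

lemma rcomp_triangle:
  assumes "rcomp X k F"
  shows "rcomp X k (\<lambda>xs. triangle (F xs))"
proof -
  have "rec_nat 0 (\<lambda>n y. y + Suc n) x = triangle x" for x
    by (induction x) simp_all
  then show ?thesis
    using rcomp_rec_nat[OF rcomp_zero rcomp_add[OF rcomp_nth[of 1] rcomp_Suc[OF rcomp_nth[of 0]]] assms assms]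
    by simp
qed

lemma rcomp_Mn:
  assumes "rcomp X (Suc k) F" and "\<And>xs. length xs = k \<Longrightarrow> \<exists>n. F (n # xs) = 0"
  shows "rcomp X k (\<lambda>xs. LEAST n. F (n # xs) = 0)"
proof -
  obtain f where f: "\<forall>xs. length xs = Suc k \<longrightarrow> reval X f xs (F xs)"
    using assms(1) unfolding rcomp_def by blast
  have "reval X (Mn f) xs (LEAST n. F (n # xs) = 0)" if "length xs = k" for xs
  proof (rule reval.intros(8))
    have "F ((LEAST n. F (n # xs) = 0) # xs) = 0"
      using assms(2)[OF that] by (rule LeastI_ex)
    then show "reval X f ((LEAST n. F (n # xs) = 0) # xs) 0"
      using f[rule_format, of "(LEAST n. F (n # xs) = 0) # xs"] that by simp
    show "\<forall>m<LEAST n. F (n # xs) = 0. \<exists>y>0. reval X f (m # xs) y"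
    proof (intro allI impI)
      fix m
      assume "m < (LEAST n. F (n # xs) = 0)"
      then have "F (m # xs) \<noteq> 0"
        by (rule not_less_Least)
      then show "\<exists>y>0. reval X f (m # xs) y"
        using f[rule_format, of "m # xs"] that by auto
    qed
  qed
  then show ?thesis
    unfolding rcomp_def by blast
qed

text \<open>The code of (m, n) is triangle (m + n) + m, so m + n is the least w with c < triangle (w
  + 1). The truncated difference turns this inequality into a test for zero, the form required by
  unbounded search.\<close>

lemma prod_decode_by_triangle:
  fixes c :: nat
  defines "w \<equiv> LEAST w. Suc c - triangle (Suc w) = 0"
  shows "prod_decode c = (c - triangle w, w - (c - triangle w))"
proof -
  obtain m n where mn: "c = prod_encode (m, n)"
    by (metis prod_decode_inverse surj_pair)
  have mono: "triangle a \<le> triangle b" if "a \<le> b" for a b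
    using that by (rule lift_Suc_mono_le[rotated]) simp
  have "w = m + n"
    unfolding w_def
  proof (rule Least_equality)
    show "Suc c - triangle (Suc (m + n)) = 0"
      by (simp add: mn prod_encode_def)
    fix y
    assume y: "Suc c - triangle (Suc y) = 0"
    show "m + n \<le> y"
    proof (rule ccontr)
      assume "\<not> m + n \<le> y"
      then have "triangle (Suc y) \<le> triangle (m + n)"
        by (intro mono) simp
      then show False
        using y by (simp add: mn prod_encode_def)
    qed
  qed
  then show ?thesis
    by (simp add: mn) (simp add: prod_encode_def)
qed

lemma rcomp_prod_decode:
  assumes "rcomp X k F"
  shows "rcomp X k (\<lambda>xs. fst (prod_decode (F xs)))" "rcomp X k (\<lambda>xs. snd (prod_decode (F xs)))"
proof -
  let ?w = "\<lambda>c. LEAST w. Suc c - triangle (Suc w) = 0"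
  have "rcomp X 1 (\<lambda>xs. LEAST w. Suc ((w # xs) ! 1) - triangle (Suc ((w # xs) ! 0)) = 0)"
  proof (rule rcomp_Mn)
    show "rcomp X (Suc 1) (\<lambda>xs. Suc (xs ! 1) - triangle (Suc (xs ! 0)))"
      by (intro rcomp_diff rcomp_triangle rcomp_Suc rcomp_nth) simp_all
    \<comment> \<open>The search terminates, at c at the latest.\<close>
    have "c < triangle (Suc c)" for c
      by (induction c) auto
    then have "Suc ((xs ! 0 # xs) ! 1) - triangle (Suc ((xs ! 0 # xs) ! 0)) = 0" for xs
      by (metis One_nat_def Suc_leI diff_is_0_eq nth_Cons_0 nth_Cons_Suc)
    then show "\<exists>n. Suc ((n # xs) ! 1) - triangle (Suc ((n # xs) ! 0)) = 0" for xs :: "nat list"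
      by blast
  qed
  then have w: "rcomp X 1 (\<lambda>xs. ?w (xs ! 0))"
    by simp
  show "rcomp X k (\<lambda>xs. fst (prod_decode (F xs)))"
    unfolding prod_decode_by_triangle fst_conv
    by (intro rcomp_diff rcomp_triangle assms rcomp_comp1[OF w])
  show "rcomp X k (\<lambda>xs. snd (prod_decode (F xs)))"
    unfolding prod_decode_by_triangle snd_conv
    by (intro rcomp_diff rcomp_triangle assms rcomp_comp1[OF w])
qed

lemma rcomp_prod_encode:
  assumes "rcomp X k F" "rcomp X k G"
  shows "rcomp X k (\<lambda>xs. prod_encode (F xs, G xs))"
  unfolding prod_encode_def split_conv
  by (intro rcomp_add rcomp_triangle assms)

definition rdec :: "nat set \<Rightarrow> nat \<Rightarrow> (nat list \<Rightarrow> bool) \<Rightarrow> bool" where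
  "rdec X k P \<longleftrightarrow> rcomp X k (\<lambda>xs. if P xs then 1 else 0)"

lemma rdec_not: "rdec X k P \<Longrightarrow> rdec X k (\<lambda>xs. \<not> P xs)"
  unfolding rdec_def
  by (rule rcomp_cong[OF rcomp_diff[OF rcomp_const[of _ _ 1]]]) auto

lemma rdec_disj:
  assumes "rdec X k P" "rdec X k Q"
  shows "rdec X k (\<lambda>xs. P xs \<or> Q xs)"
proof -
  have "rcomp X k (\<lambda>xs. 1 - (1 - ((if P xs then 1 else 0) + (if Q xs then 1 else 0))))"
    using assms unfolding rdec_def by (intro rcomp_diff rcomp_add rcomp_const)
  then show ?thesis
    unfolding rdec_def by (rule rcomp_cong) auto
qed

lemma rdec_conj: "rdec X k P \<Longrightarrow> rdec X k Q \<Longrightarrow> rdec X k (\<lambda>xs. P xs \<and> Q xs)"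
  using rdec_not[OF rdec_disj[OF rdec_not rdec_not]] by fastforce

lemma rdec_eq:
  assumes "rcomp X k F" "rcomp X k G"
  shows "rdec X k (\<lambda>xs. F xs = G xs)"
proof -
  have "rcomp X k (\<lambda>xs. 1 - ((F xs - G xs) + (G xs - F xs)))"
    by (intro rcomp_diff rcomp_add assms rcomp_const)
  then show ?thesis
    unfolding rdec_def by (rule rcomp_cong) auto
qed

lemma computable_from_iff_rdec: "computable_from X A \<longleftrightarrow> rdec X 1 (\<lambda>xs. xs ! 0 \<in> A)"
proof
  assume "computable_from X A"
  then show "rdec X 1 (\<lambda>xs. xs ! 0 \<in> A)"
    unfolding computable_from_def rdec_def rcomp_def
    by (metis One_nat_def length_0_conv length_Suc_conv nth_Cons_0)
next
  assume "rdec X 1 (\<lambda>xs. xs ! 0 \<in> A)"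
  then obtain f where "\<forall>xs. length xs = 1 \<longrightarrow> reval X f xs (if xs ! 0 \<in> A then 1 else 0)"
    unfolding rdec_def rcomp_def by blast
  from this[rule_format, of "[n]" for n] have "reval X f [n] (if n \<in> A then 1 else 0)" for n
    by simp
  then show "computable_from X A"
    unfolding computable_from_def by blast
qed

lemma computable_from_self: "computable_from X X"
  unfolding computable_from_iff_rdec rdec_def by (rule rcomp_oracle)

section \<open>Computable well-orderings\<close>

definition comp_rel :: "nat set \<Rightarrow> nat rel \<Rightarrow> bool" where
  "comp_rel X r \<longleftrightarrow> Well_order r \<and> computable_from X (prod_encode ` r)"

lemma prod_encode_mem_image [simp]: "prod_encode p \<in> prod_encode ` r \<longleftrightarrow> p \<in> r"
  by (auto simp: image_iff)

lemma rdec_rel: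
  assumes "computable_from X (prod_encode ` r)" "rcomp X k F" "rcomp X k G"
  shows "rdec X k (\<lambda>xs. (F xs, G xs) \<in> r)"
proof -
  have "rcomp X k (\<lambda>xs. if prod_encode (F xs, G xs) \<in> prod_encode ` r then 1 else 0)"
    using assms(1) unfolding computable_from_iff_rdec rdec_def
    by (rule rcomp_comp1) (intro rcomp_prod_encode assms)
  then show ?thesis
    unfolding rdec_def by simp
qed

lemma computable_relI:
  assumes "rdec X 1 (\<lambda>xs. (fst (prod_decode (xs ! 0)), snd (prod_decode (xs ! 0))) \<in> r)"
  shows "computable_from X (prod_encode ` r)"
proof -
  have "n \<in> prod_encode ` r \<longleftrightarrow> prod_decode n \<in> r" for n
    by (metis prod_decode_inverse prod_encode_mem_image)
  then show ?thesis
    using assms unfolding computable_from_iff_rdec by simp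
qed

text \<open>The element a enters the program as a constant; lying strictly below it is decided by a
  query to r and a test for equality.\<close>

lemma comp_rel_initial_segment:
  assumes "comp_rel X r"
  shows "comp_rel X (Restr r (underS r a))"
proof -
  have r: "Well_order r" "computable_from X (prod_encode ` r)"
    using assms by (auto simp: comp_rel_def)
  have "rdec X 1 (\<lambda>xs. ((fst (prod_decode (xs ! 0)), snd (prod_decode (xs ! 0))) \<in> r \<and>
      (\<not> fst (prod_decode (xs ! 0)) = a \<and> (fst (prod_decode (xs ! 0)), a) \<in> r)) \<and>
      \<not> snd (prod_decode (xs ! 0)) = a \<and> (snd (prod_decode (xs ! 0)), a) \<in> r)"
    by (intro rdec_conj rdec_not rdec_eq rdec_rel[OF r(2)] rcomp_prod_decode rcomp_nth rcomp_const) auto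
  then have "computable_from X (prod_encode ` (Restr r (underS r a)))"
    by (intro computable_relI) (simp add: underS_def mem_Times_iff conj_ac)
  then show ?thesis
    using Well_order_Restr[OF r(1)] by (simp add: comp_rel_def)
qed

text \<open>The lexicographic product with r as the more significant factor, on codes of pairs so
  that it is again a relation on numbers. The reflexive conditions on s keep the second coordinates
  in its field even where the first ones differ.\<close>

definition lex_rel :: "nat rel \<Rightarrow> nat rel \<Rightarrow> nat rel" where
  "lex_rel r s = {(x, y). \<exists>a b a' b'. x = prod_encode (a, b) \<and> y = prod_encode (a', b') \<and>
     (a, a') \<in> r \<and> (b, b) \<in> s \<and> (b', b') \<in> s \<and> (a = a' \<longrightarrow> (b, b') \<in> s)}"

lemma lex_rel_iff [simp]:
  "(prod_encode (a, b), prod_encode (a', b')) \<in> lex_rel r s \<longleftrightarrow>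
     (a, a') \<in> r \<and> (b, b) \<in> s \<and> (b', b') \<in> s \<and> (a = a' \<longrightarrow> (b, b') \<in> s)"
  by (auto simp: lex_rel_def)

lemma Well_order_refl: "Well_order r \<Longrightarrow> (a, a) \<in> r \<longleftrightarrow> a \<in> Field r"
  by (auto simp: well_order_on_def linear_order_on_def partial_order_on_def preorder_on_def
    refl_on_def Field_def)

lemma Field_lex_rel:
  assumes "Well_order r" "Well_order s"
  shows "Field (lex_rel r s) = prod_encode ` (Field r \<times> Field s)"
proof (intro set_eqI iffI)
  fix x
  assume "x \<in> Field (lex_rel r s)"
  then show "x \<in> prod_encode ` (Field r \<times> Field s)"
    using assms unfolding Field_def lex_rel_def by (auto simp: Domain_iff Range_iff)
next
  fix x
  assume "x \<in> prod_encode ` (Field r \<times> Field s)"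
  then have "(x, x) \<in> lex_rel r s"
    using assms by (auto simp: Well_order_refl)
  then show "x \<in> Field (lex_rel r s)"
    by (auto simp: Field_def)
qed

lemma comp_rel_lex:
  assumes "comp_rel X r" "comp_rel X s"
  shows "comp_rel X (lex_rel r s)"
proof -
  have r: "Well_order r" "computable_from X (prod_encode ` r)"
    and s: "Well_order s" "computable_from X (prod_encode ` s)"
    using assms by (auto simp: comp_rel_def)
  note W = well_order_on_def linear_order_on_def partial_order_on_def preorder_on_def
  have tr: "trans r" "antisym r" "Total r" "wf (r - Id)" "trans s" "antisym s" "Total s" "wf (s - Id)"
    using r(1) s(1) by (auto simp: W)
  have "Refl (lex_rel r s)"
    unfolding refl_on_def Field_lex_rel[OF r(1) s(1)]
    using r(1) s(1) by (auto simp: Well_order_refl)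
  moreover have "trans (lex_rel r s)"
  proof (rule transI)
    fix x y z
    assume *: "(x, y) \<in> lex_rel r s" "(y, z) \<in> lex_rel r s"
    obtain a b a' b' a'' b'' where xyz: "x = prod_encode (a, b)" "y = prod_encode (a', b')" "z = prod_encode (a'', b'')"
      by (metis prod_decode_inverse surj_pair)
    have "a = a' \<and> a' = a''" if "a = a''"
      using * that antisymD[OF tr(2), of a a'] by (simp add: xyz)
    moreover have "(a, a'') \<in> r"
      using * transD[OF tr(1), of a a' a''] by (simp add: xyz)
    moreover have "(b, b'') \<in> s" if "(b, b') \<in> s" "(b', b'') \<in> s"
      using that tr(5) by (rule transD[rotated])
    ultimately show "(x, z) \<in> lex_rel r s"
      using * by (auto simp: xyz)
  qed
  moreover have "antisym (lex_rel r s)"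
  proof (rule antisymI)
    fix x y
    assume *: "(x, y) \<in> lex_rel r s" "(y, x) \<in> lex_rel r s"
    obtain a b a' b' where xy: "x = prod_encode (a, b)" "y = prod_encode (a', b')"
      by (metis prod_decode_inverse surj_pair)
    show "x = y"
      using * antisymD[OF tr(2), of a a'] antisymD[OF tr(6), of b b'] by (simp add: xy)
  qed
  moreover have "Total (lex_rel r s)"
  proof -
    have "(prod_encode (a, b), prod_encode (a', b')) \<in> lex_rel r s \<or>
        (prod_encode (a', b'), prod_encode (a, b)) \<in> lex_rel r s"
      if "a \<in> Field r" "b \<in> Field s" "a' \<in> Field r" "b' \<in> Field s" for a b a' b'
    proof -
      have *: "(b, b) \<in> s" "(b', b') \<in> s" "(a, a) \<in> r"
        using that r(1) s(1) by (simp_all add: Well_order_refl)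
      have "(b, b') \<in> s \<or> (b', b) \<in> s"
        using tr(7)[unfolded total_on_def, rule_format, of b b'] that * by (cases "b = b'") simp_all
      moreover have "(a, a') \<in> r \<or> (a', a) \<in> r"
        using tr(3)[unfolded total_on_def, rule_format, of a a'] that * by (cases "a = a'") simp_all
      ultimately show ?thesis
        using * by auto
    qed
    then show ?thesis
      unfolding total_on_def Field_lex_rel[OF r(1) s(1)] by auto
  qed
  moreover have "wf (lex_rel r s - Id)"
  proof (rule wf_subset)
    show "wf (inv_image ((r - Id) <*lex*> (s - Id)) prod_decode)"
      by (intro wf_inv_image wf_lex_prod tr)
    show "lex_rel r s - Id \<subseteq> inv_image ((r - Id) <*lex*> (s - Id)) prod_decode"
      by (auto simp: lex_rel_def inv_image_def)
  qed
  moreover have "computable_from X (prod_encode ` lex_rel r s)"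
  proof (rule computable_relI)
    let ?x = "\<lambda>xs. fst (prod_decode (xs ! 0))" and ?y = "\<lambda>xs. snd (prod_decode (xs ! 0))"
    let ?a = "\<lambda>xs. fst (prod_decode (?x xs))" and ?b = "\<lambda>xs. snd (prod_decode (?x xs))"
    let ?a' = "\<lambda>xs. fst (prod_decode (?y xs))" and ?b' = "\<lambda>xs. snd (prod_decode (?y xs))"
    have lex_iff: "(x, y) \<in> lex_rel r s \<longleftrightarrow> (fst (prod_decode x), fst (prod_decode y)) \<in> r \<and>
       (snd (prod_decode x), snd (prod_decode x)) \<in> s \<and> (snd (prod_decode y), snd (prod_decode y)) \<in> s \<and>
       (\<not> fst (prod_decode x) = fst (prod_decode y) \<or> (snd (prod_decode x), snd (prod_decode y)) \<in> s)" for x y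
      using lex_rel_iff[of "fst (prod_decode x)" "snd (prod_decode x)" "fst (prod_decode y)" "snd (prod_decode y)" r s]
      by simp
    have "rdec X 1 (\<lambda>xs. (?a xs, ?a' xs) \<in> r \<and> (?b xs, ?b xs) \<in> s \<and> (?b' xs, ?b' xs) \<in> s \<and>
      (\<not> ?a xs = ?a' xs \<or> (?b xs, ?b' xs) \<in> s))"
      by (intro rdec_conj rdec_disj rdec_not rdec_eq rdec_rel[OF r(2)] rdec_rel[OF s(2)]
        rcomp_prod_decode rcomp_nth) auto
    then show "rdec X 1 (\<lambda>xs. (?x xs, ?y xs) \<in> lex_rel r s)"
      by (simp only: lex_iff)
  qed
  moreover have "lex_rel r s \<subseteq> Field (lex_rel r s) \<times> Field (lex_rel r s)"
    by (auto simp: Field_def)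
  ultimately show ?thesis
    unfolding comp_rel_def W by blast
qed

section \<open>Order types of computable well-orderings\<close>

instance recf :: countable
  by countable_datatype

lemma omega1_real_seg_rel:
  "omega1_real X = (LEAST \<alpha>. \<not> (\<exists>r. comp_rel X r \<and> (r, seg_rel \<alpha>) \<in> ordIso))"
  unfolding omega1_real_def comp_rel_def seg_rel_def conj_assoc by (rule refl)

lemma comp_rel_less_omega1_real:
  assumes "\<alpha> < omega1_real X"
  shows "\<exists>r. comp_rel X r \<and> (r, seg_rel \<alpha>) \<in> ordIso"
  using assms not_less_Least[of \<alpha> "\<lambda>\<alpha>. \<not> (\<exists>r. comp_rel X r \<and> (r, seg_rel \<alpha>) \<in> ordIso)"]
  unfolding omega1_real_seg_rel by blast

text \<open>The minimum in \<open>omega1_real\<close> is attained: otherwise a choice of programs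
  would inject the uncountably many countable ordinals into the countable set of programs, because a
  program determines its relation and a relation its order type.\<close>

lemma not_comp_rel_omega1_real:
  "\<not> (\<exists>r. comp_rel X r \<and> (r, seg_rel (omega1_real X)) \<in> ordIso)"
proof -
  let ?P = "\<lambda>\<alpha>. \<exists>r. comp_rel X r \<and> (r, seg_rel \<alpha>) \<in> ordIso"
  have "\<exists>\<alpha>. \<not> ?P \<alpha>"
  proof (rule ccontr)
    assume "\<nexists>\<alpha>. \<not> ?P \<alpha>"
    then have "\<forall>\<alpha>. \<exists>r. comp_rel X r \<and> (r, seg_rel \<alpha>) \<in> ordIso"
      by blast
    from choice[OF this] obtain r where r: "\<And>\<alpha>. comp_rel X (r \<alpha>)" "\<And>\<alpha>. (r \<alpha>, seg_rel \<alpha>) \<in> ordIso"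
      by blast
    then have "\<forall>\<alpha>. \<exists>f. \<forall>n. reval X f [n] (if n \<in> prod_encode ` r \<alpha> then 1 else 0)"
      unfolding comp_rel_def computable_from_def by blast
    from choice[OF this] obtain f
      where f: "\<And>\<alpha> n. reval X (f \<alpha>) [n] (if n \<in> prod_encode ` r \<alpha> then 1 else 0)"
      by blast
    have "inj f"
    proof (rule injI)
      fix \<alpha> \<beta>
      assume "f \<alpha> = f \<beta>"
      then have "(if n \<in> prod_encode ` r \<alpha> then 1 else 0) = (if n \<in> prod_encode ` r \<beta> then 1 else (0 :: nat))" for n
        by (intro reval_deterministic[OF f]) (simp only: f)
      then have "n \<in> prod_encode ` r \<alpha> \<longleftrightarrow> n \<in> prod_encode ` r \<beta>" for n
        by (metis zero_neq_one)
      then have "prod_encode ` r \<alpha> = prod_encode ` r \<beta>"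
        by blast
      then have "r \<alpha> = r \<beta>"
        by (simp add: inj_image_eq_iff inj_prod_encode)
      then have "(seg_rel \<alpha>, seg_rel \<beta>) \<in> ordIso"
        using ordIso_transitive[OF ordIso_symmetric[OF r(2)[of \<alpha>]]] r(2)[of \<beta>] by simp
      then show "\<alpha> = \<beta>"
        by (rule seg_rel_ordIso_eq)
    qed
    then have "countable (UNIV :: om1 set)"
      using countable_image_inj_on[of f UNIV] by simp
    then show False
      using om1_uncountable by blast
  qed
  then show ?thesis
    unfolding omega1_real_seg_rel by (rule LeastI_ex[of "\<lambda>\<alpha>. \<not> ?P \<alpha>"])
qed

text \<open>By comparability of well-orderings, if r were not shorter than the segment up to
  \<open>omega1_real X\<close>, that segment would be isomorphic to r or to a proper initial segment
  of r, hence to a computable ordering.\<close>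

lemma comp_rel_ordertype:
  assumes "comp_rel X r"
  shows "\<exists>\<beta><omega1_real X. (r, seg_rel \<beta>) \<in> ordIso"
proof -
  let ?k = "omega1_real X"
  have r: "Well_order r"
    using assms by (simp add: comp_rel_def)
  have "(r, seg_rel ?k) \<in> ordLess"
  proof (rule ccontr)
    assume "\<not> (r, seg_rel ?k) \<in> ordLess"
    then have "(seg_rel ?k, r) \<in> ordLess \<or> (seg_rel ?k, r) \<in> ordIso"
      using ordLess_or_ordLeq[OF r Well_order_seg_rel] ordLeq_iff_ordLess_or_ordIso by blast
    then show False
    proof
      assume "(seg_rel ?k, r) \<in> ordLess"
      then obtain a where "(seg_rel ?k, Restr r (underS r a)) \<in> ordIso"
        using ordLess_iff_ordIso_Restr[OF r Well_order_seg_rel] by blast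
      then show False
        using comp_rel_initial_segment[OF assms] ordIso_symmetric not_comp_rel_omega1_real by blast
    next
      assume "(seg_rel ?k, r) \<in> ordIso"
      then show False
        using assms ordIso_symmetric not_comp_rel_omega1_real by blast
    qed
  qed
  then obtain \<beta> where \<beta>: "\<beta> \<in> Field (seg_rel ?k)" "(r, Restr (seg_rel ?k) (underS (seg_rel ?k) \<beta>)) \<in> ordIso"
    using ordLess_iff_ordIso_Restr[OF Well_order_seg_rel r] by blast
  then have "\<beta> < ?k"
    by (simp add: Field_seg_rel)
  moreover have "Restr (seg_rel ?k) (underS (seg_rel ?k) \<beta>) = seg_rel \<beta>"
    using \<open>\<beta> < ?k\<close> by (auto simp: seg_rel_def underS_def le_less)
  ultimately show ?thesis
    using \<beta>(2) by auto
qed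

text \<open>The rank of \<open>(\<delta>, n)\<close> is its position, in a threefold lexicographic power of a computable
  well-ordering, above a block that takes care of \<open>\<xi>\<close>; it bounds the complexity of the formulas
  that appear in the n-th closure step of the fragment of level \<open>\<delta>\<close>.\<close>

lemma omega1_real_rank:
  assumes "\<xi> < omega1_real X" "\<eta> < omega1_real X" "omega < omega1_real X"
  obtains h :: "om1 \<Rightarrow> nat \<Rightarrow> om1"
  where "\<And>\<delta> n. \<delta> < \<eta> \<Longrightarrow> \<xi> \<le> h \<delta> n" "\<And>\<delta> n. \<delta> < \<eta> \<Longrightarrow> h \<delta> n < omega1_real X"
    "\<And>\<delta> m n. \<delta> < \<eta> \<Longrightarrow> m < n \<Longrightarrow> h \<delta> m < h \<delta> n"
    "\<And>\<gamma> \<delta> m n. \<gamma> < \<delta> \<Longrightarrow> \<delta> < \<eta> \<Longrightarrow> h \<gamma> m < h \<delta> n"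
proof -
  \<comment> \<open>One ordering serves for all three coordinates: it is long enough for the block
    of \<xi>, for the levels below \<eta> and for the \<omega> closure steps.\<close>
  define \<theta> where "\<theta> = max (max \<xi> \<eta>) omega"
  have "\<theta> < omega1_real X"
    using assms by (simp add: \<theta>_def)
  then obtain r where r: "comp_rel X r" "(r, seg_rel \<theta>) \<in> ordIso"
    using comp_rel_less_omega1_real by blast
  then obtain f where f: "bij_betw f (Field r) {..<\<theta>}"
    and f_mono: "\<forall>a \<in> Field r. \<forall>b \<in> Field r. (a, b) \<in> r \<longleftrightarrow> f a \<le> f b" and wo: "Well_order r"
    unfolding seg_rel_ordIso_iff by blast
  define g where "g = inv_into (Field r) f"
  have g_Field: "g \<alpha> \<in> Field r" and fg: "f (g \<alpha>) = \<alpha>" if "\<alpha> < \<theta>" for \<alpha>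
    using that f unfolding g_def bij_betw_def by (metis inv_into_into f_inv_into_f lessThan_iff)+
  have g_iff: "(g \<alpha>, g \<beta>) \<in> r \<longleftrightarrow> \<alpha> \<le> \<beta>" if "\<alpha> < \<theta>" "\<beta> < \<theta>" for \<alpha> \<beta>
    using that f_mono g_Field fg by simp
  have g_eq: "g \<alpha> = g \<beta> \<longleftrightarrow> \<alpha> = \<beta>" if "\<alpha> < \<theta>" "\<beta> < \<theta>" for \<alpha> \<beta>
    using that fg by metis
  define R where "R = lex_rel r (lex_rel r r)"
  have R: "comp_rel X R"
    unfolding R_def by (intro comp_rel_lex r)
  then obtain \<beta> where \<beta>: "\<beta> < omega1_real X" "(R, seg_rel \<beta>) \<in> ordIso"
    using comp_rel_ordertype by blast
  then obtain F where F: "bij_betw F (Field R) {..<\<beta>}"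
    and F_mono: "\<forall>a \<in> Field R. \<forall>b \<in> Field R. (a, b) \<in> R \<longleftrightarrow> F a \<le> F b"
    unfolding seg_rel_ordIso_iff by blast
  define e where "e x y z = prod_encode (g x, prod_encode (g y, g z))" for x y z
  have e_Field: "e x y z \<in> Field R" if "x < \<theta>" "y < \<theta>" "z < \<theta>" for x y z
    using that g_Field wo comp_rel_lex[OF r(1) r(1)]
    by (simp add: R_def e_def Field_lex_rel comp_rel_def)
  have e_less: "F (e x y z) < F (e x' y' z')"
    if "x < x' \<or> x = x' \<and> (y < y' \<or> y = y' \<and> z < z')"
      "x < \<theta>" "y < \<theta>" "z < \<theta>" "x' < \<theta>" "y' < \<theta>" "z' < \<theta>" for x y z x' y' z'
  proof -
    have "(e x' y' z', e x y z) \<notin> R"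
      using that by (auto simp: R_def e_def g_iff g_eq)
    then show ?thesis
      using F_mono[rule_format, OF e_Field[OF that(5-7)] e_Field[OF that(2-4)]] by simp
  qed
  have fin: "fin_ord n < \<theta>" for n
    using fin_ord_less_omega[of n] by (simp add: \<theta>_def less_max_iff_disj)
  have zero: "0 < \<theta>"
    using fin[of 0] by (simp add: fin_ord_def)
  have \<eta>: "\<delta> < \<theta>" if "\<delta> < \<eta>" for \<delta>
    using that by (simp add: \<theta>_def less_max_iff_disj)
  \<comment> \<open>First coordinate 1 puts these codes above the whole block of codes with first
    coordinate 0.\<close>
  define h where "h \<delta> n = F (e (fin_ord 1) \<delta> (fin_ord n))" for \<delta> n
  show ?thesis
  proof (rule that)
    fix \<delta> n
    assume "\<delta> < \<eta>"
    show "h \<delta> n < omega1_real X"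
    proof -
      have "h \<delta> n < \<beta>"
        using F e_Field[OF fin \<eta>[OF \<open>\<delta> < \<eta>\<close>] fin] unfolding h_def bij_betw_def by blast
      then show ?thesis using \<beta>(1) by simp
    qed
    show "\<xi> \<le> h \<delta> n"
    proof (rule ccontr)
      assume "\<not> \<xi> \<le> h \<delta> n"
      then have less: "h \<delta> n < \<theta>"
        by (simp add: \<theta>_def less_max_iff_disj not_le)
      \<comment> \<open>The block with first coordinate 0 embeds the ordinals below \<theta>
        increasingly, and all of its values lie below \<open>h \<delta> n\<close>. If
        \<open>h \<delta> n\<close> were below \<theta>, its own image would be both at least and
        less than itself.\<close>
      have "h \<delta> n \<le> F (e 0 (h \<delta> n) 0)"
      proof (rule strict_mono_ge[where f = "\<lambda>x. F (e 0 x 0)", OF _ less])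
        fix x y
        assume "x < y" "y < \<theta>"
        moreover from this have "x < \<theta>"
          by (rule less_trans)
        ultimately show "F (e 0 x 0) < F (e 0 y 0)"
          using zero by (intro e_less) simp_all
      qed
      also have "\<dots> < h \<delta> n"
      proof -
        have "F (e 0 (h \<delta> n) 0) < F (e (fin_ord 1) \<delta> (fin_ord n))"
          using zero less fin \<eta>[OF \<open>\<delta> < \<eta>\<close>] by (intro e_less) (simp_all, simp add: fin_ord_def)
        then show ?thesis
          by (simp add: h_def[of \<delta> n])
      qed
      finally show False by simp
    qed
  next
    fix \<delta> and m n :: nat
    assume "\<delta> < \<eta>" "m < n"
    then show "h \<delta> m < h \<delta> n"
      unfolding h_def by (intro e_less) (auto simp: fin \<eta> fin_ord_strict_mono)
  next
    fix \<gamma> \<delta> and m n :: nat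
    assume "\<gamma> < \<delta>" "\<delta> < \<eta>"
    moreover from this have "\<gamma> < \<theta>" "\<delta> < \<theta>"
      by (blast intro: \<eta> less_trans)+
    ultimately show "h \<gamma> m < h \<delta> n"
      unfolding h_def by (intro e_less) (simp_all add: fin)
  qed
qed

text \<open>With \<alpha> in the place of \<xi>, two consecutive ranks are available: the first is
  at least \<alpha>, so the second is at least the successor of \<alpha>.\<close>

lemma is_limit_omega1_real:
  assumes "omega < omega1_real X"
  shows "is_limit (omega1_real X)"
proof -
  have "osuc \<alpha> < omega1_real X" if \<alpha>: "\<alpha> < omega1_real X" for \<alpha>
  proof -
    obtain h :: "om1 \<Rightarrow> nat \<Rightarrow> om1"
    where h: "\<And>\<delta> n. \<delta> < omega \<Longrightarrow> \<alpha> \<le> h \<delta> n" "\<And>\<delta> n. \<delta> < omega \<Longrightarrow> h \<delta> n < omega1_real X"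
      "\<And>\<delta> m n. \<delta> < omega \<Longrightarrow> m < n \<Longrightarrow> h \<delta> m < h \<delta> n"
      "\<And>\<gamma> \<delta> m n. \<gamma> < \<delta> \<Longrightarrow> \<delta> < omega \<Longrightarrow> h \<gamma> m < h \<delta> n"
      by (rule omega1_real_rank[OF \<alpha> assms assms], rule that)
    have "0 < omega"
      using fin_ord_less_omega[of 0] by (simp add: fin_ord_def)
    then have "\<alpha> < h 0 1"
      using h(1)[of 0 0] h(3)[of 0 0 1] by simp
    then show ?thesis
      using osuc_le h(2)[OF \<open>0 < omega\<close>] le_less_trans by blast
  qed
  then show ?thesis
    using assms unfolding is_limit_def by (metis not_less_zero_om1)
qed

section \<open>Semantics\<close>

lemma rcset_cimage [simp]: "rcset (cimage f \<Phi>) = f ` rcset \<Phi>"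
  by (rule cimage.rep_eq)

lemma case_nat_in_envs: "a \<in> univ M \<Longrightarrow> e \<in> envs M \<Longrightarrow> case_nat a e \<in> envs M"
  by (auto simp: envs_def subset_iff split: nat.splits)

lemma envs_in_univ: "e \<in> envs M \<Longrightarrow> e i \<in> univ M"
  by (auto simp: envs_def)

lemma envs_nonempty: "M \<in> structures V \<Longrightarrow> \<exists>e. e \<in> envs M"
  by (auto simp: structures_def envs_def intro!: exI[of _ "\<lambda>_. SOME a. a \<in> univ M"] intro: someI)

lemma tval_cong: "(\<And>i. i \<in> fv_trm t \<Longrightarrow> e i = e' i) \<Longrightarrow> tval M e t = tval M e' t"
proof (induction t)
  case (App f ts)
  then have "map (tval M e) ts = map (tval M e') ts"
    by (intro map_cong refl App.IH) auto
  then show ?case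
    by (simp del: map_eq_conv)
qed simp

lemma sat_cong: "(\<And>i. i \<in> fv F \<Longrightarrow> e i = e' i) \<Longrightarrow> sat M F e = sat M F e'"
proof (induction F arbitrary: e e')
  case (Equal s t)
  then show ?case
    using tval_cong[of s e e' M] tval_cong[of t e e' M] by simp
next
  case (Atom r ts)
  then have "map (tval M e) ts = map (tval M e') ts"
    by (auto intro!: tval_cong)
  then show ?case
    by (simp del: map_eq_conv)
next
  case (Neg F)
  then show ?case by (metis fv.simps(3) sat.simps(3))
next
  case (Conj \<Phi>)
  have "sat M F e = sat M F e'" if "F \<in> rcset \<Phi>" for F
    using that Conj.prems by (intro Conj.IH) auto
  then show ?case by simp
next
  case (Disj \<Phi>)
  have "sat M F e = sat M F e'" if "F \<in> rcset \<Phi>" for F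
    using that Disj.prems by (intro Disj.IH) auto
  then show ?case by simp
next
  case (Exi F)
  have "sat M F (case_nat a e) = sat M F (case_nat a e')" for a
    using Exi.prems by (intro Exi.IH) (auto split: nat.split)
  then show ?case by simp
next
  case (Forall F)
  have "sat M F (case_nat a e) = sat M F (case_nat a e')" for a
    using Forall.prems by (intro Forall.IH) (auto split: nat.split)
  then show ?case by simp
qed

lemma tval_subst_trm: "tval M e (subst_trm \<sigma> t) = tval M (\<lambda>i. tval M e (\<sigma> i)) t"
  by (induction t) (auto cong: map_cong)

lemma tval_lift_subst:
  "tval M (case_nat a e) (lift_subst \<sigma> i) = case_nat a (\<lambda>j. tval M e (\<sigma> j)) i"
  by (auto simp: lift_subst_def tval_subst_trm split: nat.split)

lemma sat_subst: "sat M (subst F \<sigma>) e = sat M F (\<lambda>i. tval M e (\<sigma> i))"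
proof (induction F arbitrary: \<sigma> e)
  case (Atom r ts)
  then show ?case
    by (simp add: tval_subst_trm comp_def)
next
  case (Exi F)
  then show ?case
    by (simp add: tval_lift_subst)
next
  case (Forall F)
  then show ?case
    by (simp add: tval_lift_subst)
qed (simp_all add: tval_subst_trm)

lemma sat_inst: "sat M (inst F t) e = sat M F (case_nat (tval M e t) e)"
proof -
  have "(\<lambda>i. tval M e (case i of 0 \<Rightarrow> t | Suc j \<Rightarrow> Var j)) = case_nat (tval M e t) e"
    by (auto split: nat.split)
  then show ?thesis
    unfolding inst_def sat_subst by simp
qed

lemma sat_shift: "sat M (shift F) (case_nat a e) = sat M F e"
  unfolding shift_def sat_subst by simp

lemma tval_in_univ:
  assumes "M \<in> structures V" "e \<in> envs M"
  shows "wf_trm V t \<Longrightarrow> tval M e t \<in> univ M"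
proof (induction t)
  case (Var i)
  then show ?case using assms by (simp add: envs_in_univ)
next
  case (App f ts)
  then have "set (map (tval M e) ts) \<subseteq> univ M"
    by (auto simp: list_all_iff)
  then show ?case
    using App.prems assms(1) unfolding structures_def by simp
qed

lemma fv_subst_trm: "fv_trm (subst_trm \<sigma> t) = (\<Union>i\<in>fv_trm t. fv_trm (\<sigma> i))"
  by (induction t) auto

lemma fv_lift_subst:
  "Suc i \<in> fv_trm (lift_subst \<sigma> j) \<longleftrightarrow> (\<exists>k. j = Suc k \<and> i \<in> fv_trm (\<sigma> k))"
  by (auto simp: lift_subst_def fv_subst_trm split: nat.split)

lemma fv_subst: "fv (subst F \<sigma>) = (\<Union>i\<in>fv F. fv_trm (\<sigma> i))"
proof (induction F arbitrary: \<sigma>)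
  case (Exi F)
  then show ?case by (fastforce simp: fv_lift_subst)
next
  case (Forall F)
  then show ?case by (fastforce simp: fv_lift_subst)
qed (simp_all add: fv_subst_trm)

lemma finite_fv_trm: "finite (fv_trm t)"
  by (induction t) auto

lemma wf_trm_subst: "wf_trm V t \<Longrightarrow> (\<And>i. wf_trm V (\<sigma> i)) \<Longrightarrow> wf_trm V (subst_trm \<sigma> t)"
  by (induction t) (auto simp: list_all_iff)

lemma wf_lift_subst: "(\<And>i. wf_trm V (\<sigma> i)) \<Longrightarrow> wf_trm V (lift_subst \<sigma> i)"
  by (auto simp: lift_subst_def wf_trm_subst split: nat.split)

lemma wf_symbols_subst:
  "wf_symbols V F \<Longrightarrow> (\<And>i. wf_trm V (\<sigma> i)) \<Longrightarrow> wf_symbols V (subst F \<sigma>)"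
proof (induction F arbitrary: \<sigma>)
  case (Equal s t)
  then show ?case by (simp add: wf_trm_subst)
next
  case (Atom r ts)
  then show ?case by (auto simp: list_all_iff wf_trm_subst)
next
  case (Exi F)
  then show ?case by (simp add: wf_lift_subst)
next
  case (Forall F)
  then show ?case by (simp add: wf_lift_subst)
qed auto

lemma subst_in_formulas:
  "F \<in> formulas V \<Longrightarrow> (\<And>i. wf_trm V (\<sigma> i)) \<Longrightarrow> subst F \<sigma> \<in> formulas V"
  by (auto simp: formulas_def wf_symbols_subst fv_subst finite_fv_trm)

lemma finitary_subst: "finitary (subst F \<sigma>) = finitary F" if "finitary F"
  using that by (induction F arbitrary: \<sigma>) auto

lemma quantifier_free_subst: "quantifier_free (subst F \<sigma>) = quantifier_free F"
  by (induction F arbitrary: \<sigma>) auto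

text \<open>The induction is on derivations, which may branch infinitely. The environment must vary:
  the quantifier rules pass to one with a new value at index 0, where \<open>shift\<close> is
  undone.\<close>

lemma prov_sound:
  assumes "M \<in> structures V"
  shows "prov V k \<Gamma> F \<Longrightarrow> e \<in> envs M \<Longrightarrow> \<forall>G\<in>\<Gamma>. sat M G e \<Longrightarrow> sat M F e"
proof (induction arbitrary: e rule: prov.induct)
  case (ExI t k \<Gamma> F)
  then show ?case
    using tval_in_univ[OF assms ExI(4,1)] by (auto simp: sat_inst)
next
  case (ExE k \<Gamma> F G)
  then have "sat M (Exi F) e"
    by blast
  then obtain a where a: "a \<in> univ M" "sat M F (case_nat a e)"
    by auto
  then have "sat M (shift G) (case_nat a e)"
    using ExE by (intro ExE.IH) (auto simp: case_nat_in_envs sat_shift)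
  then show ?case by (simp add: sat_shift)
next
  case (AllI k \<Gamma> F)
  have "sat M F (case_nat a e)" if "a \<in> univ M" for a
    using AllI that by (intro AllI.IH) (auto simp: case_nat_in_envs sat_shift)
  then show ?case by simp
next
  case (AllE t k \<Gamma> F)
  then show ?case
    using tval_in_univ[OF assms AllE(4,1)] by (auto simp: sat_inst)
next
  case (NegI k F \<Gamma> G)
  then show ?case by (metis insert_iff sat.simps(3))
next
  case (NegE k F \<Gamma> G)
  then show ?case by (metis insert_iff sat.simps(3))
next
  case (DisjE k \<Gamma> \<Phi> G)
  then have "sat M (Disj \<Phi>) e"
    by blast
  then obtain F where "F \<in> rcset \<Phi>" "sat M F e"
    by auto
  then show ?case
    using DisjE by (metis insert_iff)
qed (auto simp: sat_inst)

lemma derivable_sound: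
  "derivable V \<Gamma> F \<Longrightarrow> M \<in> structures V \<Longrightarrow> e \<in> envs M \<Longrightarrow> \<forall>G\<in>\<Gamma>. sat M G e \<Longrightarrow> sat M F e"
  unfolding derivable_def using prov_sound by blast

lemma fin_consistentI:
  "M \<in> structures V \<Longrightarrow> e \<in> envs M \<Longrightarrow> \<forall>G\<in>\<Gamma>. sat M G e \<Longrightarrow> fin_consistent V \<Gamma>"
  unfolding fin_consistent_def using derivable_sound by (metis sat.simps(3))

lemma holds_iff_sat: 
  assumes "fv F = {}" "e \<in> envs M"
  shows "M \<Turnstile> F \<longleftrightarrow> sat M F e"
  unfolding holds_def using assms sat_cong[of F] by (metis empty_iff)

lemma holds_Neg: "fv F = {} \<Longrightarrow> M \<in> structures V \<Longrightarrow> M \<Turnstile> Neg F \<longleftrightarrow> \<not> M \<Turnstile> F"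
  using envs_nonempty by (metis fv.simps(3) holds_iff_sat sat.simps(3))

text \<open>A quantifier block prepends k elements to the environment. The condition on indices i +
  k says this without naming the elements, which is how extensions of tuples are treated
  below.\<close>

lemma sat_Exi_pow:
  assumes "e \<in> envs M"
  shows "sat M ((Exi ^^ k) G) e \<longleftrightarrow> (\<exists>e'\<in>envs M. (\<forall>i. e' (i + k) = e i) \<and> sat M G e')"
  using assms
proof (induction k arbitrary: e)
  case 0
  have "e' = e" if "\<forall>i. e' i = e i" for e'
    using that by auto
  then show ?case using 0 by auto
next
  case (Suc k)
  have "(\<exists>a\<in>univ M. \<exists>e'\<in>envs M. (\<forall>i. e' (i + k) = case_nat a e i) \<and> sat M G e') \<longleftrightarrow>
      (\<exists>e'\<in>envs M. (\<forall>i. e' (i + Suc k) = e i) \<and> sat M G e')" (is "?L \<longleftrightarrow> ?R")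
  proof
    assume ?L
    then obtain a e' where "a \<in> univ M" "e' \<in> envs M" "\<forall>i. e' (i + k) = case_nat a e i" "sat M G e'"
      by blast
    moreover from this(3) have "e' (i + Suc k) = e i" for i
      by (metis add_Suc_shift nat.case(2))
    ultimately show ?R by blast
  next
    assume ?R
    then obtain e' where e': "e' \<in> envs M" "\<forall>i. e' (i + Suc k) = e i" "sat M G e'"
      by blast
    \<comment> \<open>The outermost quantifier of the block supplies the element at index k of the
      matrix.\<close>
    have "e' (i + k) = case_nat (e' k) e i" for i
      using e'(2) by (cases i) auto
    then show ?L
      using e' envs_in_univ by blast
  qed
  then show ?case
    using Suc by (simp add: case_nat_in_envs)
qed

lemma sat_Forall_pow:
  "sat M ((Forall ^^ k) G) e \<longleftrightarrow> \<not> sat M ((Exi ^^ k) (Neg G)) e"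
  by (induction k arbitrary: e) auto

lemma fv_pow: "fv ((Exi ^^ k) G) = {i. i + k \<in> fv G}" "fv ((Forall ^^ k) G) = {i. i + k \<in> fv G}"
  by (induction k) auto

lemma wf_symbols_pow [simp]:
  "wf_symbols V ((Exi ^^ k) G) = wf_symbols V G" "wf_symbols V ((Forall ^^ k) G) = wf_symbols V G"
  by (induction k) auto

section \<open>Isomorphisms\<close>

lemma tval_iso:
  assumes M: "M \<in> structures V" and e: "e \<in> envs M"
    and f: "\<And>f as. fun_ar V f = Some (length as) \<Longrightarrow> set as \<subseteq> univ M \<Longrightarrow>
      h (fun_val M f as) = fun_val N f (map h as)"
  shows "wf_trm V t \<Longrightarrow> h (tval M e t) = tval N (h \<circ> e) t"
proof (induction t)
  case (App g ts)
  then have wf: "\<forall>t\<in>set ts. wf_trm V t"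
    by (auto simp: list_all_iff)
  have "set (map (tval M e) ts) \<subseteq> univ M"
    using wf tval_in_univ[OF M e] by auto
  moreover have "map h (map (tval M e) ts) = map (tval N (h \<circ> e)) ts"
  proof -
    have "h (tval M e t) = tval N (h \<circ> e) t" if "t \<in> set ts" for t
      using wf that by (intro App.IH) blast+
    then show ?thesis
      by (auto simp del: comp_apply simp: comp_def[of h "tval M e"])
  qed
  moreover have "fun_ar V g = Some (length (map (tval M e) ts))"
    using App.prems by simp
  ultimately show ?case
    using f[of g "map (tval M e) ts"] by (simp only: tval.simps)
qed simp

lemma sat_iso:
  assumes M: "M \<in> structures V"
    and h: "bij_betw h (univ M) (univ N)"
    and f: "\<And>f as. fun_ar V f = Some (length as) \<Longrightarrow> set as \<subseteq> univ M \<Longrightarrow>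
      h (fun_val M f as) = fun_val N f (map h as)"
    and r: "\<And>r as. rel_ar V r = Some (length as) \<Longrightarrow> set as \<subseteq> univ M \<Longrightarrow>
      rel_val M r as = rel_val N r (map h as)"
  shows "e \<in> envs M \<Longrightarrow> wf_symbols V F \<Longrightarrow> sat M F e = sat N F (h \<circ> e)"
proof (induction F arbitrary: e)
  case (Equal s t)
  have "h (tval M e s) = h (tval M e t) \<longleftrightarrow> tval M e s = tval M e t"
    using Equal(2) tval_in_univ[OF M Equal(1)] h inj_on_eq_iff[of h "univ M"] unfolding bij_betw_def
    by simp
  then show ?case
    using tval_iso[OF M Equal(1) f, of s] tval_iso[OF M Equal(1) f, of t] Equal(2)
    by (simp del: comp_apply)
next
  case (Atom p ts)
  then have wf: "\<forall>t\<in>set ts. wf_trm V t"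
    by (auto simp: list_all_iff)
  have "set (map (tval M e) ts) \<subseteq> univ M"
    using wf tval_in_univ[OF M Atom(1)] by auto
  moreover have "map h (map (tval M e) ts) = map (tval N (h \<circ> e)) ts"
  proof -
    have "h (tval M e t) = tval N (h \<circ> e) t" if "t \<in> set ts" for t
      using wf that by (intro tval_iso[OF M Atom(1) f]) blast+
    then show ?thesis
      by (auto simp del: comp_apply simp: comp_def[of h "tval M e"])
  qed
  moreover have "rel_ar V p = Some (length (map (tval M e) ts))"
    using Atom.prems by simp
  ultimately show ?case
    using r[of p "map (tval M e) ts"] by (simp only: sat.simps)
next
  case (Exi F)
  have eq: "h \<circ> case_nat a e = case_nat (h a) (h \<circ> e)" for a
    by (auto split: nat.split)
  have "sat M F (case_nat a e) = sat N F (case_nat (h a) (h \<circ> e))" if "a \<in> univ M" for a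
    using Exi that by (simp del: comp_apply add: case_nat_in_envs flip: eq)
  moreover have "univ N = h ` univ M"
    using h by (simp add: bij_betw_def)
  ultimately show ?case by (simp del: comp_apply)
next
  case (Forall F)
  have eq: "h \<circ> case_nat a e = case_nat (h a) (h \<circ> e)" for a
    by (auto split: nat.split)
  have "sat M F (case_nat a e) = sat N F (case_nat (h a) (h \<circ> e))" if "a \<in> univ M" for a
    using Forall that by (simp del: comp_apply add: case_nat_in_envs flip: eq)
  moreover have "univ N = h ` univ M"
    using h by (simp add: bij_betw_def)
  ultimately show ?case by (simp del: comp_apply)
qed (simp_all del: comp_apply)

lemma isomorphic_sat:
  assumes "isomorphic V M N" "M \<in> structures V"
  obtains h where "h ` univ M = univ N"
    "\<And>F e. e \<in> envs M \<Longrightarrow> wf_symbols V F \<Longrightarrow> sat M F e = sat N F (h \<circ> e)"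
proof -
  obtain h where h: "bij_betw h (univ M) (univ N)"
      "\<And>f as. fun_ar V f = Some (length as) \<Longrightarrow> set as \<subseteq> univ M \<Longrightarrow>
         h (fun_val M f as) = fun_val N f (map h as)"
      "\<And>r as. rel_ar V r = Some (length as) \<Longrightarrow> set as \<subseteq> univ M \<Longrightarrow>
         rel_val M r as = rel_val N r (map h as)"
    using assms(1) unfolding isomorphic_def by blast
  show ?thesis
    using that[of h] sat_iso[OF assms(2) h] h(1) by (simp add: bij_betw_def)
qed

lemma isomorphic_refl: "isomorphic V M M"
  unfolding isomorphic_def by (intro exI[of _ "\<lambda>x. x"]) (auto simp: bij_betw_def)

text \<open>The inverse map is applied to values of \<open>fun_val M\<close>; these lie in the
  universe because M is a structure.\<close>

lemma isomorphic_sym: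
  assumes "isomorphic V M N" "M \<in> structures V"
  shows "isomorphic V N M"
proof -
  obtain h where h: "bij_betw h (univ M) (univ N)"
      "\<And>f as. fun_ar V f = Some (length as) \<Longrightarrow> set as \<subseteq> univ M \<Longrightarrow>
         h (fun_val M f as) = fun_val N f (map h as)"
      "\<And>r as. rel_ar V r = Some (length as) \<Longrightarrow> set as \<subseteq> univ M \<Longrightarrow>
         rel_val M r as = rel_val N r (map h as)"
    using assms(1) unfolding isomorphic_def by blast
  define g where "g = inv_into (univ M) h"
  have g: "bij_betw g (univ N) (univ M)"
    unfolding g_def by (rule bij_betw_inv_into[OF h(1)])
  have gh: "g (h x) = x" if "x \<in> univ M" for x
    using that h(1) unfolding g_def by (rule bij_betw_inv_into_left[rotated])
  have map: "set (map g as) \<subseteq> univ M" "map h (map g as) = as" if "set as \<subseteq> univ N" for as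
  proof -
    show "set (map g as) \<subseteq> univ M"
      using that g by (auto simp: bij_betw_def)
    have "h (g x) = x" if "x \<in> univ N" for x
      using that h(1) unfolding g_def by (rule bij_betw_inv_into_right[rotated])
    then show "map h (map g as) = as"
      using that by (induction as) auto
  qed
  have "g (fun_val N f as) = fun_val M f (map g as)"
    if "fun_ar V f = Some (length as)" "set as \<subseteq> univ N" for f as
  proof -
    have "fun_val M f (map g as) \<in> univ M"
      using map[OF that(2)] that(1) assms(2) unfolding structures_def by simp
    then show ?thesis
      using h(2)[of f "map g as"] map[OF that(2)] that gh by (metis length_map)
  qed
  moreover have "rel_val N r as = rel_val M r (map g as)"
    if "rel_ar V r = Some (length as)" "set as \<subseteq> univ N" for r as
    using h(3)[of r "map g as"] map[OF that(2)] that by simp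
  ultimately show ?thesis
    unfolding isomorphic_def using g by blast
qed

lemma isomorphic_trans:
  assumes "isomorphic V M N" "isomorphic V N P"
  shows "isomorphic V M P"
proof -
  obtain h where h: "bij_betw h (univ M) (univ N)"
      "\<And>f as. fun_ar V f = Some (length as) \<Longrightarrow> set as \<subseteq> univ M \<Longrightarrow>
         h (fun_val M f as) = fun_val N f (map h as)"
      "\<And>r as. rel_ar V r = Some (length as) \<Longrightarrow> set as \<subseteq> univ M \<Longrightarrow>
         rel_val M r as = rel_val N r (map h as)"
    using assms(1) unfolding isomorphic_def by blast
  obtain g where g: "bij_betw g (univ N) (univ P)"
      "\<And>f as. fun_ar V f = Some (length as) \<Longrightarrow> set as \<subseteq> univ N \<Longrightarrow>
         g (fun_val N f as) = fun_val P f (map g as)"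
      "\<And>r as. rel_ar V r = Some (length as) \<Longrightarrow> set as \<subseteq> univ N \<Longrightarrow>
         rel_val N r as = rel_val P r (map g as)"
    using assms(2) unfolding isomorphic_def by blast
  have set: "set (map h as) \<subseteq> univ N" if "set as \<subseteq> univ M" for as
    using that h(1) by (auto simp: bij_betw_def)
  have "bij_betw (g \<circ> h) (univ M) (univ P)"
    by (rule bij_betw_trans[OF h(1) g(1)])
  moreover have "(g \<circ> h) (fun_val M f as) = fun_val P f (map (g \<circ> h) as)"
    if "fun_ar V f = Some (length as)" "set as \<subseteq> univ M" for f as
    using h(2)[OF that] g(2)[OF _ set[OF that(2)], of f] that by simp
  moreover have "rel_val M r as = rel_val P r (map (g \<circ> h) as)"
    if "rel_ar V r = Some (length as)" "set as \<subseteq> univ M" for r as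
    using h(3)[OF that] g(3)[OF _ set[OF that(2)], of r] that by simp
  ultimately show ?thesis
    unfolding isomorphic_def by blast
qed

lemma isomorphic_holds:
  assumes "isomorphic V M N" "M \<in> structures V" "N \<in> structures V" "F \<in> sentences V"
  shows "M \<Turnstile> F \<longleftrightarrow> N \<Turnstile> F"
proof -
  obtain h where h: "h ` univ M = univ N"
      "\<And>F e. e \<in> envs M \<Longrightarrow> wf_symbols V F \<Longrightarrow> sat M F e = sat N F (h \<circ> e)"
    using isomorphic_sat[OF assms(1,2)] by blast
  obtain e where e: "e \<in> envs M"
    using envs_nonempty[OF assms(2)] by blast
  then have "h \<circ> e \<in> envs N"
    using h(1) by (auto simp: envs_def)
  then show ?thesis
    using e h(2)[OF e, of F] assms(4) by (simp add: sentences_def formulas_def holds_iff_sat)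
qed

section \<open>The infinitary hierarchy\<close>

lemma Sigma_in_cases:
  assumes "Sigma_in V \<alpha> F"
  obtains "\<alpha> = 0" "F \<in> formulas V" "finitary F" "quantifier_free F"
  | \<Phi> where "0 < \<alpha>" "F = Disj \<Phi>" "Disj \<Phi> \<in> formulas V"
      "\<forall>F\<in>rcset \<Phi>. \<exists>\<beta><\<alpha>. \<exists>k G. F = (Exi ^^ k) G \<and> Pi_in V \<beta> G"
  using assms by (cases rule: Sigma_in.cases) blast+

lemma Pi_in_cases:
  assumes "Pi_in V \<alpha> F"
  obtains "\<alpha> = 0" "F \<in> formulas V" "finitary F" "quantifier_free F"
  | \<Phi> where "0 < \<alpha>" "F = Conj \<Phi>" "Conj \<Phi> \<in> formulas V"
      "\<forall>F\<in>rcset \<Phi>. \<exists>\<beta><\<alpha>. \<exists>k G. F = (Forall ^^ k) G \<and> Sigma_in V \<beta> G"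
  using assms by (cases rule: Pi_in.cases) blast+

lemma Sigma_in_zero: "Sigma_in V 0 F \<longleftrightarrow> F \<in> formulas V \<and> finitary F \<and> quantifier_free F"
  by (auto elim: Sigma_in_cases intro: Sigma_in_0)

lemma Pi_in_zero: "Pi_in V 0 F \<longleftrightarrow> F \<in> formulas V \<and> finitary F \<and> quantifier_free F"
  by (auto elim: Pi_in_cases intro: Pi_in_0)

lemma Sigma_in_formulas: "Sigma_in V \<alpha> F \<Longrightarrow> F \<in> formulas V"
  by (auto elim: Sigma_in_cases)

lemma Pi_in_formulas: "Pi_in V \<alpha> F \<Longrightarrow> F \<in> formulas V"
  by (auto elim: Pi_in_cases)

lemma sat_pow_cong:
  assumes "\<And>e. sat M G e \<longleftrightarrow> sat M G' e"
  shows "sat M ((Exi ^^ k) G) e \<longleftrightarrow> sat M ((Exi ^^ k) G') e"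
  by (induction k arbitrary: e) (simp_all add: assms)

lemma sat_Exi_pow_Neg:
  assumes "\<And>e. sat M G' e \<longleftrightarrow> \<not> sat M G e"
  shows "sat M ((Forall ^^ k) G') e \<longleftrightarrow> \<not> sat M ((Exi ^^ k) G) e"
    "sat M ((Exi ^^ k) G') e \<longleftrightarrow> \<not> sat M ((Forall ^^ k) G) e"
  unfolding sat_Forall_pow by (simp_all add: assms cong: sat_pow_cong)
   (rule sat_pow_cong, simp add: assms)+

text \<open>Negation is pushed through the connective and the quantifier block down to a matrix of
  lower level, which belongs to the other class; hence both halves are proved together. The dual of
  each member is obtained by choice, since level and block vary with the member.\<close>

lemma in_hierarchy_dual:
  "(Sigma_in V \<alpha> F \<longrightarrow> (\<exists>G. Pi_in V \<alpha> G \<and> fv G = fv F \<and> (\<forall>M e. sat M G e \<longleftrightarrow> \<not> sat M F e))) \<and>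
   (Pi_in V \<alpha> F \<longrightarrow> (\<exists>G. Sigma_in V \<alpha> G \<and> fv G = fv F \<and> (\<forall>M e. sat M G e \<longleftrightarrow> \<not> sat M F e)))"
proof (induction \<alpha> arbitrary: F rule: less_induct)
  case (less \<alpha>)
  show ?case
  proof (intro conjI impI)
    assume "Sigma_in V \<alpha> F"
    then show "\<exists>G. Pi_in V \<alpha> G \<and> fv G = fv F \<and> (\<forall>M e. sat M G e \<longleftrightarrow> \<not> sat M F e)"
    proof (cases rule: Sigma_in_cases)
      case 1
      then show ?thesis
        by (intro exI[of _ "Neg F"]) (auto simp: Pi_in_zero formulas_def)
    next
      case (2 \<Phi>)
      let ?dual = "\<lambda>H H'. (\<exists>\<beta><\<alpha>. \<exists>k G. H' = (Forall ^^ k) G \<and> Sigma_in V \<beta> G) \<and> fv H' = fv H \<and>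
          wf_symbols V H' \<and> (\<forall>M e. sat M H' e \<longleftrightarrow> \<not> sat M H e)"
      have "\<exists>H'. ?dual H H'" if "H \<in> rcset \<Phi>" for H
      proof -
        obtain \<beta> k G where G: "\<beta> < \<alpha>" "H = (Exi ^^ k) G" "Pi_in V \<beta> G"
          using 2 \<open>H \<in> rcset \<Phi>\<close> by blast
        then obtain G' where "Sigma_in V \<beta> G'" "fv G' = fv G" "\<And>M e. sat M G' e \<longleftrightarrow> \<not> sat M G e"
          using less.IH[of \<beta> G] by blast
        moreover from this(1) have "wf_symbols V G'"
          by (auto dest: Sigma_in_formulas simp: formulas_def)
        ultimately show ?thesis
          using G by (intro exI[of _ "(Forall ^^ k) G'"])
            (auto simp: fv_pow sat_Exi_pow_Neg(1)[of _ G' G])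
      qed
      then have "\<exists>neg. \<forall>H\<in>rcset \<Phi>. ?dual H (neg H)"
        by (intro bchoice ballI)
      then obtain neg where neg: "\<And>H. H \<in> rcset \<Phi> \<Longrightarrow> (\<exists>\<beta><\<alpha>. \<exists>k G. neg H = (Forall ^^ k) G \<and> Sigma_in V \<beta> G)"
        "\<And>H. H \<in> rcset \<Phi> \<Longrightarrow> fv (neg H) = fv H" "\<And>H. H \<in> rcset \<Phi> \<Longrightarrow> wf_symbols V (neg H)"
        "\<And>H M e. H \<in> rcset \<Phi> \<Longrightarrow> sat M (neg H) e \<longleftrightarrow> \<not> sat M H e"
        by blast
      have fv: "fv (Conj (cimage neg \<Phi>)) = fv F"
        using 2(2) neg(2) by simp
      show ?thesis
      proof (intro exI conjI)
        show "Pi_in V \<alpha> (Conj (cimage neg \<Phi>))"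
          using 2 neg(1,3) fv by (intro Pi_in_pos) (auto simp: formulas_def)
        show "fv (Conj (cimage neg \<Phi>)) = fv F"
          by (rule fv)
        show "\<forall>M e. sat M (Conj (cimage neg \<Phi>)) e \<longleftrightarrow> \<not> sat M F e"
          using 2(2) neg(4) by simp
      qed
    qed
  next
    assume "Pi_in V \<alpha> F"
    then show "\<exists>G. Sigma_in V \<alpha> G \<and> fv G = fv F \<and> (\<forall>M e. sat M G e \<longleftrightarrow> \<not> sat M F e)"
    proof (cases rule: Pi_in_cases)
      case 1
      then show ?thesis
        by (intro exI[of _ "Neg F"]) (auto simp: Sigma_in_zero formulas_def)
    next
      case (2 \<Phi>)
      let ?dual = "\<lambda>H H'. (\<exists>\<beta><\<alpha>. \<exists>k G. H' = (Exi ^^ k) G \<and> Pi_in V \<beta> G) \<and> fv H' = fv H \<and>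
          wf_symbols V H' \<and> (\<forall>M e. sat M H' e \<longleftrightarrow> \<not> sat M H e)"
      have "\<exists>H'. ?dual H H'" if "H \<in> rcset \<Phi>" for H
      proof -
        obtain \<beta> k G where G: "\<beta> < \<alpha>" "H = (Forall ^^ k) G" "Sigma_in V \<beta> G"
          using 2 \<open>H \<in> rcset \<Phi>\<close> by blast
        then obtain G' where "Pi_in V \<beta> G'" "fv G' = fv G" "\<And>M e. sat M G' e \<longleftrightarrow> \<not> sat M G e"
          using less.IH[of \<beta> G] by blast
        moreover from this(1) have "wf_symbols V G'"
          by (auto dest: Pi_in_formulas simp: formulas_def)
        ultimately show ?thesis
          using G by (intro exI[of _ "(Exi ^^ k) G'"])
            (auto simp: fv_pow sat_Exi_pow_Neg(2)[of _ G' G])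
      qed
      then have "\<exists>neg. \<forall>H\<in>rcset \<Phi>. ?dual H (neg H)"
        by (intro bchoice ballI)
      then obtain neg where neg: "\<And>H. H \<in> rcset \<Phi> \<Longrightarrow> (\<exists>\<beta><\<alpha>. \<exists>k G. neg H = (Exi ^^ k) G \<and> Pi_in V \<beta> G)"
        "\<And>H. H \<in> rcset \<Phi> \<Longrightarrow> fv (neg H) = fv H" "\<And>H. H \<in> rcset \<Phi> \<Longrightarrow> wf_symbols V (neg H)"
        "\<And>H M e. H \<in> rcset \<Phi> \<Longrightarrow> sat M (neg H) e \<longleftrightarrow> \<not> sat M H e"
        by blast
      have fv: "fv (Disj (cimage neg \<Phi>)) = fv F"
        using 2(2) neg(2) by simp
      show ?thesis
      proof (intro exI conjI)
        show "Sigma_in V \<alpha> (Disj (cimage neg \<Phi>))"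
          using 2 neg(1,3) fv by (intro Sigma_in_pos) (auto simp: formulas_def)
        show "fv (Disj (cimage neg \<Phi>)) = fv F"
          by (rule fv)
        show "\<forall>M e. sat M (Disj (cimage neg \<Phi>)) e \<longleftrightarrow> \<not> sat M F e"
          using 2(2) neg(4) by simp
      qed
    qed
  qed
qed

lemma subst_pow:
  "subst ((Exi ^^ k) G) \<sigma> = (Exi ^^ k) (subst G ((lift_subst ^^ k) \<sigma>))"
  "subst ((Forall ^^ k) G) \<sigma> = (Forall ^^ k) (subst G ((lift_subst ^^ k) \<sigma>))"
  by (induction k arbitrary: \<sigma>) (simp_all add: funpow_swap1[of lift_subst])

lemma wf_lift_subst_pow:
  "(\<And>i. wf_trm V (\<sigma> i)) \<Longrightarrow> wf_trm V ((lift_subst ^^ k) \<sigma> i)"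
  by (induction k arbitrary: i) (auto intro: wf_lift_subst)

text \<open>Below k quantifiers the substitution arrives lifted k times, so the induction lets it
  vary.\<close>

lemma in_hierarchy_subst:
  assumes "\<And>i. wf_trm V (\<sigma> i)"
  shows "(Sigma_in V \<alpha> F \<longrightarrow> Sigma_in V \<alpha> (subst F \<sigma>)) \<and> (Pi_in V \<alpha> F \<longrightarrow> Pi_in V \<alpha> (subst F \<sigma>))"
  using assms
proof (induction \<alpha> arbitrary: F \<sigma> rule: less_induct)
  case (less \<alpha>)
  show ?case
  proof (intro conjI impI)
    assume "Sigma_in V \<alpha> F"
    then show "Sigma_in V \<alpha> (subst F \<sigma>)"
    proof (cases rule: Sigma_in_cases)
      case 1
      then show ?thesis
        using less.prems by (simp add: Sigma_in_zero subst_in_formulas finitary_subst quantifier_free_subst)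
    next
      case (2 \<Phi>)
      have "\<exists>\<beta><\<alpha>. \<exists>k G. subst H \<sigma> = (Exi ^^ k) G \<and> Pi_in V \<beta> G" if "H \<in> rcset \<Phi>" for H
      proof -
        obtain \<beta> k G where G: "\<beta> < \<alpha>" "H = (Exi ^^ k) G" "Pi_in V \<beta> G"
          using 2 \<open>H \<in> rcset \<Phi>\<close> by blast
        then show ?thesis
          using less.IH[OF G(1), of "(lift_subst ^^ k) \<sigma>" G] wf_lift_subst_pow[of V \<sigma> k, OF less.prems]
            subst_pow(1)[of k G \<sigma>] by blast
      qed
      moreover have "subst F \<sigma> = Disj (cimage (\<lambda>H. subst H \<sigma>) \<Phi>)"
        using 2(2) by (simp add: cset.map_comp comp_def)
      ultimately show ?thesis
        using 2 subst_in_formulas[of F V \<sigma>] less.prems by (auto intro!: Sigma_in_pos)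
    qed
  next
    assume "Pi_in V \<alpha> F"
    then show "Pi_in V \<alpha> (subst F \<sigma>)"
    proof (cases rule: Pi_in_cases)
      case 1
      then show ?thesis
        using less.prems by (simp add: Pi_in_zero subst_in_formulas finitary_subst quantifier_free_subst)
    next
      case (2 \<Phi>)
      have "\<exists>\<beta><\<alpha>. \<exists>k G. subst H \<sigma> = (Forall ^^ k) G \<and> Sigma_in V \<beta> G" if "H \<in> rcset \<Phi>" for H
      proof -
        obtain \<beta> k G where G: "\<beta> < \<alpha>" "H = (Forall ^^ k) G" "Sigma_in V \<beta> G"
          using 2 \<open>H \<in> rcset \<Phi>\<close> by blast
        then show ?thesis
          using less.IH[OF G(1), of "(lift_subst ^^ k) \<sigma>" G] wf_lift_subst_pow[of V \<sigma> k, OF less.prems]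
            subst_pow(2)[of k G \<sigma>] by blast
      qed
      moreover have "subst F \<sigma> = Conj (cimage (\<lambda>H. subst H \<sigma>) \<Phi>)"
        using 2(2) by (simp add: cset.map_comp comp_def)
      ultimately show ?thesis
        using 2 subst_in_formulas[of F V \<sigma>] less.prems by (auto intro!: Pi_in_pos)
    qed
  qed
qed

text \<open>Arguing about definable properties of environments instead of formulas replaces rewriting
  to normal form.\<close>

definition sigma_def :: "vocab \<Rightarrow> om1 \<Rightarrow> nat set \<Rightarrow> (struct \<Rightarrow> (nat \<Rightarrow> nat) \<Rightarrow> bool) \<Rightarrow> bool" where
  "sigma_def V \<gamma> D P \<longleftrightarrow> (\<exists>G. Sigma_in V \<gamma> G \<and> fv G \<subseteq> D \<and> (\<forall>M e. sat M G e \<longleftrightarrow> P M e))"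

definition pi_def :: "vocab \<Rightarrow> om1 \<Rightarrow> nat set \<Rightarrow> (struct \<Rightarrow> (nat \<Rightarrow> nat) \<Rightarrow> bool) \<Rightarrow> bool" where
  "pi_def V \<gamma> D P \<longleftrightarrow> (\<exists>G. Pi_in V \<gamma> G \<and> fv G \<subseteq> D \<and> (\<forall>M e. sat M G e \<longleftrightarrow> P M e))"

text \<open>Duality at the level of properties: each closure fact for one class gives its mirror
  image for the other without a second construction.\<close>

lemma pi_def_iff_sigma_def_not: "pi_def V \<gamma> D P \<longleftrightarrow> sigma_def V \<gamma> D (\<lambda>M e. \<not> P M e)"
  unfolding sigma_def_def pi_def_def using in_hierarchy_dual[of V \<gamma>] by (metis (no_types, lifting))

lemma sigma_def_iff_pi_def_not: "sigma_def V \<gamma> D P \<longleftrightarrow> pi_def V \<gamma> D (\<lambda>M e. \<not> P M e)"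
  by (simp add: pi_def_iff_sigma_def_not)

lemma sigma_def_mono_fv: "sigma_def V \<gamma> D P \<Longrightarrow> D \<subseteq> D' \<Longrightarrow> sigma_def V \<gamma> D' P"
  unfolding sigma_def_def by blast

definition sigma_part :: "vocab \<Rightarrow> om1 \<Rightarrow> fml \<Rightarrow> bool" where
  "sigma_part V \<gamma> H \<longleftrightarrow> (\<exists>\<beta><\<gamma>. \<exists>k G. H = (Exi ^^ k) G \<and> Pi_in V \<beta> G)"

text \<open>With \<open>sigma_defE\<close> this identifies the \<Sigma> properties of a positive
  level with countable unions of parts. D is finite because even an infinite disjunction must have
  finitely many free variables.\<close>

lemma sigma_defI:
  assumes "0 < \<gamma>" "finite D" "countable X" "\<And>H. H \<in> X \<Longrightarrow> fv H \<subseteq> D \<and> sigma_part V \<gamma> H"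
    and "\<And>M e. P M e \<longleftrightarrow> (\<exists>H\<in>X. sat M H e)"
  shows "sigma_def V \<gamma> D P"
  unfolding sigma_def_def
proof (intro exI conjI)
  have "wf_symbols V H" if "H \<in> X" for H
    using assms(4)[OF that] by (auto simp: sigma_part_def formulas_def dest!: Pi_in_formulas)
  moreover have "finite (\<Union> (fv ` X))"
    using assms(2,4) by (auto intro: finite_subset[of _ D])
  ultimately show "Sigma_in V \<gamma> (Disj (acset X))"
    using assms by (intro Sigma_in_pos) (auto simp: formulas_def sigma_part_def)
  show "fv (Disj (acset X)) \<subseteq> D"
    using assms by auto
  show "\<forall>M e. sat M (Disj (acset X)) e \<longleftrightarrow> P M e"
    using assms by simp
qed

lemma sigma_defE:
  assumes "sigma_def V \<gamma> D P" "0 < \<gamma>"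
  obtains X where "countable X" "\<And>H. H \<in> X \<Longrightarrow> fv H \<subseteq> D \<and> sigma_part V \<gamma> H"
    "\<And>M e. P M e \<longleftrightarrow> (\<exists>H\<in>X. sat M H e)"
proof -
  obtain G where G: "Sigma_in V \<gamma> G" "fv G \<subseteq> D" "\<And>M e. sat M G e \<longleftrightarrow> P M e"
    using assms(1) unfolding sigma_def_def by blast
  from G(1) obtain \<Phi> where \<Phi>: "G = Disj \<Phi>"
      "\<forall>F\<in>rcset \<Phi>. \<exists>\<beta><\<gamma>. \<exists>k G. F = (Exi ^^ k) G \<and> Pi_in V \<beta> G"
    using assms(2) by (auto elim!: Sigma_in_cases)
  show ?thesis
  proof (rule that[of "rcset \<Phi>"])
    show "fv H \<subseteq> D \<and> sigma_part V \<gamma> H" if "H \<in> rcset \<Phi>" for H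
      using that \<Phi> G(2) by (auto simp: sigma_part_def)
    show "P M e \<longleftrightarrow> (\<exists>H\<in>rcset \<Phi>. sat M H e)" for M e
      using G(3)[of M e] \<Phi>(1) by simp
  qed simp
qed

lemma pi_def_imp_sigma_def:
  assumes "pi_def V \<beta> D P" "\<beta> < \<gamma>" "finite D"
  shows "sigma_def V \<gamma> D P"
proof -
  obtain G where G: "Pi_in V \<beta> G" "fv G \<subseteq> D" "\<And>M e. sat M G e \<longleftrightarrow> P M e"
    using assms(1) unfolding pi_def_def by blast
  have "sigma_part V \<gamma> G"
    unfolding sigma_part_def using G(1) assms(2) by (intro exI[of _ \<beta>] conjI exI[of _ 0] exI[of _ G]) auto
  then show ?thesis
    using G assms by (intro sigma_defI[where X = "{G}"]) (auto intro: le_less_trans[OF zero_le_om1])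
qed

text \<open>From a positive level the same disjuncts serve at every higher one. Formulas of level 0
  need not be disjunctions of parts, but there \<Sigma> and \<Pi> coincide, so the formula itself
  becomes the only disjunct.\<close>

lemma sigma_def_mono:
  assumes "sigma_def V \<beta> D P" "\<beta> \<le> \<gamma>" "finite D"
  shows "sigma_def V \<gamma> D P"
proof (cases "\<beta> = 0")
  case True
  show ?thesis
  proof (cases "\<gamma> = \<beta>")
    case False
    then have "\<beta> < \<gamma>"
      using assms(2) by simp
    moreover have "pi_def V \<beta> D P"
      using assms(1) unfolding sigma_def_def pi_def_def True by (simp add: Sigma_in_zero Pi_in_zero)
    ultimately show ?thesis
      using assms(3) by (intro pi_def_imp_sigma_def)
  qed (use assms in simp)
next
  case False
  then have "0 < \<beta>"
    by (simp add: order.not_eq_order_implies_strict)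
  obtain X where X: "countable X" "\<And>H. H \<in> X \<Longrightarrow> fv H \<subseteq> D \<and> sigma_part V \<beta> H"
    "\<And>M e. P M e \<longleftrightarrow> (\<exists>H\<in>X. sat M H e)"
    by (rule sigma_defE[OF assms(1) \<open>0 < \<beta>\<close>], rule that)
  have "sigma_part V \<gamma> H" if H: "sigma_part V \<beta> H" for H
  proof -
    obtain \<beta>' k G where "\<beta>' < \<beta>" "H = (Exi ^^ k) G" "Pi_in V \<beta>' G"
      using H unfolding sigma_part_def by blast
    moreover have "\<beta>' < \<gamma>"
      using \<open>\<beta>' < \<beta>\<close> assms(2) by (rule less_le_trans)
    ultimately show ?thesis
      unfolding sigma_part_def by blast
  qed
  then show ?thesis
    using X assms \<open>0 < \<beta>\<close> by (intro sigma_defI[where X = X]) auto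
qed

lemma pi_def_mono: "pi_def V \<beta> D P \<Longrightarrow> \<beta> \<le> \<gamma> \<Longrightarrow> finite D \<Longrightarrow> pi_def V \<gamma> D P"
  unfolding pi_def_iff_sigma_def_not by (rule sigma_def_mono)

lemma sigma_def_imp_pi_def: "sigma_def V \<beta> D P \<Longrightarrow> \<beta> < \<gamma> \<Longrightarrow> finite D \<Longrightarrow> pi_def V \<gamma> D P"
  unfolding pi_def_iff_sigma_def_not sigma_def_iff_pi_def_not[of _ _ _ P]
  by (rule pi_def_imp_sigma_def[unfolded pi_def_iff_sigma_def_not]) simp_all

lemma sigma_def_Bex:
  assumes "0 < \<gamma>" "finite D" "countable I" "\<And>i. i \<in> I \<Longrightarrow> sigma_def V \<gamma> D (P i)"
  shows "sigma_def V \<gamma> D (\<lambda>M e. \<exists>i\<in>I. P i M e)"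
proof -
  let ?parts = "\<lambda>i X. countable X \<and> (\<forall>H\<in>X. fv H \<subseteq> D \<and> sigma_part V \<gamma> H) \<and>
    (\<forall>M e. P i M e \<longleftrightarrow> (\<exists>H\<in>X. sat M H e))"
  have "\<forall>i\<in>I. \<exists>X. ?parts i X"
  proof
    fix i
    assume "i \<in> I"
    then have P: "sigma_def V \<gamma> D (P i)"
      by (rule assms(4))
    obtain X where "countable X" "\<And>H. H \<in> X \<Longrightarrow> fv H \<subseteq> D \<and> sigma_part V \<gamma> H"
      "\<And>M e. P i M e \<longleftrightarrow> (\<exists>H\<in>X. sat M H e)"
      by (rule sigma_defE[OF P assms(1)], rule that)
    then show "\<exists>X. ?parts i X"
      by blast
  qed
  from bchoice[OF this] obtain X where "\<forall>i\<in>I. ?parts i (X i)" ..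
  then have X: "\<And>i. i \<in> I \<Longrightarrow> ?parts i (X i)"
    by (rule bspec)
  show ?thesis
  proof (rule sigma_defI[where X = "\<Union> (X ` I)"])
    show "fv H \<subseteq> D \<and> sigma_part V \<gamma> H" if "H \<in> \<Union> (X ` I)" for H
      using that X by blast
    show "(\<exists>i\<in>I. P i M e) \<longleftrightarrow> (\<exists>H\<in>\<Union> (X ` I). sat M H e)" for M e
      using X by simp
    show "countable (\<Union> (X ` I))"
      using assms(3) X by (intro countable_UN) blast+
  qed (use assms in auto)
qed

lemma pi_def_Ball:
  assumes "0 < \<gamma>" "finite D" "countable I" "\<And>i. i \<in> I \<Longrightarrow> pi_def V \<gamma> D (P i)"
  shows "pi_def V \<gamma> D (\<lambda>M e. \<forall>i\<in>I. P i M e)"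
  using sigma_def_Bex[of \<gamma> D I V "\<lambda>i M e. \<not> P i M e"] assms by (simp add: pi_def_iff_sigma_def_not)

text \<open>The quantifier distributes over the countable disjunction and lengthens the block of
  each disjunct by one.\<close>

lemma sigma_def_Exi:
  assumes "0 < \<gamma>" "finite D" "sigma_def V \<gamma> D' P" "D' \<subseteq> insert 0 (Suc ` D)"
  shows "sigma_def V \<gamma> D (\<lambda>M e. \<exists>a\<in>univ M. P M (case_nat a e))"
proof -
  obtain X where X: "countable X" "\<And>H. H \<in> X \<Longrightarrow> fv H \<subseteq> D' \<and> sigma_part V \<gamma> H"
    "\<And>M e. P M e \<longleftrightarrow> (\<exists>H\<in>X. sat M H e)"
    by (rule sigma_defE[OF assms(3,1)], rule that)
  have "sigma_part V \<gamma> (Exi H)" if "sigma_part V \<gamma> H" for H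
    using that unfolding sigma_part_def by (metis comp_apply funpow.simps(2))
  moreover have "fv (Exi H) \<subseteq> D" if "H \<in> X" for H
    using X(2)[OF that] assms(4) by auto
  ultimately have parts: "fv (Exi H) \<subseteq> D \<and> sigma_part V \<gamma> (Exi H)" if "H \<in> X" for H
    using X(2) that by blast
  show ?thesis
  proof (rule sigma_defI[where X = "Exi ` X"])
    show "fv H \<subseteq> D \<and> sigma_part V \<gamma> H" if "H \<in> Exi ` X" for H
      using that parts by blast
    show "(\<exists>a\<in>univ M. P M (case_nat a e)) \<longleftrightarrow> (\<exists>H\<in>Exi ` X. sat M H e)" for M e
      using X(3) by auto
  qed (use assms X(1) in auto)
qed

lemma pi_def_Forall:
  assumes "0 < \<gamma>" "finite D" "pi_def V \<gamma> D' P" "D' \<subseteq> insert 0 (Suc ` D)"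
  shows "pi_def V \<gamma> D (\<lambda>M e. \<forall>a\<in>univ M. P M (case_nat a e))"
  using sigma_def_Exi[of \<gamma> D V D' "\<lambda>M e. \<not> P M e"] assms by (simp add: pi_def_iff_sigma_def_not)

lemma sigma_def_subst:
  assumes "sigma_def V \<gamma> D P" "\<And>i. wf_trm V (\<sigma> i)" "(\<Union>i\<in>D. fv_trm (\<sigma> i)) \<subseteq> D'"
  shows "sigma_def V \<gamma> D' (\<lambda>M e. P M (\<lambda>i. tval M e (\<sigma> i)))"
proof -
  obtain G where G: "Sigma_in V \<gamma> G" "fv G \<subseteq> D" "\<And>M e. sat M G e \<longleftrightarrow> P M e"
    using assms(1) unfolding sigma_def_def by blast
  show ?thesis
    unfolding sigma_def_def
  proof (intro exI conjI)
    show "Sigma_in V \<gamma> (subst G \<sigma>)"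
      using in_hierarchy_subst[of V \<sigma>] assms(2) G(1) by blast
    show "fv (subst G \<sigma>) \<subseteq> D'"
      using G(2) assms(3) by (auto simp: fv_subst)
    show "\<forall>M e. sat M (subst G \<sigma>) e \<longleftrightarrow> P M (\<lambda>i. tval M e (\<sigma> i))"
      by (simp add: sat_subst G(3))
  qed
qed

lemma pi_def_subst:
  assumes "pi_def V \<gamma> D P" "\<And>i. wf_trm V (\<sigma> i)" "(\<Union>i\<in>D. fv_trm (\<sigma> i)) \<subseteq> D'"
  shows "pi_def V \<gamma> D' (\<lambda>M e. P M (\<lambda>i. tval M e (\<sigma> i)))"
  using sigma_def_subst[of V \<gamma> D "\<lambda>M e. \<not> P M e" \<sigma> D'] assms by (simp add: pi_def_iff_sigma_def_not)

section \<open>Conjunctions of formulas with quantifier blocks\<close>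

lemma Pi_in_binary_conj:
  assumes "Pi_in V \<beta> G1" "Pi_in V \<beta> G2"
  shows "\<exists>G. Pi_in V \<beta> G \<and> fv G = fv G1 \<union> fv G2 \<and> (\<forall>M e. sat M G e \<longleftrightarrow> sat M G1 e \<and> sat M G2 e)"
proof (cases "\<beta> = 0")
  case True
  then show ?thesis
    using assms by (intro exI[of _ "Conj (acset {G1, G2})"]) (auto simp: Pi_in_zero formulas_def)
next
  case False
  from assms(1) False obtain \<Phi>1 where 1: "0 < \<beta>" "G1 = Conj \<Phi>1" "Conj \<Phi>1 \<in> formulas V"
      "\<forall>F\<in>rcset \<Phi>1. \<exists>\<gamma><\<beta>. \<exists>k G. F = (Forall ^^ k) G \<and> Sigma_in V \<gamma> G"
    by (auto elim: Pi_in_cases)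
  from assms(2) False obtain \<Phi>2 where 2: "G2 = Conj \<Phi>2" "Conj \<Phi>2 \<in> formulas V"
      "\<forall>F\<in>rcset \<Phi>2. \<exists>\<gamma><\<beta>. \<exists>k G. F = (Forall ^^ k) G \<and> Sigma_in V \<gamma> G"
    by (auto elim: Pi_in_cases)
  let ?G = "Conj (acset (rcset \<Phi>1 \<union> rcset \<Phi>2))"
  have "Pi_in V \<beta> ?G"
    using 1 2 by (intro Pi_in_pos) (auto simp: formulas_def)
  then show ?thesis
    using 1 2 by (intro exI[of _ ?G]) auto
qed

text \<open>The two blocks are merged by pulling out one quantifier at a time and shifting the other
  conjunct past it. Shifting the second conjunct amounts to substituting, lifted m times, in its
  matrix.\<close>

lemma Exi_pow_binary_conj:
  assumes "Pi_in V \<beta> G1" "Pi_in V \<beta> G2"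
  shows "\<exists>G. Pi_in V \<beta> G \<and> fv ((Exi ^^ (k + m)) G) \<subseteq> fv ((Exi ^^ k) G1) \<union> fv ((Exi ^^ m) G2) \<and>
    (\<forall>M e. sat M ((Exi ^^ (k + m)) G) e \<longleftrightarrow> sat M ((Exi ^^ k) G1) e \<and> sat M ((Exi ^^ m) G2) e)"
  using assms
proof (induction k arbitrary: G1 G2)
  case 0
  then show ?case
  proof (induction m arbitrary: G1)
    case 0
    then show ?case
      using Pi_in_binary_conj[of V \<beta> G1 G2] by (auto; blast)
  next
    case (Suc m)
    have "Pi_in V \<beta> (shift G1)"
      using in_hierarchy_subst[of V "\<lambda>i. Var (Suc i)" \<beta> G1] Suc.prems(1) by (simp add: shift_def)
    from Suc.IH[OF this Suc.prems(2)] obtain G where G: "Pi_in V \<beta> G"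
      "fv ((Exi ^^ m) G) \<subseteq> fv (shift G1) \<union> fv ((Exi ^^ m) G2)"
      "\<And>M e. sat M ((Exi ^^ m) G) e \<longleftrightarrow> sat M (shift G1) e \<and> sat M ((Exi ^^ m) G2) e"
      by auto
    have "fv (shift G1) = Suc ` fv G1"
      by (auto simp: shift_def fv_subst)
    then show ?case
      using G by (intro exI[of _ G]) (auto simp: sat_shift)
  qed
next
  case (Suc k)
  have "Pi_in V \<beta> (subst G2 ((lift_subst ^^ m) (\<lambda>i. Var (Suc i))))"
    using in_hierarchy_subst[of V "(lift_subst ^^ m) (\<lambda>i. Var (Suc i))" \<beta> G2]
      wf_lift_subst_pow[of V "\<lambda>i. Var (Suc i)" m] Suc.prems(2) by simp
  from Suc.IH[OF Suc.prems(1) this] obtain G where G: "Pi_in V \<beta> G"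
    "fv ((Exi ^^ (k + m)) G) \<subseteq> fv ((Exi ^^ k) G1) \<union> fv (shift ((Exi ^^ m) G2))"
    "\<And>M e. sat M ((Exi ^^ (k + m)) G) e \<longleftrightarrow> sat M ((Exi ^^ k) G1) e \<and> sat M (shift ((Exi ^^ m) G2)) e"
    by (auto simp: shift_def subst_pow)
  have "fv (shift ((Exi ^^ m) G2)) = Suc ` fv ((Exi ^^ m) G2)"
    by (auto simp: shift_def fv_subst)
  then show ?case
    using G by (intro exI[of _ G]) (auto simp: sat_shift)
qed

lemma sigma_part_conj:
  assumes "sigma_part V \<gamma> H1" "sigma_part V \<gamma> H2"
  shows "\<exists>H. sigma_part V \<gamma> H \<and> fv H \<subseteq> fv H1 \<union> fv H2 \<and> (\<forall>M e. sat M H e \<longleftrightarrow> sat M H1 e \<and> sat M H2 e)"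
proof -
  obtain \<beta>1 k1 G1 where 1: "\<beta>1 < \<gamma>" "H1 = (Exi ^^ k1) G1" "Pi_in V \<beta>1 G1"
    using assms(1) unfolding sigma_part_def by blast
  obtain \<beta>2 k2 G2 where 2: "\<beta>2 < \<gamma>" "H2 = (Exi ^^ k2) G2" "Pi_in V \<beta>2 G2"
    using assms(2) unfolding sigma_part_def by blast
  \<comment> \<open>Matrices are conjoined within one level, so both are first rewritten at the
    larger of the two levels.\<close>
  define \<beta> where "\<beta> = max \<beta>1 \<beta>2"
  have \<beta>: "\<beta>1 \<le> \<beta>" "\<beta>2 \<le> \<beta>" "\<beta> < \<gamma>"
    using 1(1) 2(1) by (simp_all add: \<beta>_def)
  have up: "\<exists>G'. Pi_in V \<beta> G' \<and> fv G' \<subseteq> fv G \<and> (\<forall>M e. sat M G' e \<longleftrightarrow> sat M G e)"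
    if "Pi_in V \<beta>' G" "\<beta>' \<le> \<beta>" for \<beta>' G
  proof -
    have "finite (fv G)"
      using Pi_in_formulas[OF that(1)] by (simp add: formulas_def)
    moreover have "pi_def V \<beta>' (fv G) (\<lambda>M. sat M G)"
      using that(1) unfolding pi_def_def by blast
    ultimately have "pi_def V \<beta> (fv G) (\<lambda>M. sat M G)"
      using pi_def_mono[of V \<beta>' "fv G"] that(2) by blast
    then show ?thesis
      by (simp only: pi_def_def)
  qed
  obtain G1' where g1: "Pi_in V \<beta> G1'" "fv G1' \<subseteq> fv G1" "\<And>M e. sat M G1' e \<longleftrightarrow> sat M G1 e"
    using up[OF 1(3) \<beta>(1)] by blast
  obtain G2' where g2: "Pi_in V \<beta> G2'" "fv G2' \<subseteq> fv G2" "\<And>M e. sat M G2' e \<longleftrightarrow> sat M G2 e"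
    using up[OF 2(3) \<beta>(2)] by blast
  obtain G where G: "Pi_in V \<beta> G"
    "fv ((Exi ^^ (k1 + k2)) G) \<subseteq> fv ((Exi ^^ k1) G1') \<union> fv ((Exi ^^ k2) G2')"
    "\<And>M e. sat M ((Exi ^^ (k1 + k2)) G) e \<longleftrightarrow> sat M ((Exi ^^ k1) G1') e \<and> sat M ((Exi ^^ k2) G2') e"
    using Exi_pow_binary_conj[OF g1(1) g2(1), of k1 k2] by blast
  show ?thesis
  proof (intro exI conjI allI)
    show "sigma_part V \<gamma> ((Exi ^^ (k1 + k2)) G)"
      unfolding sigma_part_def using G(1) \<beta>(3) by blast
    show "fv ((Exi ^^ (k1 + k2)) G) \<subseteq> fv H1 \<union> fv H2"
      using G(2) g1(2) g2(2) 1(2) 2(2) by (auto simp: fv_pow)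
    show "sat M ((Exi ^^ (k1 + k2)) G) e \<longleftrightarrow> sat M H1 e \<and> sat M H2 e" for M e
      using G(3) sat_pow_cong[OF g1(3)] sat_pow_cong[OF g2(3)] 1(2) 2(2) by simp
  qed
qed

text \<open>Conjunction distributes over the two disjunctions; the new disjuncts are indexed by
  pairs.\<close>

lemma sigma_def_conj:
  assumes "0 < \<gamma>" "finite D" "sigma_def V \<gamma> D P" "sigma_def V \<gamma> D Q"
  shows "sigma_def V \<gamma> D (\<lambda>M e. P M e \<and> Q M e)"
proof -
  obtain X where X: "countable X" "\<And>H. H \<in> X \<Longrightarrow> fv H \<subseteq> D \<and> sigma_part V \<gamma> H"
    "\<And>M e. P M e \<longleftrightarrow> (\<exists>H\<in>X. sat M H e)"
    by (rule sigma_defE[OF assms(3,1)], rule that)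
  obtain Y where Y: "countable Y" "\<And>H. H \<in> Y \<Longrightarrow> fv H \<subseteq> D \<and> sigma_part V \<gamma> H"
    "\<And>M e. Q M e \<longleftrightarrow> (\<exists>H\<in>Y. sat M H e)"
    by (rule sigma_defE[OF assms(4,1)], rule that)
  let ?both = "\<lambda>p H. sigma_part V \<gamma> H \<and> fv H \<subseteq> D \<and> (\<forall>M e. sat M H e \<longleftrightarrow> sat M (fst p) e \<and> sat M (snd p) e)"
  have "\<forall>p\<in>X \<times> Y. \<exists>H. ?both p H"
  proof
    fix p
    assume "p \<in> X \<times> Y"
    then have "fst p \<in> X" "snd p \<in> Y"
      by auto
    with sigma_part_conj[of V \<gamma> "fst p" "snd p"] X(2) Y(2)
    obtain H where "sigma_part V \<gamma> H" "fv H \<subseteq> fv (fst p) \<union> fv (snd p)"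
      "\<forall>M e. sat M H e \<longleftrightarrow> sat M (fst p) e \<and> sat M (snd p) e" "fv (fst p) \<subseteq> D" "fv (snd p) \<subseteq> D"
      by blast
    then show "\<exists>H. ?both p H"
      by (intro exI[of _ H]) blast
  qed
  from bchoice[OF this] obtain c where "\<forall>p\<in>X \<times> Y. ?both p (c p)" ..
  then have c: "\<And>p. p \<in> X \<times> Y \<Longrightarrow> ?both p (c p)"
    by (rule bspec)
  show ?thesis
  proof (rule sigma_defI[where X = "c ` (X \<times> Y)"])
    show "P M e \<and> Q M e \<longleftrightarrow> (\<exists>H\<in>c ` (X \<times> Y). sat M H e)" for M e
      unfolding X(3) Y(3) using c by fastforce
    show "fv H \<subseteq> D \<and> sigma_part V \<gamma> H" if "H \<in> c ` (X \<times> Y)" for H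
      using that c by blast
  qed (use assms X(1) Y(1) in auto)
qed

lemma sigma_def_True:
  assumes "finite D"
  shows "sigma_def V \<gamma> D (\<lambda>M e. True)"
proof -
  have "sigma_def V 0 D (\<lambda>M e. True)"
    unfolding sigma_def_def Sigma_in_zero by (intro exI[of _ "Conj (acset {})"]) (auto simp: formulas_def)
  then show ?thesis
    using sigma_def_mono[OF _ zero_le_om1 assms] by blast
qed

lemma sigma_def_finite_Ball:
  assumes "0 < \<gamma>" "finite D" "finite I" "\<And>i. i \<in> I \<Longrightarrow> sigma_def V \<gamma> D (P i)"
  shows "sigma_def V \<gamma> D (\<lambda>M e. \<forall>i\<in>I. P i M e)"
  using assms(3,4)
proof (induction I)
  case empty
  then show ?case using sigma_def_True[OF assms(2)] by simp
next
  case (insert i I)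
  then show ?case
    using sigma_def_conj[OF assms(1,2), of V "P i" "\<lambda>M e. \<forall>i\<in>I. P i M e"] by simp
qed

lemma pi_def_finite_Bex:
  assumes "0 < \<gamma>" "finite D" "finite I" "\<And>i. i \<in> I \<Longrightarrow> pi_def V \<gamma> D (P i)"
  shows "pi_def V \<gamma> D (\<lambda>M e. \<exists>i\<in>I. P i M e)"
  using sigma_def_finite_Ball[of \<gamma> D I V "\<lambda>i M e. \<not> P i M e"] assms by (simp add: pi_def_iff_sigma_def_not)

lemma sigma_def_finitary:
  assumes "F \<in> formulas V" "finitary F" "quantifier_free F" "finite D" "fv F \<subseteq> D"
  shows "sigma_def V \<gamma> D (\<lambda>M. sat M F)" "pi_def V \<gamma> D (\<lambda>M. sat M F)"
proof -
  have "sigma_def V 0 D (\<lambda>M. sat M F)" "pi_def V 0 D (\<lambda>M. sat M F)"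
    unfolding sigma_def_def pi_def_def Sigma_in_zero Pi_in_zero using assms by blast+
  then show "sigma_def V \<gamma> D (\<lambda>M. sat M F)" "pi_def V \<gamma> D (\<lambda>M. sat M F)"
    using sigma_def_mono[OF _ zero_le_om1 assms(4)] pi_def_mono[OF _ zero_le_om1 assms(4)] by blast+
qed

text \<open>Every placement rule for arbitrary formulas is matched by a closure property of
  definable properties. D may exceed the free variables, since the members of a conjunction or
  disjunction are treated over the variables of the whole.\<close>

lemma in_Sigma_in_Pi_definable:
  "in_Sigma \<alpha> F \<Longrightarrow> wf_symbols V F \<Longrightarrow> finite D \<Longrightarrow> fv F \<subseteq> D \<Longrightarrow> sigma_def V \<alpha> D (\<lambda>M. sat M F)"
  "in_Pi \<alpha> F \<Longrightarrow> wf_symbols V F \<Longrightarrow> finite D \<Longrightarrow> fv F \<subseteq> D \<Longrightarrow> pi_def V \<alpha> D (\<lambda>M. sat M F)"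
proof (induction arbitrary: D and D rule: in_Sigma_in_Pi.inducts)
  case (1 F \<alpha>)
  then show ?case
    using finite_subset by (intro sigma_def_finitary) (auto simp: formulas_def)
next
  case (2 F \<alpha>)
  then show ?case
    using finite_subset by (intro sigma_def_finitary) (auto simp: formulas_def)
next
  case (3 \<beta> F \<alpha>)
  show ?case
    by (rule pi_def_imp_sigma_def[OF "3.IH"[OF "3.prems"] "3.hyps"(2) "3.prems"(2)])
next
  case (4 \<beta> F \<alpha>)
  show ?case
    by (rule sigma_def_imp_pi_def[OF "4.IH"[OF "4.prems"] "4.hyps"(2) "4.prems"(2)])
next
  case (5 \<alpha> F)
  then show ?case by (simp add: sigma_def_iff_pi_def_not)
next
  case (6 \<alpha> F)
  then show ?case by (simp add: pi_def_iff_sigma_def_not)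
next
  case (7 \<alpha> \<Phi>)
  have "sigma_def V \<alpha> D (\<lambda>M e. \<exists>F\<in>rcset \<Phi>. sat M F e)"
    using 7 by (intro sigma_def_Bex) (auto simp: UN_subset_iff)
  then show ?case by simp
next
  case (8 \<alpha> \<Phi>)
  have "pi_def V \<alpha> D (\<lambda>M e. \<forall>F\<in>rcset \<Phi>. sat M F e)"
    using 8 by (intro pi_def_Ball) (auto simp: UN_subset_iff)
  then show ?case by simp
next
  case (9 \<alpha> \<Phi>)
  have "sigma_def V \<alpha> D (\<lambda>M e. \<forall>F\<in>rcset \<Phi>. sat M F e)"
    using 9 by (intro sigma_def_finite_Ball) (auto simp: UN_subset_iff)
  then show ?case by simp
next
  case (10 \<alpha> \<Phi>)
  have "pi_def V \<alpha> D (\<lambda>M e. \<exists>F\<in>rcset \<Phi>. sat M F e)"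
    using 10 by (intro pi_def_finite_Bex) (auto simp: UN_subset_iff)
  then show ?case by simp
next
  case (11 \<alpha> F)
  have "i \<in> insert 0 (Suc ` D)" if "i \<in> fv F" for i
    using that 11 by (cases i) auto
  then have "sigma_def V \<alpha> (insert 0 (Suc ` D)) (\<lambda>M. sat M F)"
    using 11 by (intro "11.IH") auto
  then show ?case
    using sigma_def_Exi[OF "11.hyps"(1) "11.prems"(2) _ order_refl, of V "\<lambda>M. sat M F"] by simp
next
  case (12 \<alpha> F)
  have "i \<in> insert 0 (Suc ` D)" if "i \<in> fv F" for i
    using that 12 by (cases i) auto
  then have "pi_def V \<alpha> (insert 0 (Suc ` D)) (\<lambda>M. sat M F)"
    using 12 by (intro "12.IH") auto
  then show ?case
    using pi_def_Forall[OF "12.hyps"(1) "12.prems"(2) _ order_refl, of V "\<lambda>M. sat M F"] by simp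
qed

text \<open>A strict step may change between \<Sigma> and \<Pi>; two successors leave room to reach
  both classes from either one.\<close>

lemma in_hierarchy_step:
  assumes "in_Sigma \<beta> F \<or> in_Pi \<beta> F"
  shows "in_Sigma (osuc (osuc \<beta>)) F" "in_Pi (osuc (osuc \<beta>)) F"
proof -
  have "\<beta> < osuc (osuc \<beta>)"
    using less_trans[OF less_osuc less_osuc] .
  with assms show "in_Sigma (osuc (osuc \<beta>)) F" "in_Pi (osuc (osuc \<beta>)) F"
    by (meson in_Sigma_in_Pi.intros(3,4) less_osuc)+
qed

lemma in_hierarchy_countable:
  assumes "\<And>F. F \<in> rcset \<Phi> \<Longrightarrow> \<exists>\<beta>. in_Sigma \<beta> F \<and> in_Pi \<beta> F"
  obtains \<alpha> where "0 < \<alpha>" "\<forall>F\<in>rcset \<Phi>. in_Sigma \<alpha> F" "\<forall>F\<in>rcset \<Phi>. in_Pi \<alpha> F"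
proof -
  obtain b where b: "\<And>F. F \<in> rcset \<Phi> \<Longrightarrow> in_Sigma (b F) F \<and> in_Pi (b F) F"
    using assms by metis
  obtain \<alpha> where "\<forall>\<beta>\<in>insert 0 (b ` rcset \<Phi>). \<beta> < \<alpha>"
    using om1_bounded[of "insert 0 (b ` rcset \<Phi>)"] by auto
  then have "0 < \<alpha>" "\<And>F. F \<in> rcset \<Phi> \<Longrightarrow> b F < \<alpha>"
    by auto
  then show ?thesis
    using b that in_Sigma_in_Pi.intros(3,4) by meson
qed

text \<open>This makes the minimum in \<open>qr\<close> meaningful. Both classes are carried through
  the induction, so that every connective finds its members in the class it needs; infinite ones use
  a common bound of countably many levels.\<close>

lemma in_hierarchy_exists: "\<exists>\<beta>. in_Sigma \<beta> F \<and> in_Pi \<beta> F"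
proof (induction F)
  case (Equal s t)
  then show ?case
    using in_Sigma_in_Pi.intros(1,2)[of "Equal s t"] by auto
next
  case (Atom r ts)
  then show ?case
    using in_Sigma_in_Pi.intros(1,2)[of "Atom r ts"] by auto
next
  case (Neg F)
  then show ?case
    using in_Sigma_in_Pi.intros(5,6) by blast
next
  case (Conj \<Phi>)
  then obtain \<alpha> where "0 < \<alpha>" "\<forall>F\<in>rcset \<Phi>. in_Pi \<alpha> F"
    by (rule in_hierarchy_countable)
  then have "in_Pi \<alpha> (Conj \<Phi>)"
    by (rule in_Sigma_in_Pi.intros(8))
  then show ?case
    using in_hierarchy_step by blast
next
  case (Disj \<Phi>)
  then obtain \<alpha> where "0 < \<alpha>" "\<forall>F\<in>rcset \<Phi>. in_Sigma \<alpha> F"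
    by (rule in_hierarchy_countable)
  then have "in_Sigma \<alpha> (Disj \<Phi>)"
    by (rule in_Sigma_in_Pi.intros(7))
  then show ?case
    using in_hierarchy_step by blast
next
  case (Exi F)
  then obtain \<beta> where "in_Sigma (osuc (osuc \<beta>)) F"
    using in_hierarchy_step by blast
  then have "in_Sigma (osuc (osuc \<beta>)) (Exi F)"
    by (intro in_Sigma_in_Pi.intros(11)) simp
  then show ?case
    using in_hierarchy_step by blast
next
  case (Forall F)
  then obtain \<beta> where "in_Pi (osuc (osuc \<beta>)) F"
    using in_hierarchy_step by blast
  then have "in_Pi (osuc (osuc \<beta>)) (Forall F)"
    by (intro in_Sigma_in_Pi.intros(12)) simp
  then show ?case
    using in_hierarchy_step by blast
qed

lemma qr_placed: "in_Pi (qr F) F \<or> in_Sigma (qr F) F"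
  unfolding qr_def by (rule LeastI_ex) (use in_hierarchy_exists in blast)

section \<open>Subformulas and two-sided ranks\<close>

primrec subfmls :: "fml \<Rightarrow> fml set" where
  "subfmls (Equal s t) = {Equal s t}"
| "subfmls (Atom r ts) = {Atom r ts}"
| "subfmls (Neg F) = insert (Neg F) (subfmls F)"
| "subfmls (Conj \<Phi>) = insert (Conj \<Phi>) (\<Union> (rcset (cimage subfmls \<Phi>)))"
| "subfmls (Disj \<Phi>) = insert (Disj \<Phi>) (\<Union> (rcset (cimage subfmls \<Phi>)))"
| "subfmls (Exi F) = insert (Exi F) (subfmls F)"
| "subfmls (Forall F) = insert (Forall F) (subfmls F)"

lemma subfmls_self [simp]: "F \<in> subfmls F"
  by (cases F) simp_all

lemma finitary_subfmls:
  "G \<in> subfmls F \<Longrightarrow> finitary F \<Longrightarrow> quantifier_free F \<Longrightarrow> finitary G \<and> quantifier_free G"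
  by (induction F) auto

text \<open>Each placement rule takes its components from the same level or a lower one, so levels
  never rise on the way down. Negation changes the class, hence the disjunction.\<close>

lemma subfmls_in_hierarchy:
  "in_Sigma \<alpha> F \<Longrightarrow> \<forall>G\<in>subfmls F. \<exists>\<beta>\<le>\<alpha>. in_Sigma \<beta> G \<or> in_Pi \<beta> G"
  "in_Pi \<alpha> F \<Longrightarrow> \<forall>G\<in>subfmls F. \<exists>\<beta>\<le>\<alpha>. in_Sigma \<beta> G \<or> in_Pi \<beta> G"
proof (induction rule: in_Sigma_in_Pi.inducts)
  case (1 F \<alpha>)
  then show ?case
    using finitary_subfmls in_Sigma_in_Pi.intros(1) by blast
next
  case (2 F \<alpha>)
  then show ?case
    using finitary_subfmls in_Sigma_in_Pi.intros(1) by blast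
next
  case (3 \<beta> F \<alpha>)
  then show ?case
    by (meson less_imp_le order_trans)
next
  case (4 \<beta> F \<alpha>)
  then show ?case
    by (meson less_imp_le order_trans)
next
  case (5 \<alpha> F)
  then have "in_Sigma \<alpha> (Neg F)"
    by (intro in_Sigma_in_Pi.intros(5))
  then show ?case using 5 by auto
next
  case (6 \<alpha> F)
  then have "in_Pi \<alpha> (Neg F)"
    by (intro in_Sigma_in_Pi.intros(6))
  then show ?case using 6 by auto
next
  case (7 \<alpha> \<Phi>)
  then have "in_Sigma \<alpha> (Disj \<Phi>)"
    by (intro in_Sigma_in_Pi.intros(7)) auto
  then show ?case using 7 by auto
next
  case (8 \<alpha> \<Phi>)
  then have "in_Pi \<alpha> (Conj \<Phi>)"
    by (intro in_Sigma_in_Pi.intros(8)) auto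
  then show ?case using 8 by auto
next
  case (9 \<alpha> \<Phi>)
  then have "in_Sigma \<alpha> (Conj \<Phi>)"
    by (intro in_Sigma_in_Pi.intros(9)) auto
  then show ?case using 9 by auto
next
  case (10 \<alpha> \<Phi>)
  then have "in_Pi \<alpha> (Disj \<Phi>)"
    by (intro in_Sigma_in_Pi.intros(10)) auto
  then show ?case using 10 by auto
next
  case (11 \<alpha> F)
  then have "in_Sigma \<alpha> (Exi F)"
    by (intro in_Sigma_in_Pi.intros(11)) auto
  then show ?case using 11 by auto
next
  case (12 \<alpha> F)
  then have "in_Pi \<alpha> (Forall F)"
    by (intro in_Sigma_in_Pi.intros(12)) auto
  then show ?case using 12 by auto
qed

text \<open>The analogue of a \<Delta> class, up to equivalence and with the same free variables.
  Two-sidedness makes it stable under negation and lets either quantifier be applied next.\<close>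

definition rank_le :: "vocab \<Rightarrow> om1 \<Rightarrow> fml \<Rightarrow> bool" where
  "rank_le V \<gamma> F \<longleftrightarrow> sigma_def V \<gamma> (fv F) (\<lambda>M. sat M F) \<and> pi_def V \<gamma> (fv F) (\<lambda>M. sat M F)"

lemma rank_le_mono: "rank_le V \<beta> F \<Longrightarrow> \<beta> \<le> \<gamma> \<Longrightarrow> F \<in> formulas V \<Longrightarrow> rank_le V \<gamma> F"
  unfolding rank_le_def formulas_def using sigma_def_mono pi_def_mono by blast

lemma rank_leI_sigma:
  assumes "sigma_def V \<beta> (fv F) (\<lambda>M. sat M F)" "\<beta> < \<gamma>" "F \<in> formulas V"
  shows "rank_le V \<gamma> F"
  using sigma_def_mono[OF assms(1) less_imp_le[OF assms(2)]] sigma_def_imp_pi_def[OF assms(1,2)] assms(3)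
  unfolding rank_le_def formulas_def by blast

lemma rank_leI_pi:
  assumes "pi_def V \<beta> (fv F) (\<lambda>M. sat M F)" "\<beta> < \<gamma>" "F \<in> formulas V"
  shows "rank_le V \<gamma> F"
  using pi_def_mono[OF assms(1) less_imp_le[OF assms(2)]] pi_def_imp_sigma_def[OF assms(1,2)] assms(3)
  unfolding rank_le_def formulas_def by blast

lemma rank_le_in_hierarchy:
  assumes "in_Sigma \<beta> F \<or> in_Pi \<beta> F" "\<beta> < \<gamma>" "F \<in> formulas V"
  shows "rank_le V \<gamma> F"
  using assms in_Sigma_in_Pi_definable[of \<beta> F V "fv F"]
  by (auto intro: rank_leI_sigma rank_leI_pi simp: formulas_def)

lemma rank_le_finitary:
  assumes "F \<in> formulas V" "finitary F" "quantifier_free F"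
  shows "rank_le V \<gamma> F"
  unfolding rank_le_def using sigma_def_finitary[OF assms, of "fv F"] assms(1) by (simp add: formulas_def)

lemma rank_le_Neg: "rank_le V \<gamma> F \<Longrightarrow> rank_le V \<gamma> (Neg F)"
  unfolding rank_le_def by (simp add: pi_def_iff_sigma_def_not)

lemma fv_member_subset: "F \<in> rcset \<Phi> \<Longrightarrow> fv F \<subseteq> fv (Conj \<Phi>)" "F \<in> rcset \<Phi> \<Longrightarrow> fv F \<subseteq> fv (Disj \<Phi>)"
  by auto

lemma pi_def_mono_fv: "pi_def V \<gamma> D P \<Longrightarrow> D \<subseteq> D' \<Longrightarrow> pi_def V \<gamma> D' P"
  unfolding pi_def_def by blast

text \<open>A countable conjunction stays \<Pi> at the level of its members and becomes two-sided at
  any larger one. This is the unit of cost in counting ranks.\<close>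

lemma rank_le_Conj:
  assumes "\<And>F. F \<in> rcset \<Phi> \<Longrightarrow> rank_le V \<beta> F" "0 < \<beta>" "\<beta> < \<gamma>" "Conj \<Phi> \<in> formulas V"
  shows "rank_le V \<gamma> (Conj \<Phi>)"
proof -
  have "pi_def V \<beta> (fv (Conj \<Phi>)) (\<lambda>M e. \<forall>F\<in>rcset \<Phi>. sat M F e)"
  proof (rule pi_def_Ball)
    fix F
    assume F: "F \<in> rcset \<Phi>"
    then show "pi_def V \<beta> (fv (Conj \<Phi>)) (\<lambda>M. sat M F)"
      using pi_def_mono_fv[OF _ fv_member_subset(1)[OF F]] assms(1)[OF F] unfolding rank_le_def by blast
  qed (use assms in \<open>auto simp: formulas_def\<close>)
  then show ?thesis
    using assms by (intro rank_leI_pi[of V \<beta>]) simp_all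
qed

lemma rank_le_Disj:
  assumes "\<And>F. F \<in> rcset \<Phi> \<Longrightarrow> rank_le V \<beta> F" "0 < \<beta>" "\<beta> < \<gamma>" "Disj \<Phi> \<in> formulas V"
  shows "rank_le V \<gamma> (Disj \<Phi>)"
proof -
  have "sigma_def V \<beta> (fv (Disj \<Phi>)) (\<lambda>M e. \<exists>F\<in>rcset \<Phi>. sat M F e)"
  proof (rule sigma_def_Bex)
    fix F
    assume F: "F \<in> rcset \<Phi>"
    then show "sigma_def V \<beta> (fv (Disj \<Phi>)) (\<lambda>M. sat M F)"
      using sigma_def_mono_fv[OF _ fv_member_subset(2)[OF F]] assms(1)[OF F] unfolding rank_le_def by blast
  qed (use assms in \<open>auto simp: formulas_def\<close>)
  then show ?thesis
    using assms by (intro rank_leI_sigma[of V \<beta>]) simp_all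
qed

lemma fv_quantifier_subset:
  "fv F \<subseteq> insert 0 (Suc ` fv (Exi F))" "fv F \<subseteq> insert 0 (Suc ` fv (Forall F))"
proof -
  have "i \<in> insert 0 (Suc ` {i. Suc i \<in> fv F})" if "i \<in> fv F" for i
    using that by (cases i) auto
  then show "fv F \<subseteq> insert 0 (Suc ` fv (Exi F))" "fv F \<subseteq> insert 0 (Suc ` fv (Forall F))"
    by auto
qed

lemma rank_le_Exi:
  assumes "rank_le V \<beta> F" "0 < \<beta>" "\<beta> < \<gamma>" "Exi F \<in> formulas V"
  shows "rank_le V \<gamma> (Exi F)"
proof -
  have "sigma_def V \<beta> (fv (Exi F)) (\<lambda>M e. \<exists>a\<in>univ M. sat M F (case_nat a e))"
    using sigma_def_Exi[OF assms(2) _ _ fv_quantifier_subset(1), where V = V and P = "\<lambda>M. sat M F"] assms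
    unfolding rank_le_def formulas_def by blast
  then show ?thesis
    using assms by (intro rank_leI_sigma[of V \<beta>]) simp_all
qed

lemma rank_le_Forall:
  assumes "rank_le V \<beta> F" "0 < \<beta>" "\<beta> < \<gamma>" "Forall F \<in> formulas V"
  shows "rank_le V \<gamma> (Forall F)"
proof -
  have "pi_def V \<beta> (fv (Forall F)) (\<lambda>M e. \<forall>a\<in>univ M. sat M F (case_nat a e))"
    using pi_def_Forall[OF assms(2) _ _ fv_quantifier_subset(2), where V = V and P = "\<lambda>M. sat M F"] assms
    unfolding rank_le_def formulas_def by blast
  then show ?thesis
    using assms by (intro rank_leI_pi[of V \<beta>]) simp_all
qed

lemma rank_le_subst:
  assumes "rank_le V \<gamma> F" "\<And>i. wf_trm V (\<sigma> i)"
  shows "rank_le V \<gamma> (subst F \<sigma>)"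
  using sigma_def_subst[of V \<gamma> "fv F" "\<lambda>M. sat M F" \<sigma> "fv (subst F \<sigma>)"]
    pi_def_subst[of V \<gamma> "fv F" "\<lambda>M. sat M F" \<sigma> "fv (subst F \<sigma>)"] assms
  unfolding rank_le_def sat_subst by (simp add: fv_subst sat_subst)

section \<open>Fragments\<close>

lemma fragment_dest:
  assumes "fragment V L"
  shows "countable L" "L \<subseteq> formulas V"
    "wf_trm V s \<Longrightarrow> wf_trm V t \<Longrightarrow> Equal s t \<in> L"
    "rel_ar V r = Some (length ts) \<Longrightarrow> list_all (wf_trm V) ts \<Longrightarrow> Atom r ts \<in> L"
    "Neg F \<in> L \<longleftrightarrow> F \<in> L" "Exi F \<in> L \<longleftrightarrow> F \<in> L" "Forall F \<in> L \<longleftrightarrow> F \<in> L"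
    "Conj \<Phi> \<in> L \<Longrightarrow> rcset \<Phi> \<subseteq> L" "Disj \<Phi> \<in> L \<Longrightarrow> rcset \<Phi> \<subseteq> L"
    "finite (rcset \<Phi>) \<Longrightarrow> rcset \<Phi> \<subseteq> L \<Longrightarrow> Conj \<Phi> \<in> L"
    "finite (rcset \<Phi>) \<Longrightarrow> rcset \<Phi> \<subseteq> L \<Longrightarrow> Disj \<Phi> \<in> L"
    "F \<in> L \<Longrightarrow> (\<And>i. wf_trm V (\<sigma> i)) \<Longrightarrow> subst F \<sigma> \<in> L"
proof -
  note a = assms[unfolded fragment_def]
  show "countable L" by (rule a[THEN conjunct1])
  show "L \<subseteq> formulas V" by (rule a[THEN conjunct2, THEN conjunct1])
  show "wf_trm V s \<Longrightarrow> wf_trm V t \<Longrightarrow> Equal s t \<in> L"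
    using a[THEN conjunct2, THEN conjunct2, THEN conjunct1] by blast
  show "rel_ar V r = Some (length ts) \<Longrightarrow> list_all (wf_trm V) ts \<Longrightarrow> Atom r ts \<in> L"
    using a[THEN conjunct2, THEN conjunct2, THEN conjunct2, THEN conjunct1] by blast
  show "Neg F \<in> L \<longleftrightarrow> F \<in> L" by (rule spec[OF a[THEN conjunct2, THEN conjunct2, THEN conjunct2, THEN conjunct2, THEN conjunct1]])
  show "Exi F \<in> L \<longleftrightarrow> F \<in> L" by (rule spec[OF a[THEN conjunct2, THEN conjunct2, THEN conjunct2, THEN conjunct2, THEN conjunct2, THEN conjunct1]])
  show "Forall F \<in> L \<longleftrightarrow> F \<in> L" by (rule spec[OF a[THEN conjunct2, THEN conjunct2, THEN conjunct2, THEN conjunct2, THEN conjunct2, THEN conjunct2, THEN conjunct1]])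
  show "Conj \<Phi> \<in> L \<Longrightarrow> rcset \<Phi> \<subseteq> L" using a[THEN conjunct2, THEN conjunct2, THEN conjunct2, THEN conjunct2, THEN conjunct2, THEN conjunct2, THEN conjunct2, THEN conjunct1] by blast
  show "Disj \<Phi> \<in> L \<Longrightarrow> rcset \<Phi> \<subseteq> L" using a[THEN conjunct2, THEN conjunct2, THEN conjunct2, THEN conjunct2, THEN conjunct2, THEN conjunct2, THEN conjunct2, THEN conjunct2, THEN conjunct1] by blast
  show "finite (rcset \<Phi>) \<Longrightarrow> rcset \<Phi> \<subseteq> L \<Longrightarrow> Conj \<Phi> \<in> L"
    using a[THEN conjunct2, THEN conjunct2, THEN conjunct2, THEN conjunct2, THEN conjunct2, THEN conjunct2, THEN conjunct2, THEN conjunct2, THEN conjunct2, THEN conjunct1] by blast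
  show "finite (rcset \<Phi>) \<Longrightarrow> rcset \<Phi> \<subseteq> L \<Longrightarrow> Disj \<Phi> \<in> L"
    using a[THEN conjunct2, THEN conjunct2, THEN conjunct2, THEN conjunct2, THEN conjunct2, THEN conjunct2, THEN conjunct2, THEN conjunct2, THEN conjunct2, THEN conjunct1] by blast
  show "F \<in> L \<Longrightarrow> (\<And>i. wf_trm V (\<sigma> i)) \<Longrightarrow> subst F \<sigma> \<in> L"
    using a[THEN conjunct2, THEN conjunct2, THEN conjunct2, THEN conjunct2, THEN conjunct2, THEN conjunct2, THEN conjunct2, THEN conjunct2, THEN conjunct2, THEN conjunct2] by blast
qed

lemma fragment_Exi_pow: "fragment V L \<Longrightarrow> (Exi ^^ k) F \<in> L \<longleftrightarrow> F \<in> L"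
  by (induction k) (simp_all add: fragment_dest)

lemma fragment_subfmls: "fragment V L \<Longrightarrow> F \<in> L \<Longrightarrow> subfmls F \<subseteq> L"
proof (induction F)
  case (Conj \<Phi>)
  then show ?case
    using fragment_dest(8)[OF Conj.prems] by auto
next
  case (Disj \<Phi>)
  then show ?case
    using fragment_dest(9)[OF Disj.prems] by auto
qed (simp_all add: fragment_dest)

lemma fragment_finitary:
  assumes "fragment V L"
  shows "wf_symbols V F \<Longrightarrow> finitary F \<Longrightarrow> quantifier_free F \<Longrightarrow> F \<in> L"
proof (induction F)
  case (Conj \<Phi>)
  then show ?case
    by (intro fragment_dest(10)[OF assms]) auto
next
  case (Disj \<Phi>)
  then show ?case
    by (intro fragment_dest(11)[OF assms]) auto
qed (simp_all add: fragment_dest[OF assms])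

lemma gen_fragment_superset: "X \<subseteq> gen_fragment V X"
  unfolding gen_fragment_def by blast

lemma gen_fragment_least: "fragment V L \<Longrightarrow> X \<subseteq> L \<Longrightarrow> gen_fragment V X \<subseteq> L"
  unfolding gen_fragment_def by blast

text \<open>The generated set is an intersection, so some fragment containing X must be given: an
  empty intersection would consist of everything.\<close>

lemma fragment_gen_fragment:
  assumes "fragment V L" "X \<subseteq> L"
  shows "fragment V (gen_fragment V X)"
proof -
  let ?G = "gen_fragment V X"
  have mem: "F \<in> ?G \<longleftrightarrow> (\<forall>L. fragment V L \<longrightarrow> X \<subseteq> L \<longrightarrow> F \<in> L)" for F
    unfolding gen_fragment_def by blast
  have sub: "?G \<subseteq> L"
    by (rule gen_fragment_least[OF assms])
  show ?thesis
    unfolding fragment_def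
  proof (intro conjI allI impI)
    show "countable ?G" "?G \<subseteq> formulas V"
      using sub fragment_dest(1,2)[OF assms(1)] countable_subset by blast+
    show "Equal s t \<in> ?G" if "wf_trm V s \<and> wf_trm V t" for s t
      unfolding mem using that by (simp add: fragment_dest(3))
    show "Atom r ts \<in> ?G" if "rel_ar V r = Some (length ts) \<and> list_all (wf_trm V) ts" for r ts
      unfolding mem using that by (simp add: fragment_dest(4))
    show "Neg F \<in> ?G \<longleftrightarrow> F \<in> ?G" "Exi F \<in> ?G \<longleftrightarrow> F \<in> ?G" "Forall F \<in> ?G \<longleftrightarrow> F \<in> ?G" for F
      unfolding mem by (simp_all add: fragment_dest(5-7))
    show "rcset \<Phi> \<subseteq> ?G" if "Conj \<Phi> \<in> ?G" for \<Phi>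
    proof -
      have "rcset \<Phi> \<subseteq> L" if L: "fragment V L" "X \<subseteq> L" for L
        by (rule fragment_dest(8)[OF L(1)]) (use gen_fragment_least[OF L] \<open>Conj \<Phi> \<in> ?G\<close> in blast)
      then show ?thesis
        unfolding gen_fragment_def by blast
    qed
    show "rcset \<Phi> \<subseteq> ?G" if "Disj \<Phi> \<in> ?G" for \<Phi>
    proof -
      have "rcset \<Phi> \<subseteq> L" if L: "fragment V L" "X \<subseteq> L" for L
        by (rule fragment_dest(9)[OF L(1)]) (use gen_fragment_least[OF L] \<open>Disj \<Phi> \<in> ?G\<close> in blast)
      then show ?thesis
        unfolding gen_fragment_def by blast
    qed
    show "Conj \<Phi> \<in> ?G" "Disj \<Phi> \<in> ?G" if "finite (rcset \<Phi>) \<and> rcset \<Phi> \<subseteq> ?G" for \<Phi>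
    proof -
      have "rcset \<Phi> \<subseteq> L" if L: "fragment V L" "X \<subseteq> L" for L
        using gen_fragment_least[OF L] \<open>finite (rcset \<Phi>) \<and> rcset \<Phi> \<subseteq> ?G\<close> by blast
      then show "Conj \<Phi> \<in> ?G" "Disj \<Phi> \<in> ?G"
        unfolding mem using that by (simp_all add: fragment_dest(10,11))
    qed
    show "subst F \<sigma> \<in> ?G" if "F \<in> ?G \<and> (\<forall>i. wf_trm V (\<sigma> i))" for F \<sigma>
      using that unfolding mem by (simp add: fragment_dest(12))
  qed
qed

text \<open>The new substitution is \<sigma> lifted once for each quantifier passed on the way
  down.\<close>

lemma subfmls_subst:
  "G \<in> subfmls (subst F \<sigma>) \<Longrightarrow> (\<And>i. wf_trm V (\<sigma> i)) \<Longrightarrow>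
    \<exists>H\<in>subfmls F. \<exists>\<tau>. (\<forall>i. wf_trm V (\<tau> i)) \<and> G = subst H \<tau>"
proof (induction F arbitrary: \<sigma>)
  case (Neg F)
  then show ?case by (auto; metis subst.simps(3))
next
  case (Conj \<Phi>)
  show ?case
  proof (cases "G = subst (Conj \<Phi>) \<sigma>")
    case False
    then obtain F where "F \<in> rcset \<Phi>" "G \<in> subfmls (subst F \<sigma>)"
      using Conj.prems(1) by auto
    then show ?thesis
      using Conj.IH[OF _ _ Conj.prems(2)] by fastforce
  qed (use Conj.prems(2) in auto)
next
  case (Disj \<Phi>)
  show ?case
  proof (cases "G = subst (Disj \<Phi>) \<sigma>")
    case False
    then obtain F where "F \<in> rcset \<Phi>" "G \<in> subfmls (subst F \<sigma>)"
      using Disj.prems(1) by auto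
    then show ?thesis
      using Disj.IH[OF _ _ Disj.prems(2)] by fastforce
  qed (use Disj.prems(2) in auto)
next
  case (Exi F)
  show ?case
  proof (cases "G = subst (Exi F) \<sigma>")
    case False
    then show ?thesis
      using Exi.IH[of "lift_subst \<sigma>"] Exi.prems wf_lift_subst[of V \<sigma>] by auto
  qed (use Exi.prems(2) in auto)
next
  case (Forall F)
  show ?case
  proof (cases "G = subst (Forall F) \<sigma>")
    case False
    then show ?thesis
      using Forall.IH[of "lift_subst \<sigma>"] Forall.prems wf_lift_subst[of V \<sigma>] by auto
  qed (use Forall.prems(2) in auto)
qed (use subst.simps in fastforce)+

text \<open>A fragment is closed downwards, so an induction over a generated fragment must
  carry the property for all subformulas.\<close>

lemma gen_fragment_subfmls_induct:
  assumes L: "fragment V L" "X \<subseteq> L"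
    and X: "\<And>F G. F \<in> X \<Longrightarrow> G \<in> subfmls F \<Longrightarrow> Q G"
    and qf: "\<And>F. F \<in> formulas V \<Longrightarrow> finitary F \<Longrightarrow> quantifier_free F \<Longrightarrow> Q F"
    and Neg: "\<And>F. F \<in> formulas V \<Longrightarrow> Q F \<Longrightarrow> Q (Neg F)"
    and Exi: "\<And>F. Exi F \<in> formulas V \<Longrightarrow> Q F \<Longrightarrow> Q (Exi F)"
    and Forall: "\<And>F. Forall F \<in> formulas V \<Longrightarrow> Q F \<Longrightarrow> Q (Forall F)"
    and Conj: "\<And>\<Phi>. Conj \<Phi> \<in> formulas V \<Longrightarrow> finite (rcset \<Phi>) \<Longrightarrow> \<forall>F\<in>rcset \<Phi>. Q F \<Longrightarrow> Q (Conj \<Phi>)"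
    and Disj: "\<And>\<Phi>. Disj \<Phi> \<in> formulas V \<Longrightarrow> finite (rcset \<Phi>) \<Longrightarrow> \<forall>F\<in>rcset \<Phi>. Q F \<Longrightarrow> Q (Disj \<Phi>)"
    and subst: "\<And>F \<sigma>. F \<in> formulas V \<Longrightarrow> (\<And>i. wf_trm V (\<sigma> i)) \<Longrightarrow> Q F \<Longrightarrow> Q (subst F \<sigma>)"
    and F: "F \<in> gen_fragment V X" "G \<in> subfmls F"
  shows "Q G"
proof -
  \<comment> \<open>Minimality of the generated fragment is applied to the part of L that has Q
    hereditarily. Being closed under subformulas, it also satisfies the downward clauses of a
    fragment.\<close>
  define L' where "L' = {F \<in> L. \<forall>G\<in>subfmls F. Q G}"
  note d = fragment_dest[OF L(1)]
  have "fragment V L'"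
    unfolding fragment_def
  proof (intro conjI allI impI)
    show "countable L'"
      using d(1) by (rule countable_subset[rotated]) (auto simp: L'_def)
    show "L' \<subseteq> formulas V"
      using d(2) by (auto simp: L'_def)
    show "Equal s t \<in> L'" if "wf_trm V s \<and> wf_trm V t" for s t
      using that d(3) qf by (auto simp: L'_def formulas_def finite_fv_trm)
    show "Atom r ts \<in> L'" if "rel_ar V r = Some (length ts) \<and> list_all (wf_trm V) ts" for r ts
      using that d(4) qf by (auto simp: L'_def formulas_def finite_fv_trm)
    show "Neg F \<in> L' \<longleftrightarrow> F \<in> L'" for F
    proof -
      have "F \<in> formulas V \<and> Neg F \<in> formulas V" if "F \<in> L"
        using that d(2,5) by blast
      then show ?thesis
        using Neg[of F] by (auto simp: L'_def d(5))
    qed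
    show "Exi F \<in> L' \<longleftrightarrow> F \<in> L'" for F
    proof -
      have "F \<in> formulas V \<and> Exi F \<in> formulas V" if "F \<in> L"
        using that d(2,6) by blast
      then show ?thesis
        using Exi[of F] by (auto simp: L'_def d(6))
    qed
    show "Forall F \<in> L' \<longleftrightarrow> F \<in> L'" for F
    proof -
      have "F \<in> formulas V \<and> Forall F \<in> formulas V" if "F \<in> L"
        using that d(2,7) by blast
      then show ?thesis
        using Forall[of F] by (auto simp: L'_def d(7))
    qed
    show "rcset \<Phi> \<subseteq> L'" if "Conj \<Phi> \<in> L'" for \<Phi>
      using that d(8) by (auto simp: L'_def)
    show "rcset \<Phi> \<subseteq> L'" if "Disj \<Phi> \<in> L'" for \<Phi>
      using that d(9) by (auto simp: L'_def)
    show "Conj \<Phi> \<in> L'" if "finite (rcset \<Phi>) \<and> rcset \<Phi> \<subseteq> L'" for \<Phi>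
    proof -
      have "Conj \<Phi> \<in> L" "\<forall>F\<in>rcset \<Phi>. Q F"
        using that d(10) by (auto simp: L'_def subset_iff)
      then show ?thesis
        using that Conj d(2) by (auto simp: L'_def)
    qed
    show "Disj \<Phi> \<in> L'" if "finite (rcset \<Phi>) \<and> rcset \<Phi> \<subseteq> L'" for \<Phi>
    proof -
      have "Disj \<Phi> \<in> L" "\<forall>F\<in>rcset \<Phi>. Q F"
        using that d(11) by (auto simp: L'_def subset_iff)
      then show ?thesis
        using that Disj d(2) by (auto simp: L'_def)
    qed
    show "subst F \<sigma> \<in> L'" if "F \<in> L' \<and> (\<forall>i. wf_trm V (\<sigma> i))" for F \<sigma>
    proof -
      have "Q G" if G: "G \<in> subfmls (subst F \<sigma>)" for G
      proof -
        obtain H \<tau> where H: "H \<in> subfmls F" "\<And>i. wf_trm V (\<tau> i)" "G = subst H \<tau>"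
          using subfmls_subst[OF G, of V] \<open>F \<in> L' \<and> _\<close> by blast
        moreover have "H \<in> formulas V"
          using H(1) fragment_subfmls[OF L(1), of F] d(2) \<open>F \<in> L' \<and> _\<close> by (auto simp: L'_def)
        ultimately show ?thesis
          using subst[of H \<tau>] \<open>F \<in> L' \<and> _\<close> by (auto simp: L'_def)
      qed
      then show ?thesis
        using that d(12) by (auto simp: L'_def)
    qed
  qed
  moreover have "X \<subseteq> L'"
    using L(2) X by (auto simp: L'_def)
  ultimately have "gen_fragment V X \<subseteq> L'"
    by (rule gen_fragment_least)
  then show ?thesis
    using F by (auto simp: L'_def)
qed

section \<open>Back and forth\<close>

text \<open>Elements are prepended, so positions in the lists act as de Bruijn indices, and the last
  three assumptions say that the paired tuples agree on atomic formulas.\<close>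

lemma back_and_forth:
  assumes M: "M \<in> structures V"
    and I0: "([], []) \<in> I"
    and I: "\<And>as bs. (as, bs) \<in> I \<Longrightarrow> length as = length bs \<and> set as \<subseteq> univ M \<and> set bs \<subseteq> univ N"
    and forth: "\<And>as bs a. (as, bs) \<in> I \<Longrightarrow> a \<in> univ M \<Longrightarrow> \<exists>b\<in>univ N. (a # as, b # bs) \<in> I"
    and backwards: "\<And>as bs b. (as, bs) \<in> I \<Longrightarrow> b \<in> univ N \<Longrightarrow> \<exists>a\<in>univ M. (a # as, b # bs) \<in> I"
    and eq: "\<And>as bs i j. (as, bs) \<in> I \<Longrightarrow> i < length as \<Longrightarrow> j < length as \<Longrightarrow>
      as ! i = as ! j \<longleftrightarrow> bs ! i = bs ! j"
    and fn: "\<And>as bs f ks j. (as, bs) \<in> I \<Longrightarrow> fun_ar V f = Some (length ks) \<Longrightarrow>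
      set ks \<subseteq> {..<length as} \<Longrightarrow> j < length as \<Longrightarrow>
      fun_val M f (map ((!) as) ks) = as ! j \<longleftrightarrow> fun_val N f (map ((!) bs) ks) = bs ! j"
    and rl: "\<And>as bs r ks. (as, bs) \<in> I \<Longrightarrow> rel_ar V r = Some (length ks) \<Longrightarrow>
      set ks \<subseteq> {..<length as} \<Longrightarrow>
      rel_val M r (map ((!) as) ks) \<longleftrightarrow> rel_val N r (map ((!) bs) ks)"
  shows "isomorphic V M N"
proof -
  \<comment> \<open>Stage k takes care of the number k on both sides: the universes consist of
    numbers, so the stages themselves enumerate them. Only the set of pairs is required to grow,
    because positions move when elements are prepended.\<close>
  define step where "step k x y \<longleftrightarrow> set (zip (fst x) (snd x)) \<subseteq> set (zip (fst y) (snd y)) \<and>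
    (k \<in> univ M \<longrightarrow> k \<in> set (fst y)) \<and> (k \<in> univ N \<longrightarrow> k \<in> set (snd y))"
    for k :: nat and x y :: "nat list \<times> nat list"
  have "\<exists>y. y \<in> I \<and> step k x y" if x: "x \<in> I" for x k
  proof -
    obtain as bs where ab: "x = (as, bs)" "(as, bs) \<in> I"
      using x by (cases x) auto
    have "\<exists>as' bs'. (as', bs') \<in> I \<and> set (zip as bs) \<subseteq> set (zip as' bs') \<and> (k \<in> univ M \<longrightarrow> k \<in> set as')"
    proof (cases "k \<in> univ M")
      case True
      then obtain b where "(k # as, b # bs) \<in> I"
        using forth[OF ab(2)] by blast
      then show ?thesis
        by (intro exI[of _ "k # as"] exI[of _ "b # bs"]) auto
    qed (use ab in auto)
    then obtain as' bs' where ab': "(as', bs') \<in> I" "set (zip as bs) \<subseteq> set (zip as' bs')"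
      "k \<in> univ M \<longrightarrow> k \<in> set as'"
      by blast
    have "\<exists>as'' bs''. (as'', bs'') \<in> I \<and> set (zip as' bs') \<subseteq> set (zip as'' bs'') \<and>
      set as' \<subseteq> set as'' \<and> (k \<in> univ N \<longrightarrow> k \<in> set bs'')"
    proof (cases "k \<in> univ N")
      case True
      then obtain a where "(a # as', k # bs') \<in> I"
        using backwards[OF ab'(1)] by blast
      then show ?thesis
        by (intro exI[of _ "a # as'"] exI[of _ "k # bs'"]) auto
    qed (use ab' in auto)
    then obtain as'' bs'' where "(as'', bs'') \<in> I" "set (zip as' bs') \<subseteq> set (zip as'' bs'')"
      "set as' \<subseteq> set as''" "k \<in> univ N \<longrightarrow> k \<in> set bs''"
      by blast
    then show ?thesis
      using ab ab' by (intro exI[of _ "(as'', bs'')"]) (auto simp: step_def)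
  qed
  then obtain c where c: "\<And>k. c k \<in> I" "\<And>k. step k (c k) (c (Suc k))"
    using dependent_nat_choice[of "\<lambda>k x. x \<in> I" step] I0 by blast
  define Z where "Z k = set (zip (fst (c k)) (snd (c k)))" for k
  have Z_mono: "Z i \<subseteq> Z j" if "i \<le> j" for i j
    using that by (rule lift_Suc_mono_le[rotated]) (use c(2) in \<open>auto simp: Z_def step_def\<close>)
  define R where "R = (\<Union>k. Z k)"
  have R_finite: "\<exists>k. set ps \<subseteq> Z k" if "set ps \<subseteq> R" for ps
    using that
  proof (induction ps)
    case (Cons p ps)
    then obtain k j where "set ps \<subseteq> Z k" "p \<in> Z j"
      by (auto simp: R_def)
    then have "set (p # ps) \<subseteq> Z (max k j)"
      using Z_mono[of k "max k j"] Z_mono[of j "max k j"] by auto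
    then show ?case by blast
  qed simp
  have Z_nth: "\<exists>i<length (fst (c k)). fst (c k) ! i = x \<and> snd (c k) ! i = y" if "(x, y) \<in> Z k" for x y k
    using that by (auto simp: Z_def set_zip)
  have len: "length (fst (c k)) = length (snd (c k))" and sub: "set (fst (c k)) \<subseteq> univ M" "set (snd (c k)) \<subseteq> univ N" for k
    using I[of "fst (c k)" "snd (c k)"] c(1)[of k] by auto
  have Z_I: "(fst (c k) ! i, snd (c k) ! i) \<in> Z k" if "i < length (fst (c k))" for i k
    unfolding Z_def set_zip using that len[of k] by auto
  have R_univ: "x \<in> univ M" "y \<in> univ N" if xy: "(x, y) \<in> R" for x y
  proof -
    obtain k where "(x, y) \<in> set (zip (fst (c k)) (snd (c k)))"
      using xy by (auto simp: R_def Z_def)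
    then have "x \<in> set (fst (c k))" "y \<in> set (snd (c k))"
      by (rule set_zip_leftD, rule set_zip_rightD)
    then show "x \<in> univ M" "y \<in> univ N"
      using sub[of k] by blast+
  qed
  have R_eq: "x = x' \<longleftrightarrow> y = y'" if xy: "(x, y) \<in> R" "(x', y') \<in> R" for x y x' y'
  proof -
    obtain k where k: "(x, y) \<in> Z k" "(x', y') \<in> Z k"
      using R_finite[of "[(x, y), (x', y')]"] xy by auto
    obtain i j where "i < length (fst (c k))" "fst (c k) ! i = x" "snd (c k) ! i = y"
      "j < length (fst (c k))" "fst (c k) ! j = x'" "snd (c k) ! j = y'"
      using Z_nth[OF k(1)] Z_nth[OF k(2)] by blast
    then show ?thesis
      using eq[of "fst (c k)" "snd (c k)" i j] c(1)[of k] by auto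
  qed
  have total: "\<exists>y. (x, y) \<in> R" if "x \<in> univ M" for x
  proof -
    have "x \<in> set (fst (c (Suc x)))"
      using c(2)[of x] that by (simp add: step_def)
    then obtain i where "i < length (fst (c (Suc x)))" "fst (c (Suc x)) ! i = x"
      by (auto simp: in_set_conv_nth)
    then have "(x, snd (c (Suc x)) ! i) \<in> Z (Suc x)"
      using Z_I[of i "Suc x"] by simp
    then show ?thesis unfolding R_def by blast
  qed
  have onto: "\<exists>x. (x, y) \<in> R" if "y \<in> univ N" for y
  proof -
    have "y \<in> set (snd (c (Suc y)))"
      using c(2)[of y] that by (simp add: step_def)
    then obtain i where "i < length (snd (c (Suc y)))" "snd (c (Suc y)) ! i = y"
      by (auto simp: in_set_conv_nth)
    then have "(fst (c (Suc y)) ! i, y) \<in> Z (Suc y)"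
      using Z_I[of i "Suc y"] len[of "Suc y"] by simp
    then show ?thesis unfolding R_def by blast
  qed
  define h where "h x = (SOME y. (x, y) \<in> R)" for x
  have h: "(x, h x) \<in> R" if "x \<in> univ M" for x
    unfolding h_def using total[OF that] by (rule someI_ex)
  have bij: "bij_betw h (univ M) (univ N)"
    unfolding bij_betw_def
  proof
    show "inj_on h (univ M)"
      by (rule inj_onI) (use R_eq[OF h h] in blast)
    show "h ` univ M = univ N"
    proof
      show "h ` univ M \<subseteq> univ N"
        using h R_univ by blast
      show "univ N \<subseteq> h ` univ M"
      proof
        fix y
        assume "y \<in> univ N"
        then obtain x where x: "(x, y) \<in> R"
          using onto by blast
        then have "h x = y"
          using R_eq[OF x h[OF R_univ(1)[OF x]]] by simp
        then show "y \<in> h ` univ M"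
          using R_univ(1)[OF x] by blast
      qed
    qed
  qed
  have index: "\<exists>k ks. map ((!) (fst (c k))) ks = xs \<and> map ((!) (snd (c k))) ks = map h xs \<and>
      set ks \<subseteq> {..<length (fst (c k))}" if "set xs \<subseteq> univ M" for xs
  proof -
    have "set (map (\<lambda>x. (x, h x)) xs) \<subseteq> R"
      using that h by auto
    then obtain k where "set (map (\<lambda>x. (x, h x)) xs) \<subseteq> Z k"
      using R_finite by blast
    then have "\<forall>x\<in>set xs. \<exists>i<length (fst (c k)). fst (c k) ! i = x \<and> snd (c k) ! i = h x"
      using Z_nth by (auto simp: subset_iff)
    then obtain idx where "\<forall>x\<in>set xs. idx x < length (fst (c k)) \<and> fst (c k) ! idx x = x \<and> snd (c k) ! idx x = h x"
      by metis
    then show ?thesis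
      by (intro exI[of _ k] exI[of _ "map idx xs"]) (auto simp: map_idI)
  qed
  have "h (fun_val M f as) = fun_val N f (map h as)"
    if f: "fun_ar V f = Some (length as)" "set as \<subseteq> univ M" for f as
  proof -
    let ?z = "fun_val M f as"
    have "?z \<in> univ M"
      using M f unfolding structures_def by blast
    \<comment> \<open>The value of the function is listed too, because the assumption on functions
      compares values with listed elements.\<close>
    then have "set (?z # as) \<subseteq> univ M"
      using f(2) by simp
    from index[OF this] obtain k js where js: "map ((!) (fst (c k))) js = ?z # as"
      "map ((!) (snd (c k))) js = map h (?z # as)" "set js \<subseteq> {..<length (fst (c k))}"
      by (elim exE conjE) (rule that)
    then obtain j ks where is_eq: "js = j # ks"
      by (cases js) auto
    have "length ks = length as"
      using js(1) unfolding is_eq by (metis length_map list.inject list.simps(9))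
    then show ?thesis
      using fn[of "fst (c k)" "snd (c k)" f ks j] c(1)[of k] js f unfolding is_eq by auto
  qed
  moreover have "rel_val M r as = rel_val N r (map h as)"
    if r: "rel_ar V r = Some (length as)" "set as \<subseteq> univ M" for r as
  proof -
    from index[OF r(2)] obtain k ks where is_eq: "map ((!) (fst (c k))) ks = as"
      "map ((!) (snd (c k))) ks = map h as" "set ks \<subseteq> {..<length (fst (c k))}"
      by (elim exE conjE) (rule that)
    have "length ks = length as"
      using is_eq(1) by (metis length_map)
    then show ?thesis
      using rl[of "fst (c k)" "snd (c k)" r ks] c(1)[of k] is_eq r by auto
  qed
  ultimately show ?thesis
    unfolding isomorphic_def using bij by blast
qed

section \<open>Types over a complete theory\<close>

locale complete_theory =
  fixes V :: vocab and L S :: "fml set"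
  assumes frag: "fragment V L"
    and sentences: "F \<in> S \<Longrightarrow> F \<in> L \<and> fv F = {}"
    and complete: "F \<in> L \<Longrightarrow> fv F = {} \<Longrightarrow> F \<in> S \<or> Neg F \<in> S"
begin

definition is_model :: "struct \<Rightarrow> bool" where
  "is_model M \<longleftrightarrow> M \<in> structures V \<and> (\<forall>F\<in>S. M \<Turnstile> F)"

lemma is_model_sat: "is_model M \<Longrightarrow> e \<in> envs M \<Longrightarrow> F \<in> S \<Longrightarrow> sat M F e"
  unfolding is_model_def holds_def by blast

lemma ctype_Neg: "F \<in> L \<Longrightarrow> fv F \<subseteq> {..<n} \<Longrightarrow> F \<notin> ctype L M n e \<Longrightarrow> Neg F \<in> ctype L M n e"
  by (simp add: ctype_def fragment_dest(5)[OF frag])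

text \<open>The type of a tuple decides every formula of the fragment in its variables, so inclusion
  already forces equality.\<close>

lemma ctype_eqI:
  assumes "ctype L M n e \<subseteq> ctype L N n e'"
  shows "ctype L M n e = ctype L N n e'"
proof (rule antisym[OF assms], rule subsetI, rule ccontr)
  fix F
  assume F: "F \<in> ctype L N n e'" "F \<notin> ctype L M n e"
  then have "Neg F \<in> ctype L M n e"
    using ctype_Neg[of F n M e] by (simp add: ctype_def)
  then have "Neg F \<in> ctype L N n e'"
    using assms by blast
  then show False
    using F(1) by (simp add: ctype_def)
qed

lemma ctype_zero:
  assumes "is_model M" "is_model N" "e \<in> envs M" "e' \<in> envs N"
  shows "ctype L M 0 e = ctype L N 0 e'"
proof (rule ctype_eqI, rule subsetI)
  fix F
  assume F: "F \<in> ctype L M 0 e"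
  then have "F \<in> L" "fv F = {}"
    by (auto simp: ctype_def)
  then have "F \<in> S"
    using complete is_model_sat[OF assms(1,3), of "Neg F"] F by (auto simp: ctype_def)
  then show "F \<in> ctype L N 0 e'"
    using is_model_sat[OF assms(2,4)] F by (simp add: ctype_def)
qed

lemma consistent_ctype:
  assumes "is_model M" "e \<in> envs M"
  shows "fin_consistent V (S \<union> ctype L M n e)"
  using assms is_model_sat[OF assms]
  by (intro fin_consistentI[of M V e]) (auto simp: is_model_def ctype_def)

text \<open>Soundness in M gives consistency, and a proper extension would contain some formula
  together with its negation.\<close>

lemma ntype_ctype:
  assumes "is_model M" "e \<in> envs M"
  shows "ntype V L S n (ctype L M n e)"
  unfolding ntype_def
proof (intro conjI allI impI)
  show "ctype L M n e \<subseteq> {F \<in> L. fv F \<subseteq> {..<n}}"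
    by (auto simp: ctype_def)
  show "fin_consistent V (S \<union> ctype L M n e)"
    by (rule consistent_ctype[OF assms])
  fix q
  assume q: "ctype L M n e \<subseteq> q \<and> q \<subseteq> {F \<in> L. fv F \<subseteq> {..<n}} \<and> fin_consistent V (S \<union> q)"
  have "F \<in> ctype L M n e" if "F \<in> q" for F
  proof (rule ccontr)
    assume "F \<notin> ctype L M n e"
    then have "Neg F \<in> q"
      using ctype_Neg[of F n M e] q that by blast
    then have "derivable V (S \<union> q) F" "derivable V (S \<union> q) (Neg F)"
      unfolding derivable_def using that by (auto intro: prov.assm)
    then show False
      using q unfolding fin_consistent_def by blast
  qed
  then show "q = ctype L M n e"
    using q by blast
qed

lemma ntype_realized:
  assumes "is_model M" "e \<in> envs M" "ntype V L S n p" "\<forall>F\<in>p. sat M F e"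
  shows "p = ctype L M n e"
proof -
  have "p \<subseteq> ctype L M n e"
    using assms(3,4) unfolding ntype_def ctype_def by blast
  moreover have "ctype L M n e \<subseteq> {F \<in> L. fv F \<subseteq> {..<n}}"
    by (auto simp: ctype_def)
  moreover have "\<forall>q. p \<subseteq> q \<and> q \<subseteq> {F \<in> L. fv F \<subseteq> {..<n}} \<and> fin_consistent V (S \<union> q) \<longrightarrow> q = p"
    using assms(3) unfolding ntype_def by (elim conjE)
  ultimately have "ctype L M n e = p"
    using consistent_ctype[OF assms(1,2)] by simp
  then show ?thesis by (rule sym)
qed

text \<open>Through soundness, a generator carries its type to every tuple satisfying it in any
  model of the theory.\<close>

lemma generator_ctype:
  assumes "\<forall>G\<in>ctype L M n e. derivable V (insert F S) G" "is_model N" "e' \<in> envs N" "sat N F e'"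
  shows "ctype L M n e = ctype L N n e'"
proof (rule ctype_eqI, rule subsetI)
  fix G
  assume G: "G \<in> ctype L M n e"
  then have "derivable V (insert F S) G"
    using assms(1) by blast
  then have "sat N G e'"
    using assms(2-4) is_model_sat[OF assms(2,3)]
    by (intro derivable_sound[of V "insert F S"]) (auto simp: is_model_def)
  then show "G \<in> ctype L N n e'"
    using G by (simp add: ctype_def)
qed

lemma principal_generator:
  assumes "principal V S (ctype L M n e)"
  obtains F where "F \<in> ctype L M n e" "\<forall>G\<in>ctype L M n e. derivable V (insert F S) G"
  using assms unfolding principal_def by blast

text \<open>The forth step: for a generator F of the type of the longer tuple, \<open>Exi F\<close>
  belongs to the type of the shorter one, so N has a witness, and that witness realizes the whole
  type. Atomicity is used on the side from which the element comes.\<close>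

lemma atomic_extend:
  assumes A: "atomic_model V L S M" and N: "is_model N" and e: "e \<in> envs M" "e' \<in> envs N"
    and same: "ctype L M n e = ctype L N n e'" and a: "a \<in> univ M"
  shows "\<exists>b\<in>univ N. ctype L M (Suc n) (case_nat a e) = ctype L N (Suc n) (case_nat b e')"
proof -
  have "principal V S (ctype L M (Suc n) (case_nat a e))"
    using A case_nat_in_envs[OF a e(1)] unfolding atomic_model_def by blast
  then obtain F where F: "F \<in> ctype L M (Suc n) (case_nat a e)"
    "\<forall>G\<in>ctype L M (Suc n) (case_nat a e). derivable V (insert F S) G"
    by (rule principal_generator)
  have "Exi F \<in> ctype L M n e"
    using F(1) a fragment_dest(6)[OF frag] by (auto simp: ctype_def)
  then obtain b where b: "b \<in> univ N" "sat N F (case_nat b e')"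
    unfolding same by (auto simp: ctype_def)
  show ?thesis
    using generator_ctype[OF F(2) N case_nat_in_envs[OF b(1) e(2)] b(2)] b(1) by blast
qed

lemma atomic_is_model: "atomic_model V L S M \<Longrightarrow> is_model M"
  unfolding atomic_model_def is_model_def by blast

lemma ctype_sat_iff:
  "ctype L M n e = ctype L N n e' \<Longrightarrow> F \<in> L \<Longrightarrow> fv F \<subseteq> {..<n} \<Longrightarrow> sat M F e \<longleftrightarrow> sat N F e'"
  unfolding ctype_def by blast

theorem atomic_models_isomorphic:
  assumes M: "atomic_model V L S M" and N: "atomic_model V L S N"
  shows "isomorphic V M N"
proof -
  have Ms: "M \<in> structures V" and Ns: "N \<in> structures V"
    using M N by (auto simp: atomic_model_def)
  obtain d d' where d: "d \<in> univ M" "d' \<in> univ N"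
    using Ms Ns by (auto simp: structures_def)
  \<comment> \<open>Lists are read as environments. The default d fills the indices beyond the list,
    which formulas in the first \<open>length as\<close> variables do not mention.\<close>
  define le :: "nat \<Rightarrow> nat list \<Rightarrow> nat \<Rightarrow> nat" where "le d as i = (if i < length as then as ! i else d)" for d as i
  have le_Cons: "le d (a # as) = case_nat a (le d as)" for d a as
    by (auto simp: le_def split: nat.split)
  have le_envs: "le d as \<in> envs M" if "set as \<subseteq> univ M" "d \<in> univ M" for d as and M :: struct
    using that nth_mem by (fastforce simp: envs_def le_def)
  define I where "I = {(as, bs). length as = length bs \<and> set as \<subseteq> univ M \<and> set bs \<subseteq> univ N \<and>
    ctype L M (length as) (le d as) = ctype L N (length as) (le d' bs)}"
  show ?thesis
  proof (rule back_and_forth[OF Ms, of I])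
    show "([], []) \<in> I"
      using ctype_zero[OF atomic_is_model[OF M] atomic_is_model[OF N] le_envs le_envs] d
      by (simp add: I_def)
  next
    fix as bs
    assume "(as, bs) \<in> I"
    then show "length as = length bs \<and> set as \<subseteq> univ M \<and> set bs \<subseteq> univ N"
      by (simp add: I_def)
  next
    fix as bs a
    assume I: "(as, bs) \<in> I" and a: "a \<in> univ M"
    then obtain b where "b \<in> univ N"
      "ctype L M (Suc (length as)) (case_nat a (le d as)) = ctype L N (Suc (length as)) (case_nat b (le d' bs))"
      using atomic_extend[OF M atomic_is_model[OF N] le_envs[OF _ d(1)] le_envs[OF _ d(2)], of as bs "length as" a]
      by (auto simp: I_def)
    then show "\<exists>b\<in>univ N. (a # as, b # bs) \<in> I"
      using I a by (auto simp: I_def le_Cons)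
  next
    fix as bs b
    assume I: "(as, bs) \<in> I" and b: "b \<in> univ N"
    then obtain a where "a \<in> univ M"
      "ctype L N (Suc (length as)) (case_nat b (le d' bs)) = ctype L M (Suc (length as)) (case_nat a (le d as))"
      using atomic_extend[OF N atomic_is_model[OF M] le_envs[OF _ d(2)] le_envs[OF _ d(1)], of bs as "length as" b]
      by (auto simp: I_def)
    then show "\<exists>a\<in>univ M. (a # as, b # bs) \<in> I"
      using I b by (auto simp: I_def le_Cons)
  next
    fix as bs i j
    assume I: "(as, bs) \<in> I" and ij: "i < length as" "j < length as"
    have "sat M (Equal (Var i) (Var j)) (le d as) \<longleftrightarrow> sat N (Equal (Var i) (Var j)) (le d' bs)"
      by (rule ctype_sat_iff[of _ "length as"]) (use I ij fragment_dest(3)[OF frag] in \<open>auto simp: I_def\<close>)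
    then show "as ! i = as ! j \<longleftrightarrow> bs ! i = bs ! j"
      using ij I by (simp add: I_def le_def)
  next
    fix as bs f ks j
    assume I: "(as, bs) \<in> I" and f: "fun_ar V f = Some (length ks)" "set ks \<subseteq> {..<length as}" "j < length as"
    let ?F = "Equal (App f (map Var ks)) (Var j)"
    have same: "ctype L M (length as) (le d as) = ctype L N (length as) (le d' bs)"
      using I unfolding I_def by blast
    have "?F \<in> L"
      using f by (intro fragment_dest(3)[OF frag]) (auto simp: list_all_iff)
    moreover have "fv ?F \<subseteq> {..<length as}"
      using f by auto
    ultimately have "sat M ?F (le d as) \<longleftrightarrow> sat N ?F (le d' bs)"
      by (rule ctype_sat_iff[OF same])
    moreover have "length as = length bs"
      using I by (simp add: I_def)
    then have "map (tval M (le d as)) (map Var ks) = map ((!) as) ks" "map (tval N (le d' bs)) (map Var ks) = map ((!) bs) ks"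
      "le d as j = as ! j" "le d' bs j = bs ! j"
      using f by (auto simp: le_def)
    ultimately show "fun_val M f (map ((!) as) ks) = as ! j \<longleftrightarrow> fun_val N f (map ((!) bs) ks) = bs ! j"
      by (simp only: sat.simps tval.simps)
  next
    fix as bs r ks
    assume I: "(as, bs) \<in> I" and r: "rel_ar V r = Some (length ks)" "set ks \<subseteq> {..<length as}"
    let ?F = "Atom r (map Var ks)"
    have same: "ctype L M (length as) (le d as) = ctype L N (length as) (le d' bs)"
      using I unfolding I_def by blast
    have "?F \<in> L"
      using r by (intro fragment_dest(4)[OF frag]) (auto simp: list_all_iff)
    moreover have "fv ?F \<subseteq> {..<length as}"
      using r by auto
    ultimately have F: "sat M ?F (le d as) \<longleftrightarrow> sat N ?F (le d' bs)"
      by (rule ctype_sat_iff[OF same])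
    have len: "length as = length bs"
      using I by (simp add: I_def)
    have "map (tval M (le d as)) (map Var ks) = map ((!) as) ks" "map (tval N (le d' bs)) (map Var ks) = map ((!) bs) ks"
      using r(2) len by (auto simp: le_def)
    then show "rel_val M r (map ((!) as) ks) \<longleftrightarrow> rel_val N r (map ((!) bs) ks)"
      using F by (simp only: sat.simps)
  qed
qed

lemma atomic_no_nonprincipal:
  assumes "atomic_model V L S M" "p \<in> nonprincipal_types V L S"
  shows "\<not> realizes M p"
proof
  assume "realizes M p"
  then obtain e where e: "e \<in> envs M" "\<forall>F\<in>p. sat M F e"
    unfolding realizes_def by blast
  obtain n where "ntype V L S n p" "\<not> principal V S p"
    using assms(2) unfolding nonprincipal_types_def by blast
  then show False
    using ntype_realized[OF atomic_is_model[OF assms(1)] e(1) _ e(2)] assms(1) e(1)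
    unfolding atomic_model_def by blast
qed

lemma atomic_if_no_nonprincipal:
  assumes M: "is_model M" and none: "trace_of V L S M = {}"
  shows "atomic_model V L S M"
  unfolding atomic_model_def
proof (intro conjI allI ballI)
  show "M \<in> structures V" "\<And>F. F \<in> S \<Longrightarrow> M \<Turnstile> F"
    using M by (simp_all add: is_model_def)
  fix n e
  assume e: "e \<in> envs M"
  let ?p = "ctype L M n e"
  show "principal V S ?p"
  proof (cases "n = 0")
    case True
    \<comment> \<open>Non-principal types are counted from n = 1. The type of the empty tuple is
      contained in S, so any of its members generates it; the empty conjunction is one.\<close>
    have "Conj (acset {}) \<in> ?p"
      using fragment_dest(10)[OF frag, of "acset {}"] by (simp add: ctype_def)
    moreover have "G \<in> S" if "G \<in> ?p" for G
      using that True complete[of G] is_model_sat[OF M e, of "Neg G"] by (auto simp: ctype_def)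
    ultimately show ?thesis
      unfolding principal_def derivable_def by (blast intro: prov.assm)
  next
    case False
    have "realizes M ?p"
      using e by (auto simp: realizes_def ctype_def)
    then show ?thesis
      using none ntype_ctype[OF M e, of n] False
      unfolding trace_of_def nonprincipal_types_def by (metis (mono_tags, lifting) One_nat_def Suc_leI bot_nat_0.not_eq_extremum empty_iff mem_Collect_eq)
  qed
qed

text \<open>The Scott sentence of an atomic model states the theory and that every tuple satisfies a
  generator of a type realized in the model.\<close>

theorem atomic_scott_sentence:
  assumes A: "atomic_model V L S A" and \<kappa>: "0 < \<kappa>"
    and rank: "\<And>F. F \<in> L \<Longrightarrow> \<exists>\<gamma><\<kappa>. rank_le V \<gamma> F"
  shows "\<exists>\<Theta>. Pi_in V (osuc \<kappa>) \<Theta> \<and> scott_sentence V A \<Theta>"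
proof -
  define gens where "gens n = {F \<in> L. fv F \<subseteq> {..<n} \<and>
    (\<exists>e\<in>envs A. sat A F e \<and> (\<forall>G\<in>ctype L A n e. derivable V (insert F S) G))}" for n
  have "sigma_def V \<kappa> {..<n} (\<lambda>M e. \<exists>F\<in>gens n. sat M F e)" for n
  proof (rule sigma_def_Bex[OF \<kappa>])
    show "countable (gens n)"
      using fragment_dest(1)[OF frag] by (rule countable_subset[rotated]) (auto simp: gens_def)
    fix F
    assume F: "F \<in> gens n"
    then have "F \<in> L"
      by (simp add: gens_def)
    then obtain \<gamma> where "\<gamma> < \<kappa>" "rank_le V \<gamma> F"
      using rank by blast
    moreover have "finite (fv F)"
      using F fragment_dest(2)[OF frag] by (auto simp: gens_def formulas_def)
    ultimately have "sigma_def V \<kappa> (fv F) (\<lambda>M. sat M F)"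
      using sigma_def_mono[of V \<gamma> "fv F" _ \<kappa>] by (simp add: rank_le_def)
    then show "sigma_def V \<kappa> {..<n} (\<lambda>M. sat M F)"
      using F sigma_def_mono_fv by (auto simp: gens_def)
  qed simp
  then have "\<forall>n. \<exists>G. Sigma_in V \<kappa> G \<and> fv G \<subseteq> {..<n} \<and> (\<forall>M e. sat M G e \<longleftrightarrow> (\<exists>F\<in>gens n. sat M F e))"
    by (simp add: sigma_def_def)
  from choice[OF this] obtain D where D: "\<And>n. Sigma_in V \<kappa> (D n)" "\<And>n. fv (D n) \<subseteq> {..<n}"
    "\<And>n M e. sat M (D n) e \<longleftrightarrow> (\<exists>F\<in>gens n. sat M F e)"
    by blast
  \<comment> \<open>Only members in normal form are allowed in the final conjunction, so each
    sentence of S is replaced by an equivalent one, regarded as having an empty quantifier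
    block.\<close>
  have "\<forall>F\<in>S. \<exists>G. Sigma_in V \<kappa> G \<and> fv G = {} \<and> (\<forall>M e. sat M G e \<longleftrightarrow> sat M F e)"
  proof
    fix F
    assume "F \<in> S"
    then obtain \<gamma> where \<gamma>: "\<gamma> < \<kappa>" "rank_le V \<gamma> F" "fv F = {}"
      using sentences rank by blast
    have "sigma_def V \<kappa> {} (\<lambda>M. sat M F)"
      by (rule sigma_def_mono[OF _ less_imp_le[OF \<gamma>(1)]]) (use \<gamma> in \<open>auto simp: rank_le_def\<close>)
    then show "\<exists>G. Sigma_in V \<kappa> G \<and> fv G = {} \<and> (\<forall>M e. sat M G e \<longleftrightarrow> sat M F e)"
      by (simp add: sigma_def_def)
  qed
  from bchoice[OF this] obtain nf where nf: "\<And>F. F \<in> S \<Longrightarrow> Sigma_in V \<kappa> (nf F) \<and> fv (nf F) = {}"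
    "\<And>F M e. F \<in> S \<Longrightarrow> sat M (nf F) e \<longleftrightarrow> sat M F e"
    by blast
  define X where "X = nf ` S \<union> range (\<lambda>n. (Forall ^^ n) (D n))"
  define \<Theta> where "\<Theta> = Conj (acset X)"
  have "countable S"
    using fragment_dest(1)[OF frag] by (rule countable_subset[rotated]) (use sentences in blast)
  then have X: "countable X"
    by (simp add: X_def)
  have X_part: "\<exists>k G. F = (Forall ^^ k) G \<and> Sigma_in V \<kappa> G" if "F \<in> X" for F
  proof (cases "F \<in> nf ` S")
    case True
    then show ?thesis
      using nf(1) by (intro exI[of _ 0] exI[of _ F]) auto
  qed (use that D(1) in \<open>auto simp: X_def\<close>)
  have X_fv: "fv F = {}" if "F \<in> X" for F
    using that nf(1) D(2) by (fastforce simp: X_def fv_pow)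
  have fv_\<Theta>: "fv \<Theta> = {}"
    using X X_fv by (simp add: \<Theta>_def)
  have wf_\<Theta>: "wf_symbols V \<Theta>"
    using X X_part Sigma_in_formulas by (fastforce simp: \<Theta>_def formulas_def)
  have Pi: "Pi_in V (osuc \<kappa>) \<Theta>"
    unfolding \<Theta>_def
  proof (rule Pi_in_pos)
    show "Conj (acset X) \<in> formulas V"
      using fv_\<Theta> wf_\<Theta> by (simp add: formulas_def \<Theta>_def)
    show "\<forall>F\<in>rcset (acset X). \<exists>\<beta><osuc \<kappa>. \<exists>k G. F = (Forall ^^ k) G \<and> Sigma_in V \<beta> G"
    proof -
      have "rcset (acset X) = X"
        using X by simp
      then show ?thesis
        using X_part less_osuc by blast
    qed
  qed simp
  have sat_pow: "sat M ((Forall ^^ n) (D n)) e \<longleftrightarrow>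
      (\<forall>e'\<in>envs M. (\<forall>i. e' (i + n) = e i) \<longrightarrow> (\<exists>F\<in>gens n. sat M F e'))" if "e \<in> envs M" for M n e
    unfolding sat_Forall_pow sat_Exi_pow[OF that] by (simp add: D(3)) blast
  have sat_\<Theta>: "sat M \<Theta> e \<longleftrightarrow> (\<forall>F\<in>S. sat M F e) \<and>
      (\<forall>n. \<forall>e'\<in>envs M. (\<forall>i. e' (i + n) = e i) \<longrightarrow> (\<exists>F\<in>gens n. sat M F e'))" if "e \<in> envs M" for M e
  proof -
    have "sat M \<Theta> e \<longleftrightarrow> (\<forall>F\<in>X. sat M F e)"
      using X by (simp add: \<Theta>_def)
    also have "\<dots> \<longleftrightarrow> (\<forall>F\<in>S. sat M F e) \<and> (\<forall>n. sat M ((Forall ^^ n) (D n)) e)"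
      by (simp add: X_def ball_Un nf(2) cong: ball_cong)
    finally show ?thesis
      by (simp add: sat_pow[OF that])
  qed
  have holds_A: "A \<Turnstile> \<Theta>"
    unfolding holds_def
  proof
    fix e
    assume e: "e \<in> envs A"
    have "\<exists>F\<in>gens n. sat A F e'" if e': "e' \<in> envs A" for n e'
    proof -
      have "principal V S (ctype L A n e')"
        using A e' unfolding atomic_model_def by blast
      then obtain F where "F \<in> ctype L A n e'" "\<forall>G\<in>ctype L A n e'. derivable V (insert F S) G"
        by (rule principal_generator)
      then show ?thesis
        using e' by (intro bexI[of _ F]) (auto simp: gens_def ctype_def)
    qed
    then show "sat A \<Theta> e"
      using e is_model_sat[OF atomic_is_model[OF A] e] by (simp add: sat_\<Theta>)
  qed
  have "scott_sentence V A \<Theta>"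
    unfolding scott_sentence_def
  proof (intro conjI ballI iffI)
    show sent: "\<Theta> \<in> sentences V"
      using fv_\<Theta> wf_\<Theta> by (simp add: sentences_def formulas_def)
    fix N
    assume N: "N \<in> structures V"
    show "N \<Turnstile> \<Theta>" if "isomorphic V A N"
      using isomorphic_holds[OF that _ N sent] holds_A A by (simp add: atomic_model_def)
    show "isomorphic V A N" if N\<Theta>: "N \<Turnstile> \<Theta>"
    proof -
      have model: "is_model N"
        using N N\<Theta> sat_\<Theta> unfolding is_model_def holds_def by blast
      have "principal V S (ctype L N n e')" if e': "e' \<in> envs N" for n e'
      proof -
        \<comment> \<open>An arbitrary environment extends its own tail by n elements; evaluated at
          the tail, the n-fold universal statement applies to it.\<close>
        have "(\<lambda>i. e' (i + n)) \<in> envs N"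
          using e' by (auto simp: envs_def)
        then have "\<exists>F\<in>gens n. sat N F e'"
          using N\<Theta> sat_\<Theta> e' unfolding holds_def by blast
        then obtain F e where F: "sat N F e'" "F \<in> L" "fv F \<subseteq> {..<n}" "e \<in> envs A" "sat A F e"
          "\<forall>G\<in>ctype L A n e. derivable V (insert F S) G"
          unfolding gens_def by blast
        have "ctype L A n e = ctype L N n e'"
          by (rule generator_ctype[OF F(6) model e' F(1)])
        moreover have "F \<in> ctype L A n e"
          using F by (simp add: ctype_def)
        ultimately show ?thesis
          unfolding principal_def using F(6) by metis
      qed
      then have "atomic_model V L S N"
        using model unfolding atomic_model_def is_model_def by blast
      then show ?thesis
        by (rule atomic_models_isomorphic[OF A])
    qed
  qed
  then show ?thesis
    using Pi by blast
qed

end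

section \<open>Nodes\<close>

lemma not_is_limit_zero [simp]: "\<not> is_limit 0"
  by (simp add: is_limit_def)

lemma node_complete:
  "node V \<phi> \<delta> L S \<Longrightarrow>
    (\<forall>F\<in>S. F \<in> L \<and> fv F = {}) \<and> (\<forall>F\<in>L. fv F = {} \<longrightarrow> F \<in> S \<or> Neg F \<in> S)"
proof (induction rule: node.induct)
  case (node_lim \<delta> l s)
  have IH: "\<And>\<gamma> F. \<gamma> < \<delta> \<Longrightarrow> F \<in> s \<gamma> \<Longrightarrow> F \<in> l \<gamma> \<and> fv F = {}"
    "\<And>\<gamma> F. \<gamma> < \<delta> \<Longrightarrow> F \<in> l \<gamma> \<Longrightarrow> fv F = {} \<Longrightarrow> F \<in> s \<gamma> \<or> Neg F \<in> s \<gamma>"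
    using node_lim by auto
  show ?case
  proof (intro conjI ballI impI)
    fix F
    assume "F \<in> (\<Union>\<gamma><\<delta>. s \<gamma>)"
    then obtain \<gamma> where "\<gamma> < \<delta>" "F \<in> s \<gamma>"
      by auto
    then show "F \<in> (\<Union>\<gamma><\<delta>. l \<gamma>)" "fv F = {}"
      using IH(1) by auto
  next
    fix F
    assume "F \<in> (\<Union>\<gamma><\<delta>. l \<gamma>)" and fv: "fv F = {}"
    then obtain \<gamma> where "\<gamma> < \<delta>" "F \<in> l \<gamma>"
      by auto
    then show "F \<in> (\<Union>\<gamma><\<delta>. s \<gamma>) \<or> Neg F \<in> (\<Union>\<gamma><\<delta>. s \<gamma>)"
      using IH(2)[OF _ _ fv] by auto
  qed
qed (auto simp: omega_complete_def)

lemma node_theory: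
  assumes "node V \<phi> \<delta> L S" "M \<in> structures V" "\<forall>F\<in>S. M \<Turnstile> F"
  shows "S = {F \<in> L. fv F = {} \<and> M \<Turnstile> F}"
  using node_complete[OF assms(1)] assms(2,3) holds_Neg by blast

lemma node_zeroD:
  assumes "node V \<phi> 0 L S"
  shows "L = gen_fragment V {\<phi>}" "base_theory V \<phi> \<subseteq> S"
  using assms by (cases rule: node.cases; simp)+

lemma node_osucE:
  assumes "node V \<phi> (osuc \<delta>) L' S'"
  obtains L S where "node V \<phi> \<delta> L S" "S \<subseteq> S'" "fragment V L'"
    "L' = gen_fragment V (L \<union> {Conj (acset p) | p. p \<in> nonprincipal_types V L S})"
  using assms by (cases rule: node.cases) auto

lemma node_limitE:
  assumes "node V \<phi> \<delta> L S" "is_limit \<delta>"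
  obtains l s where "\<And>\<gamma>. \<gamma> < \<delta> \<Longrightarrow> node V \<phi> \<gamma> (l \<gamma>) (s \<gamma>)" "L = (\<Union>\<gamma><\<delta>. l \<gamma>)" "S = (\<Union>\<gamma><\<delta>. s \<gamma>)"
  using assms(1)
proof (cases rule: node.cases)
  case (node_lim l s)
  then show ?thesis
    by (intro that[of l s]) auto
qed (use assms(2) in simp_all)

text \<open>A node does not record the branch below it, so inversion yields some predecessor, not a
  prescribed one. A common model settles this: a node is the theory of the model in its fragment,
  and by induction level and model determine the fragment.\<close>

lemma node_unique:
  assumes "node V \<phi> \<delta> L1 S1" "node V \<phi> \<delta> L2 S2" "M \<in> structures V"
    "\<forall>F\<in>S1. M \<Turnstile> F" "\<forall>F\<in>S2. M \<Turnstile> F"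
  shows "L1 = L2" "S1 = S2"
proof -
  have "L1 = L2"
    using assms
  proof (induction \<delta> arbitrary: L1 S1 L2 S2 rule: less_induct)
    case (less \<delta>)
    note n1 = less.prems(1) and n2 = less.prems(2)
    show ?case
    proof (cases \<delta> rule: om1_cases)
      case 1
      then show ?thesis
        using n1 n2 node_zeroD(1) by blast
    next
      case (2 \<gamma>)
      obtain L1' S1' where 1: "node V \<phi> \<gamma> L1' S1'" "S1' \<subseteq> S1"
        "L1 = gen_fragment V (L1' \<union> {Conj (acset p) | p. p \<in> nonprincipal_types V L1' S1'})"
        using n1 unfolding 2 by (rule node_osucE)
      obtain L2' S2' where n2': "node V \<phi> \<gamma> L2' S2'" "S2' \<subseteq> S2"
        "L2 = gen_fragment V (L2' \<union> {Conj (acset p) | p. p \<in> nonprincipal_types V L2' S2'})"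
        using n2 unfolding 2 by (rule node_osucE)
      have m: "\<forall>F\<in>S1'. M \<Turnstile> F" "\<forall>F\<in>S2'. M \<Turnstile> F"
        using 1(2) n2'(2) less.prems(4,5) by blast+
      have "L1' = L2'"
        using less.IH[OF _ 1(1) n2'(1) assms(3) m] 2 by simp
      moreover from this have "S1' = S2'"
        using node_theory[OF 1(1) assms(3) m(1)] node_theory[OF n2'(1) assms(3) m(2)] by simp
      ultimately show ?thesis
        using 1(3) n2'(3) by simp
    next
      case 3
      obtain l s where 1: "\<And>\<gamma>. \<gamma> < \<delta> \<Longrightarrow> node V \<phi> \<gamma> (l \<gamma>) (s \<gamma>)" "L1 = (\<Union>\<gamma><\<delta>. l \<gamma>)" "S1 = (\<Union>\<gamma><\<delta>. s \<gamma>)"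
        by (rule node_limitE[OF n1 3], rule that)
      obtain l' s' where 2: "\<And>\<gamma>. \<gamma> < \<delta> \<Longrightarrow> node V \<phi> \<gamma> (l' \<gamma>) (s' \<gamma>)" "L2 = (\<Union>\<gamma><\<delta>. l' \<gamma>)" "S2 = (\<Union>\<gamma><\<delta>. s' \<gamma>)"
        by (rule node_limitE[OF n2 3], rule that)
      have "l \<gamma> = l' \<gamma>" if "\<gamma> < \<delta>" for \<gamma>
        using less.IH[OF that 1(1)[OF that] 2(1)[OF that] assms(3)] less.prems(4,5) 1(3) 2(3) that by blast
      then show ?thesis
        using 1(2) 2(2) by simp
    qed
  qed
  then show "L1 = L2" "S1 = S2"
    using node_theory[OF assms(1,3,4)] node_theory[OF assms(2,3,5)] by simp_all
qed

section \<open>The given branch, its fragments and its types\<close>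

locale branch =
  fixes V :: vocab and \<phi> :: fml and Lb Tb :: "om1 \<Rightarrow> fml set"
  assumes branch: "sacks_branch V \<phi> Lb Tb"
begin

lemmas branch_conjuncts = branch[unfolded sacks_branch_def]

lemma node_branch: "node V \<phi> \<delta> (Lb \<delta>) (Tb \<delta>)"
  by (rule spec[OF branch_conjuncts[THEN conjunct1]])

lemma branch_mono: "\<gamma> \<le> \<delta> \<Longrightarrow> Lb \<gamma> \<subseteq> Lb \<delta>" "\<gamma> \<le> \<delta> \<Longrightarrow> Tb \<gamma> \<subseteq> Tb \<delta>"
  using branch_conjuncts[THEN conjunct2, THEN conjunct1] by simp_all

lemma branch_limit: "is_limit \<delta> \<Longrightarrow> Lb \<delta> = (\<Union>\<gamma><\<delta>. Lb \<gamma>)"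
  using branch_conjuncts[THEN conjunct2, THEN conjunct2, THEN conjunct1] by simp

lemma branch_atomic: "\<exists>A. atomic_model V (Lb \<delta>) (Tb \<delta>) A"
  using spec[OF branch_conjuncts[THEN conjunct2, THEN conjunct2, THEN conjunct2, THEN conjunct2], of \<delta>]
  by auto

lemma branch_osuc:
  "Lb (osuc \<delta>) = gen_fragment V (Lb \<delta> \<union> {Conj (acset p) | p. p \<in> nonprincipal_types V (Lb \<delta>) (Tb \<delta>)})"
  "fragment V (Lb (osuc \<delta>))"
proof -
  obtain L S where L: "node V \<phi> \<delta> L S" "S \<subseteq> Tb (osuc \<delta>)" "fragment V (Lb (osuc \<delta>))"
    "Lb (osuc \<delta>) = gen_fragment V (L \<union> {Conj (acset p) | p. p \<in> nonprincipal_types V L S})"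
    using node_branch by (rule node_osucE)
  \<comment> \<open>A model of the larger theory is a common model of the two candidates for the
    predecessor.\<close>
  obtain A where A: "A \<in> structures V" "\<forall>F\<in>Tb (osuc \<delta>). A \<Turnstile> F"
    using branch_atomic[of "osuc \<delta>"] unfolding atomic_model_def by blast
  have "L = Lb \<delta>" "S = Tb \<delta>"
    using node_unique[OF L(1) node_branch A(1)] L(2) A(2) branch_mono(2)[of \<delta> "osuc \<delta>"]
    by (meson less_imp_le less_osuc subsetD)+
  then show "Lb (osuc \<delta>) = gen_fragment V (Lb \<delta> \<union> {Conj (acset p) | p. p \<in> nonprincipal_types V (Lb \<delta>) (Tb \<delta>)})"
    "fragment V (Lb (osuc \<delta>))"
    using L by simp_all
qed

lemma base_in_branch: "\<phi> \<in> Tb \<delta>" "\<phi> \<in> Lb \<delta>"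
proof -
  have "\<phi> \<in> Tb 0"
    using node_zeroD(2)[OF node_branch] by (auto simp: base_theory_def)
  then show "\<phi> \<in> Tb \<delta>" 
    using branch_mono(2)[OF zero_le_om1] by blast
  then show "\<phi> \<in> Lb \<delta>"
    using node_complete[OF node_branch] by blast
qed

text \<open>Only successor nodes carry the fact of being a fragment. At level 0 it is level 1 that
  supplies a fragment containing \<phi>; at limits, any finite set of formulas lies in an earlier
  fragment.\<close>

lemma branch_fragment: "fragment V (Lb \<delta>)"
proof (induction \<delta> rule: less_induct)
  case (less \<delta>)
  show ?case
  proof (cases \<delta> rule: om1_cases)
    case 1
    have "fragment V (gen_fragment V {\<phi>})"
      by (rule fragment_gen_fragment[OF branch_osuc(2)[of 0]]) (use base_in_branch in simp)
    then show ?thesis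
      using node_zeroD(1)[of V \<phi>] node_branch 1 by metis
  next
    case (2 \<gamma>)
    then show ?thesis
      using branch_osuc(2) by simp
  next
    case 3
    have L: "Lb \<delta> = (\<Union>\<gamma><\<delta>. Lb \<gamma>)"
      by (rule branch_limit[OF 3])
    have frag: "fragment V (Lb \<gamma>)" if "\<gamma> < \<delta>" for \<gamma>
      by (rule less[OF that])
    have mem: "F \<in> Lb \<delta> \<longleftrightarrow> (\<exists>\<gamma><\<delta>. F \<in> Lb \<gamma>)" for F
      by (auto simp: L)
    have "0 < \<delta>"
      using 3 by (simp add: is_limit_def order.not_eq_order_implies_strict)
    have finite_mem: "\<exists>\<gamma><\<delta>. X \<subseteq> Lb \<gamma>" if "finite X" "X \<subseteq> Lb \<delta>" for X
      using that
    proof (induction X)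
      case empty
      then show ?case using \<open>0 < \<delta>\<close> by blast
    next
      case (insert F X)
      then obtain \<gamma> \<gamma>' where "\<gamma> < \<delta>" "X \<subseteq> Lb \<gamma>" "\<gamma>' < \<delta>" "F \<in> Lb \<gamma>'"
        using mem by auto
      then show ?case
        using branch_mono(1)[of \<gamma> "max \<gamma> \<gamma>'"] branch_mono(1)[of \<gamma>' "max \<gamma> \<gamma>'"]
        by (intro exI[of _ "max \<gamma> \<gamma>'"]) auto
    qed
    show ?thesis
      unfolding fragment_def
    proof (intro conjI allI impI)
      show "countable (Lb \<delta>)"
        unfolding L using frag by (intro countable_UN om1_countable_below) (auto dest: fragment_dest(1))
      show "Lb \<delta> \<subseteq> formulas V"
        unfolding L using frag by (auto dest: fragment_dest(2))
      show "Equal s t \<in> Lb \<delta>" if "wf_trm V s \<and> wf_trm V t" for s t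
        unfolding mem using that frag[OF \<open>0 < \<delta>\<close>] \<open>0 < \<delta>\<close> fragment_dest(3) by blast
      show "Atom r ts \<in> Lb \<delta>" if "rel_ar V r = Some (length ts) \<and> list_all (wf_trm V) ts" for r ts
        unfolding mem using that frag[OF \<open>0 < \<delta>\<close>] \<open>0 < \<delta>\<close> fragment_dest(4) by blast
      show "Neg F \<in> Lb \<delta> \<longleftrightarrow> F \<in> Lb \<delta>" "Exi F \<in> Lb \<delta> \<longleftrightarrow> F \<in> Lb \<delta>" "Forall F \<in> Lb \<delta> \<longleftrightarrow> F \<in> Lb \<delta>" for F
        unfolding mem using frag fragment_dest(5-7) by metis+
      show "rcset \<Phi> \<subseteq> Lb \<delta>" if "Conj \<Phi> \<in> Lb \<delta>" for \<Phi>
        using that frag fragment_dest(8) unfolding L by fastforce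
      show "rcset \<Phi> \<subseteq> Lb \<delta>" if "Disj \<Phi> \<in> Lb \<delta>" for \<Phi>
        using that frag fragment_dest(9) unfolding L by fastforce
      show "Conj \<Phi> \<in> Lb \<delta>" "Disj \<Phi> \<in> Lb \<delta>" if "finite (rcset \<Phi>) \<and> rcset \<Phi> \<subseteq> Lb \<delta>" for \<Phi>
      proof -
        obtain \<gamma> where \<gamma>: "\<gamma> < \<delta>" "rcset \<Phi> \<subseteq> Lb \<gamma>"
          using finite_mem \<open>finite (rcset \<Phi>) \<and> rcset \<Phi> \<subseteq> Lb \<delta>\<close> by blast
        then show "Conj \<Phi> \<in> Lb \<delta>" "Disj \<Phi> \<in> Lb \<delta>"
          unfolding mem using fragment_dest(10,11)[OF frag[OF \<gamma>(1)]] that by blast+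
      qed
      show "subst F \<sigma> \<in> Lb \<delta>" if "F \<in> Lb \<delta> \<and> (\<forall>i. wf_trm V (\<sigma> i))" for F \<sigma>
        using that frag fragment_dest(12) unfolding mem by blast
    qed
  qed
qed

lemma branch_complete_theory: "complete_theory V (Lb \<delta>) (Tb \<delta>)"
  using branch_fragment node_complete[OF node_branch] by unfold_locales blast+

definition models_branch :: "om1 \<Rightarrow> struct \<Rightarrow> bool" where
  "models_branch \<delta> M \<longleftrightarrow> M \<in> structures V \<and> (\<forall>F\<in>Tb \<delta>. M \<Turnstile> F)"

lemma models_branch_mono: "models_branch \<delta> M \<Longrightarrow> \<gamma> \<le> \<delta> \<Longrightarrow> models_branch \<gamma> M"
  unfolding models_branch_def using branch_mono(2) by blast

lemma is_model_iff: "complete_theory.is_model V (Tb \<delta>) M \<longleftrightarrow> models_branch \<delta> M"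
  using complete_theory.is_model_def[OF branch_complete_theory] by (simp add: models_branch_def)

lemma Conj_type_in_branch:
  assumes "p \<in> nonprincipal_types V (Lb \<beta>) (Tb \<beta>)" "\<beta> < \<delta>"
  shows "Conj (acset p) \<in> Lb \<delta>"
proof -
  have "Conj (acset p) \<in> Lb (osuc \<beta>)"
    unfolding branch_osuc(1) by (rule subsetD[OF gen_fragment_superset]) (use assms(1) in auto)
  then show ?thesis
    using branch_mono(1)[OF osuc_le[OF assms(2)]] by blast
qed

text \<open>A formula of the larger fragment isolates the type over the smaller one: a generator if the
  type is principal, and its conjunction otherwise.\<close>

lemma type_isolated:
  assumes M: "models_branch \<beta> M" "e \<in> envs M" and "\<beta> < \<delta>" "1 \<le> n"
  obtains F where "F \<in> Lb \<delta>" "fv F \<subseteq> {..<n}" "sat M F e"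
    "\<And>N e'. models_branch \<beta> N \<Longrightarrow> e' \<in> envs N \<Longrightarrow> sat N F e' \<Longrightarrow> ctype (Lb \<beta>) M n e = ctype (Lb \<beta>) N n e'"
proof -
  interpret complete_theory V "Lb \<beta>" "Tb \<beta>"
    by (rule branch_complete_theory)
  let ?p = "ctype (Lb \<beta>) M n e"
  show ?thesis
  proof (cases "principal V (Tb \<beta>) ?p")
    case True
    then obtain F where F: "F \<in> ?p" "\<forall>G\<in>?p. derivable V (insert F (Tb \<beta>)) G"
      by (rule principal_generator)
    show ?thesis
    proof (rule that)
      show "F \<in> Lb \<delta>" "fv F \<subseteq> {..<n}" "sat M F e"
        using F(1) branch_mono(1)[OF less_imp_le[OF \<open>\<beta> < \<delta>\<close>]] by (auto simp: ctype_def)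
      show "?p = ctype (Lb \<beta>) N n e'" if "models_branch \<beta> N" "e' \<in> envs N" "sat N F e'" for N e'
        using generator_ctype[OF F(2)] that by (simp add: is_model_iff)
    qed
  next
    case False
    then have np: "?p \<in> nonprincipal_types V (Lb \<beta>) (Tb \<beta>)"
      using ntype_ctype[of M e n] M \<open>1 \<le> n\<close> by (auto simp: nonprincipal_types_def is_model_iff)
    have "countable ?p"
      using fragment_dest(1)[OF frag] by (rule countable_subset[rotated]) (auto simp: ctype_def)
    then have rc: "rcset (acset ?p) = ?p"
      by simp
    show ?thesis
    proof (rule that)
      show "Conj (acset ?p) \<in> Lb \<delta>"
        by (rule Conj_type_in_branch[OF np \<open>\<beta> < \<delta>\<close>])
      show "fv (Conj (acset ?p)) \<subseteq> {..<n}" "sat M (Conj (acset ?p)) e"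
        by (auto simp: rc) (auto simp: ctype_def)
      show "?p = ctype (Lb \<beta>) N n e'" if "sat N (Conj (acset ?p)) e'" for N e'
        using that by (intro ctype_eqI) (auto simp: rc, auto simp: ctype_def)
    qed
  qed
qed

text \<open>A formula isolating the type of the longer tuple over the lower level lies in the upper
  fragment, as does its existential closure over the k new elements; the latter is in the type of
  the old tuple and so holds in N. The case k = 0 is separate because the tuple may then be empty,
  and isolation is available for nonempty tuples.\<close>

lemma type_extension:
  assumes M: "models_branch \<delta> M" "e \<in> envs M" and N: "models_branch \<delta> N" "e' \<in> envs N"
    and same: "ctype (Lb \<delta>) M n e = ctype (Lb \<delta>) N n e'"
    and "\<beta> < \<delta>" and e2: "e2 \<in> envs M" "\<And>i. e2 (i + k) = e i"
  shows "\<exists>e2'\<in>envs N. (\<forall>i. e2' (i + k) = e' i) \<and> ctype (Lb \<beta>) M (n + k) e2 = ctype (Lb \<beta>) N (n + k) e2'"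
proof (cases "k = 0")
  case True
  then have "e2 = e"
    using e2(2) by auto
  moreover have "ctype (Lb \<beta>) M' n e'' = Lb \<beta> \<inter> ctype (Lb \<delta>) M' n e''" for M' e''
    using branch_mono(1)[OF less_imp_le[OF \<open>\<beta> < \<delta>\<close>]] by (auto simp: ctype_def)
  ultimately show ?thesis
    using True same N(2) by (intro bexI[of _ e']) simp_all
next
  case False
  interpret complete_theory V "Lb \<delta>" "Tb \<delta>"
    by (rule branch_complete_theory)
  have \<beta>: "models_branch \<beta> M" "models_branch \<beta> N"
    using M(1) N(1) models_branch_mono \<open>\<beta> < \<delta>\<close> less_imp_le by blast+
  obtain F where F: "F \<in> Lb \<delta>" "fv F \<subseteq> {..<n + k}" "sat M F e2"
    "\<And>N e'. models_branch \<beta> N \<Longrightarrow> e' \<in> envs N \<Longrightarrow> sat N F e' \<Longrightarrow>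
      ctype (Lb \<beta>) M (n + k) e2 = ctype (Lb \<beta>) N (n + k) e'"
    by (rule type_isolated[OF \<beta>(1) e2(1) \<open>\<beta> < \<delta>\<close>, of "n + k"]) (use False in auto)
  have "sat M ((Exi ^^ k) F) e"
    unfolding sat_Exi_pow[OF M(2)] using e2 F(3) by blast
  moreover have "(Exi ^^ k) F \<in> Lb \<delta>" "fv ((Exi ^^ k) F) \<subseteq> {..<n}"
    using F(1,2) by (auto simp: fragment_Exi_pow[OF frag] fv_pow)
  ultimately have "sat N ((Exi ^^ k) F) e'"
    using ctype_sat_iff[OF same] by blast
  then show ?thesis
    unfolding sat_Exi_pow[OF N(2)] using F(4)[OF \<beta>(2)] by blast
qed

text \<open>Witnesses for a quantifier block are moved to N with the same type over the lower level
  \<beta>, where the hypothesis for \<beta> transfers the matrix.\<close>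

lemma same_type_Sigma_in:
  assumes IH: "\<And>\<beta> M N n e e' F. \<beta> < \<delta> \<Longrightarrow> models_branch \<beta> M \<Longrightarrow> models_branch \<beta> N \<Longrightarrow> e \<in> envs M \<Longrightarrow> e' \<in> envs N \<Longrightarrow>
      ctype (Lb \<beta>) M n e = ctype (Lb \<beta>) N n e' \<Longrightarrow> Pi_in V \<beta> F \<Longrightarrow> fv F \<subseteq> {..<n} \<Longrightarrow>
      sat M F e \<Longrightarrow> sat N F e'"
    and M: "models_branch \<delta> M" "e \<in> envs M" and N: "models_branch \<delta> N" "e' \<in> envs N"
    and same: "ctype (Lb \<delta>) M n e = ctype (Lb \<delta>) N n e'"
    and F: "Sigma_in V \<delta> F" "fv F \<subseteq> {..<n}" "sat M F e"
  shows "sat N F e'"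
  using F(1)
proof (cases rule: Sigma_in_cases)
  case 1
  then have "F \<in> Lb \<delta>"
    using fragment_finitary[OF branch_fragment] by (auto simp: formulas_def)
  then show ?thesis
    using complete_theory.ctype_sat_iff[OF branch_complete_theory same] F by blast
next
  case (2 \<Phi>)
  then obtain H where H: "H \<in> rcset \<Phi>" "sat M H e"
    using F(3) by auto
  then obtain \<beta> k G where G: "\<beta> < \<delta>" "H = (Exi ^^ k) G" "Pi_in V \<beta> G"
    using 2 by blast
  obtain e2 where e2: "e2 \<in> envs M" "\<And>i. e2 (i + k) = e i" "sat M G e2"
    using H(2) unfolding G(2) sat_Exi_pow[OF M(2)] by blast
  obtain e2' where e2': "e2' \<in> envs N" "\<forall>i. e2' (i + k) = e' i"
    "ctype (Lb \<beta>) M (n + k) e2 = ctype (Lb \<beta>) N (n + k) e2'"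
    using type_extension[OF M N same G(1) e2(1,2)] by blast
  have "fv G \<subseteq> {..<n + k}"
  proof
    fix i
    assume "i \<in> fv G"
    show "i \<in> {..<n + k}"
    proof (cases "i < k")
      case False
      then have "i - k \<in> fv H"
        using \<open>i \<in> fv G\<close> by (simp add: G(2) fv_pow)
      then have "i - k < n"
        using F(2) H(1) 2(2) by auto
      then show ?thesis by simp
    qed simp
  qed
  then have "sat N G e2'"
    using IH[OF G(1) _ _ e2(1) e2'(1,3) G(3) _ e2(3)] M(1) N(1) models_branch_mono G(1) less_imp_le by blast
  then have "sat N H e'"
    unfolding G(2) sat_Exi_pow[OF N(2)] using e2' by blast
  then show ?thesis
    using H(1) 2(2) by auto
qed

text \<open>If a \<Pi> formula of M failed in N, its \<Sigma> dual would hold in N and be carried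
  back to M; equality of types is symmetric, so the \<Sigma> step applies with the structures
  exchanged.\<close>

lemma same_type_in_hierarchy:
  assumes "models_branch \<delta> M" "e \<in> envs M" "models_branch \<delta> N" "e' \<in> envs N"
    and "ctype (Lb \<delta>) M n e = ctype (Lb \<delta>) N n e'"
    and "Pi_in V \<delta> F" "fv F \<subseteq> {..<n}" "sat M F e"
  shows "sat N F e'"
  using assms
proof (induction \<delta> arbitrary: M N n e e' F rule: less_induct)
  case (less \<delta>)
  obtain G where G: "Sigma_in V \<delta> G" "fv G = fv F" "\<And>M e. sat M G e \<longleftrightarrow> \<not> sat M F e"
    using in_hierarchy_dual[of V \<delta> F] less.prems(6) by blast
  show ?case
  proof (rule ccontr)
    assume "\<not> sat N F e'"
    then have "sat N G e'"
      using G(3) by blast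
    have "sat M G e"
    proof (rule same_type_Sigma_in)
      show "sat N' F' e2'" if "\<beta> < \<delta>" "models_branch \<beta> M'" "models_branch \<beta> N'" "e2 \<in> envs M'" "e2' \<in> envs N'"
        "ctype (Lb \<beta>) M' n' e2 = ctype (Lb \<beta>) N' n' e2'" "Pi_in V \<beta> F'" "fv F' \<subseteq> {..<n'}" "sat M' F' e2"
        for \<beta> M' N' n' e2 e2' F'
        by (rule less.IH[OF that(1,2,4,3,5-9)])
      show "models_branch \<delta> N" "e' \<in> envs N" "models_branch \<delta> M" "e \<in> envs M"
        "ctype (Lb \<delta>) N n e' = ctype (Lb \<delta>) M n e" "Sigma_in V \<delta> G" "fv G \<subseteq> {..<n}" "sat N G e'"
        using less.prems G \<open>sat N G e'\<close> by simp_all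
    qed
    then show False
      using G(3) less.prems(8) by blast
  qed
qed

text \<open>The formula already occurs at some level below the limit. Inside a level \<delta> each
  connective or quantifier moves the bound from \<open>h \<delta> n\<close> to a later
  \<open>h \<delta> m\<close> or leaves it unchanged, and each new level starts above all bounds of
  the earlier ones.\<close>

lemma branch_rank:
  assumes "omega < omega1_real X" "qr \<phi> < omega1_real X" "F \<in> Lb (omega1_real X)"
  shows "\<exists>\<gamma><omega1_real X. rank_le V \<gamma> F"
proof -
  let ?\<kappa> = "omega1_real X"
  have lim: "is_limit ?\<kappa>"
    by (rule is_limit_omega1_real[OF assms(1)])
  then obtain \<delta>0 where \<delta>0: "\<delta>0 < ?\<kappa>" "F \<in> Lb \<delta>0"
    using assms(3) branch_limit by auto
  \<comment> \<open>The first successor leaves room to make \<phi> and its subformulas two-sided;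
    the second includes the level \<open>\<delta>0\<close> itself.\<close>
  have *: "osuc (qr \<phi>) < ?\<kappa>" "osuc \<delta>0 < ?\<kappa>"
    using lim assms(2) \<delta>0(1) by (auto simp: is_limit_def)
  obtain h :: "om1 \<Rightarrow> nat \<Rightarrow> om1" where h_ge: "\<And>\<delta> n. \<delta> < osuc \<delta>0 \<Longrightarrow> osuc (qr \<phi>) \<le> h \<delta> n"
    and h_less: "\<And>\<delta> n. \<delta> < osuc \<delta>0 \<Longrightarrow> h \<delta> n < ?\<kappa>"
    and h_mono: "\<And>\<delta> m n. \<delta> < osuc \<delta>0 \<Longrightarrow> m < n \<Longrightarrow> h \<delta> m < h \<delta> n"
    and h_lex: "\<And>\<gamma> \<delta> m n. \<gamma> < \<delta> \<Longrightarrow> \<delta> < osuc \<delta>0 \<Longrightarrow> h \<gamma> m < h \<delta> n"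
    by (rule omega1_real_rank[OF * assms(1)], rule that)
  have form: "G \<in> formulas V" if "F \<in> Lb \<delta>" "G \<in> subfmls F" for F G \<delta>
    using that fragment_subfmls[OF branch_fragment] fragment_dest(2)[OF branch_fragment] by blast
  \<comment> \<open>Applied with \<phi> alone at level 0, and with the preceding fragment and the
    conjunctions of its non-principal types at successors; limits are mere unions.\<close>
  have step: "\<exists>n. rank_le V (h \<delta> n) G"
    if \<delta>: "\<delta> < osuc \<delta>0" and Lb: "Lb \<delta> = gen_fragment V Y"
      and Y: "\<And>F G. F \<in> Y \<Longrightarrow> G \<in> subfmls F \<Longrightarrow> \<exists>n. rank_le V (h \<delta> n) G"
      and FG: "F \<in> Lb \<delta>" "G \<in> subfmls F" for \<delta> Y F G
  proof -
    have pos: "0 < h \<delta> n" for n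
      by (rule less_le_trans[OF osuc_pos h_ge[OF \<delta>]])
    have up: "rank_le V (h \<delta> m) F" if "rank_le V (h \<delta> n) F" "n \<le> m" "F \<in> formulas V" for m n F
    proof (cases "n = m")
      case False
      then have "h \<delta> n \<le> h \<delta> m"
        using h_mono[OF \<delta>, of n m] that(2) by simp
      then show ?thesis
        using rank_le_mono that by blast
    qed (use that in simp)
    \<comment> \<open>Inside a level conjunctions and disjunctions are formed of finite sets only,
      so the indices have a maximum. Infinitely many could exhaust the block of the level.\<close>
    have bound: "\<exists>n. \<forall>F\<in>\<Psi>. rank_le V (h \<delta> n) F"
      if "finite \<Psi>" "\<forall>F\<in>\<Psi>. (\<exists>n. rank_le V (h \<delta> n) F) \<and> F \<in> formulas V" for \<Psi>
      using that
    proof (induction \<Psi>)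
      case (insert F \<Psi>)
      then obtain m n where "\<forall>F\<in>\<Psi>. rank_le V (h \<delta> m) F" "rank_le V (h \<delta> n) F"
        by auto
      then have "\<forall>G\<in>insert F \<Psi>. rank_le V (h \<delta> (max m n)) G"
        using up insert.prems by (metis insert_iff max.cobounded1 max.cobounded2)
      then show ?case by blast
    qed simp
    have member: "F \<in> formulas V" if "F \<in> rcset \<Phi>" "Conj \<Phi> \<in> formulas V \<or> Disj \<Phi> \<in> formulas V" for F \<Phi>
      using that fv_member_subset[OF that(1)] finite_subset by (fastforce simp: formulas_def)
    show ?thesis
    proof (rule gen_fragment_subfmls_induct[where X = Y and F = F and V = V and L = "Lb \<delta>"])
      show "fragment V (Lb \<delta>)"
        by (rule branch_fragment)
      show "Y \<subseteq> Lb \<delta>"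
        unfolding Lb by (rule gen_fragment_superset)
      show "\<exists>n. rank_le V (h \<delta> n) G" if "F \<in> Y" "G \<in> subfmls F" for F G
        by (rule Y[OF that])
      show "F \<in> gen_fragment V Y" "G \<in> subfmls F"
        using FG Lb by simp_all
      show "\<exists>n. rank_le V (h \<delta> n) F" if "F \<in> formulas V" "finitary F" "quantifier_free F" for F
        using rank_le_finitary[OF that] by blast
      show "\<exists>n. rank_le V (h \<delta> n) (Neg F)" if "\<exists>n. rank_le V (h \<delta> n) F" for F
        using that rank_le_Neg by blast
      show "\<exists>n. rank_le V (h \<delta> n) (Exi F)" if "Exi F \<in> formulas V" "\<exists>n. rank_le V (h \<delta> n) F" for F
        using that(2) rank_le_Exi[OF _ pos h_mono[OF \<delta> lessI] that(1)] by blast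
      show "\<exists>n. rank_le V (h \<delta> n) (Forall F)" if "Forall F \<in> formulas V" "\<exists>n. rank_le V (h \<delta> n) F" for F
        using that(2) rank_le_Forall[OF _ pos h_mono[OF \<delta> lessI] that(1)] by blast
      show "\<exists>n. rank_le V (h \<delta> n) (Conj \<Phi>)"
        if "Conj \<Phi> \<in> formulas V" "finite (rcset \<Phi>)" "\<forall>F\<in>rcset \<Phi>. \<exists>n. rank_le V (h \<delta> n) F" for \<Phi>
      proof -
        have "\<exists>n. \<forall>F\<in>rcset \<Phi>. rank_le V (h \<delta> n) F"
          using bound[OF that(2)] that(1,3) member by blast
        then show ?thesis
          using rank_le_Conj[OF _ pos h_mono[OF \<delta> lessI] that(1)] by blast
      qed
      show "\<exists>n. rank_le V (h \<delta> n) (Disj \<Phi>)"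
        if "Disj \<Phi> \<in> formulas V" "finite (rcset \<Phi>)" "\<forall>F\<in>rcset \<Phi>. \<exists>n. rank_le V (h \<delta> n) F" for \<Phi>
      proof -
        have "\<exists>n. \<forall>F\<in>rcset \<Phi>. rank_le V (h \<delta> n) F"
          using bound[OF that(2)] that(1,3) member by blast
        then show ?thesis
          using rank_le_Disj[OF _ pos h_mono[OF \<delta> lessI] that(1)] by blast
      qed
      show "\<exists>n. rank_le V (h \<delta> n) (subst F \<sigma>)" if "\<And>i. wf_trm V (\<sigma> i)" "\<exists>n. rank_le V (h \<delta> n) F" for F \<sigma>
        using that rank_le_subst by blast
    qed
  qed
  have "\<forall>F\<in>Lb \<delta>. \<forall>G\<in>subfmls F. \<exists>n. rank_le V (h \<delta> n) G" if "\<delta> < osuc \<delta>0" for \<delta>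
    using that
  proof (induction \<delta> rule: less_induct)
    case (less \<delta>)
    have below: "rank_le V (h \<delta> 0) G" if below: "\<gamma> < \<delta>" "F \<in> Lb \<gamma>" "G \<in> subfmls F" for \<gamma> F G
    proof -
      obtain n where n: "rank_le V (h \<gamma> n) G"
        using less.IH[OF below(1) less_trans[OF below(1) less.prems]] \<open>F \<in> Lb \<gamma>\<close> \<open>G \<in> subfmls F\<close> by blast
      show ?thesis
        by (rule rank_le_mono[OF n less_imp_le[OF h_lex[OF below(1) less.prems]] form[OF below(2,3)]])
    qed
    show ?case
    proof (cases \<delta> rule: om1_cases)
      case 1
      have "Lb \<delta> = gen_fragment V {\<phi>}"
        using node_zeroD(1)[of V \<phi>] node_branch 1 by metis
      moreover have "\<exists>n. rank_le V (h \<delta> n) G" if "F \<in> {\<phi>}" "G \<in> subfmls F" for F G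
      proof -
        obtain \<beta> where \<beta>: "\<beta> \<le> qr \<phi>" "in_Sigma \<beta> G \<or> in_Pi \<beta> G"
          using subfmls_in_hierarchy qr_placed[of \<phi>] \<open>F \<in> {\<phi>}\<close> \<open>G \<in> subfmls F\<close> by blast
        have "\<beta> < h \<delta> 0"
          using \<beta>(1) h_ge[OF less.prems, of 0] less_osuc_iff by (meson less_le_trans)
        moreover have "G \<in> formulas V"
          using form[of \<phi> 0 G] base_in_branch that by simp
        ultimately show ?thesis
          using rank_le_in_hierarchy[OF \<beta>(2)] by blast
      qed
      ultimately show ?thesis
        using step[OF less.prems] by blast
    next
      case (2 \<gamma>)
      have "\<gamma> < \<delta>"
        by (simp add: 2)
      have "\<exists>n. rank_le V (h \<delta> n) G"
        if "F \<in> Lb \<gamma> \<union> {Conj (acset p) | p. p \<in> nonprincipal_types V (Lb \<gamma>) (Tb \<gamma>)}" "G \<in> subfmls F" for F G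
        using that(1)
      proof
        assume "F \<in> Lb \<gamma>"
        then show ?thesis
          using below[OF \<open>\<gamma> < \<delta>\<close> _ that(2)] by blast
      next
        assume "F \<in> {Conj (acset p) | p. p \<in> nonprincipal_types V (Lb \<gamma>) (Tb \<gamma>)}"
        then obtain p where p: "F = Conj (acset p)" "p \<in> nonprincipal_types V (Lb \<gamma>) (Tb \<gamma>)"
          by blast
        then have "p \<subseteq> Lb \<gamma>"
          by (auto simp: nonprincipal_types_def ntype_def)
        then have rc: "rcset (acset p) = p"
          using fragment_dest(1)[OF branch_fragment] countable_subset by (metis acset_inverse mem_Collect_eq)
        show ?thesis
        proof (cases "G = F")
          case True
          have "F \<in> formulas V"
            using Conj_type_in_branch[OF p(2) \<open>\<gamma> < \<delta>\<close>] p(1) fragment_dest(2)[OF branch_fragment] by blast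
          moreover have "rank_le V (h \<delta> 0) H" if "H \<in> rcset (acset p)" for H
            using below[OF \<open>\<gamma> < \<delta>\<close> _ subfmls_self] that \<open>p \<subseteq> Lb \<gamma>\<close> rc by blast
          moreover have "0 < h \<delta> 0"
            by (rule less_le_trans[OF osuc_pos h_ge[OF less.prems]])
          \<comment> \<open>The conjunction of a type may be infinite, but its members come from the
            preceding level and share the bound \<open>h \<delta> 0\<close>.\<close>
          ultimately have "rank_le V (h \<delta> 1) (Conj (acset p))"
            using p(1) h_mono[OF less.prems, of 0 1] by (intro rank_le_Conj[of "acset p" V "h \<delta> 0"]) simp_all
          then show ?thesis
            using True p(1) by blast
        next
          case False
          then obtain H where "H \<in> p" "G \<in> subfmls H"
            using \<open>G \<in> subfmls F\<close> p(1) rc by auto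
          then show ?thesis
            using below[OF \<open>\<gamma> < \<delta>\<close>] \<open>p \<subseteq> Lb \<gamma>\<close> by blast
        qed
      qed
      then show ?thesis
        using step[OF less.prems, of "Lb \<gamma> \<union> {Conj (acset p) | p. p \<in> nonprincipal_types V (Lb \<gamma>) (Tb \<gamma>)}"]
          branch_osuc(1)[of \<gamma>] 2 by blast
    next
      case 3
      then show ?thesis
        using below branch_limit by blast
    qed
  qed
  from this[OF less_osuc] obtain n where "rank_le V (h \<delta>0 n) F"
    using \<delta>0(2) subfmls_self by blast
  then show ?thesis
    using h_less[OF less_osuc] by blast
qed

end

section \<open>The uncountable classes\<close>

lemma equiv_lvl_sym: "equiv_lvl V \<alpha> M N \<Longrightarrow> equiv_lvl V \<alpha> N M"
  unfolding equiv_lvl_def by blast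

lemma equiv_lvl_trans: "equiv_lvl V \<alpha> M N \<Longrightarrow> equiv_lvl V \<alpha> N P \<Longrightarrow> equiv_lvl V \<alpha> M P"
  unfolding equiv_lvl_def by blast

text \<open>A conjunction of positive level \<alpha> is literally one of level \<beta>. Sentences of
  level 0 need not have this shape, hence the condition on \<alpha>.\<close>

lemma equiv_lvl_mono:
  assumes "equiv_lvl V \<beta> M N" "\<alpha> < \<beta>" "0 < \<alpha>"
  shows "equiv_lvl V \<alpha> M N"
  unfolding equiv_lvl_def
proof (intro ballI impI)
  fix F
  assume F: "F \<in> sentences V" "Pi_in V \<alpha> F"
  from F(2) obtain \<Phi> where \<Phi>: "F = Conj \<Phi>" "Conj \<Phi> \<in> formulas V"
    "\<forall>F\<in>rcset \<Phi>. \<exists>\<gamma><\<alpha>. \<exists>k G. F = (Forall ^^ k) G \<and> Sigma_in V \<gamma> G"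
    using assms(3) by (auto elim!: Pi_in_cases)
  have "Pi_in V \<beta> F"
    unfolding \<Phi>(1)
  proof (rule Pi_in_pos)
    show "0 < \<beta>"
      using assms(2,3) by (rule less_trans[rotated])
    show "\<forall>F\<in>rcset \<Phi>. \<exists>\<gamma><\<beta>. \<exists>k G. F = (Forall ^^ k) G \<and> Sigma_in V \<gamma> G"
      using \<Phi>(3) assms(2) by (meson less_trans)
  qed (rule \<Phi>(2))
  then show "M \<Turnstile> F \<longleftrightarrow> N \<Turnstile> F"
    using assms(1) F(1) unfolding equiv_lvl_def by blast
qed

lemma iso_types_mono: "X \<subseteq> Y \<Longrightarrow> iso_types V X \<subseteq> iso_types V Y"
  unfolding iso_types_def by blast

lemma uncountable_models:
  assumes "minimal_counterexample V \<phi>"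
  shows "uncountable (iso_types V (models V \<phi>))"
proof
  assume "countable (iso_types V (models V \<phi>))"
  then have "(card_of (iso_types V (models V \<phi>)), natLeq) \<in> ordLeq"
    by (simp add: countable_card_le_natLeq)
  moreover have "(card_of (iso_types V (models V \<phi>)), cardSuc natLeq) \<in> ordIso"
    using assms unfolding minimal_counterexample_def by blast
  ultimately have "(cardSuc natLeq, natLeq) \<in> ordLeq"
    using ordIso_symmetric ordIso_ordLeq_trans by blast
  then show False
    using cardSuc_greater[OF natLeq_Card_order] not_ordLess_ordLeq by blast
qed

lemma holds_Conj_pair:
  "M \<Turnstile> Conj (acset {F, G}) \<longleftrightarrow> M \<Turnstile> F \<and> M \<Turnstile> G"
  unfolding holds_def by auto

text \<open>Two different classes are separated by a sentence, and minimality makes one side of that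
  sentence countable.\<close>

lemma big_class_unique:
  assumes mc: "minimal_counterexample V \<phi>"
    and C: "C \<in> equiv_classes V \<phi> \<beta>" "uncountable (iso_types V C)"
    and D: "D \<in> equiv_classes V \<phi> \<beta>" "uncountable (iso_types V D)"
  shows "C = D"
proof (rule ccontr)
  assume "C \<noteq> D"
  obtain M where M: "M \<in> models V \<phi>" "C = {N \<in> models V \<phi>. equiv_lvl V \<beta> M N}"
    using C(1) unfolding equiv_classes_def by blast
  obtain N where N: "N \<in> models V \<phi>" "D = {P \<in> models V \<phi>. equiv_lvl V \<beta> N P}"
    using D(1) unfolding equiv_classes_def by blast
  have "\<not> equiv_lvl V \<beta> M N"
    using \<open>C \<noteq> D\<close> M(2) N(2) equiv_lvl_sym equiv_lvl_trans by blast
  then obtain F where F: "F \<in> sentences V" "Pi_in V \<beta> F" "\<not> (M \<Turnstile> F \<longleftrightarrow> N \<Turnstile> F)"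
    unfolding equiv_lvl_def by blast
  have neg: "P \<Turnstile> Neg F \<longleftrightarrow> \<not> P \<Turnstile> F" if "P \<in> models V \<phi>" for P
    using that F(1) by (intro holds_Neg) (auto simp: models_def sentences_def)
  have mem: "P \<in> models V (Conj (acset {\<phi>, G})) \<longleftrightarrow> P \<in> models V \<phi> \<and> P \<Turnstile> G" for P G
    by (auto simp: models_def holds_Conj_pair)
  have C_sat: "P \<Turnstile> F \<longleftrightarrow> M \<Turnstile> F" if "P \<in> C" for P
    using that F(1,2) unfolding M(2) equiv_lvl_def by blast
  have D_sat: "P \<Turnstile> F \<longleftrightarrow> N \<Turnstile> F" if "P \<in> D" for P
    using that F(1,2) unfolding N(2) equiv_lvl_def by blast
  have CD: "C \<subseteq> models V \<phi>" "D \<subseteq> models V \<phi>"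
    using M(2) N(2) by blast+
  have big: "uncountable (iso_types V Y)" if "E \<subseteq> Y" "uncountable (iso_types V E)" for E Y
    using that(2) countable_subset[OF iso_types_mono[OF that(1)]] by blast
  have small: "countable (iso_types V (models V (Conj (acset {\<phi>, F})))) \<or>
      countable (iso_types V (models V (Conj (acset {\<phi>, Neg F}))))"
    using mc F(1) unfolding minimal_counterexample_def by blast
  then show False
  proof (cases "M \<Turnstile> F")
    case True
    have "C \<subseteq> models V (Conj (acset {\<phi>, F}))"
      using True C_sat CD(1) by (auto simp: mem)
    moreover have "D \<subseteq> models V (Conj (acset {\<phi>, Neg F}))"
      using True F(3) D_sat CD(2) neg by (auto simp: mem)
    ultimately show False
      using big[OF _ C(2)] big[OF _ D(2)] small by simp
  next
    case False
    have "D \<subseteq> models V (Conj (acset {\<phi>, F}))"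
      using False F(3) D_sat CD(2) by (auto simp: mem)
    moreover have "C \<subseteq> models V (Conj (acset {\<phi>, Neg F}))"
      using False C_sat CD(1) neg by (auto simp: mem)
    ultimately show False
      using big[OF _ C(2)] big[OF _ D(2)] small by simp
  qed
qed

text \<open>Existence is scatteredness: countably many classes with countably many isomorphism types
  each could not exhaust the models. With uniqueness, the definite description denotes.\<close>

lemma big_class:
  assumes mc: "minimal_counterexample V \<phi>"
  shows "big_class V \<phi> \<beta> \<in> equiv_classes V \<phi> \<beta>" "uncountable (iso_types V (big_class V \<phi> \<beta>))"
    "\<And>C. C \<in> equiv_classes V \<phi> \<beta> \<Longrightarrow> uncountable (iso_types V C) \<Longrightarrow> C = big_class V \<phi> \<beta>"
proof -
  have "\<exists>C\<in>equiv_classes V \<phi> \<beta>. uncountable (iso_types V C)"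
  proof (rule ccontr)
    assume "\<not> ?thesis"
    moreover have "countable (equiv_classes V \<phi> \<beta>)"
      using mc unfolding minimal_counterexample_def by blast
    ultimately have "countable (\<Union>C\<in>equiv_classes V \<phi> \<beta>. iso_types V C)"
      by blast
    moreover have "models V \<phi> \<subseteq> \<Union> (equiv_classes V \<phi> \<beta>)"
      by (auto simp: equiv_classes_def equiv_lvl_def)
    then have "iso_types V (models V \<phi>) \<subseteq> (\<Union>C\<in>equiv_classes V \<phi> \<beta>. iso_types V C)"
      unfolding iso_types_def by blast
    ultimately show False
      using uncountable_models[OF mc] countable_subset by blast
  qed
  then have "\<exists>!C. C \<in> equiv_classes V \<phi> \<beta> \<and> uncountable (iso_types V C)"
    using big_class_unique[OF mc] by blast
  from theI'[OF this] show *: "big_class V \<phi> \<beta> \<in> equiv_classes V \<phi> \<beta>" "uncountable (iso_types V (big_class V \<phi> \<beta>))"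
    unfolding big_class_def by blast+
  show "\<And>C. C \<in> equiv_classes V \<phi> \<beta> \<Longrightarrow> uncountable (iso_types V C) \<Longrightarrow> C = big_class V \<phi> \<beta>"
    using big_class_unique[OF mc _ _ *] by blast
qed

lemma scott_sentence_iso:
  assumes "isomorphic V M N" "M \<in> structures V"
  shows "scott_sentence V M F \<longleftrightarrow> scott_sentence V N F"
  unfolding scott_sentence_def
  using assms isomorphic_sym[OF assms] isomorphic_trans by blast

lemma cSR_iso: "isomorphic V M N \<Longrightarrow> M \<in> structures V \<Longrightarrow> cSR V M = cSR V N"
  unfolding cSR_def using scott_sentence_iso by simp

text \<open>The rank is invariant under isomorphism, so it factors through isomorphism types by way
  of a chosen representative.\<close>

lemma countable_cSR:
  assumes "countable (iso_types V X)" "X \<subseteq> structures V"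
  shows "countable (cSR V ` X)"
proof -
  have "cSR V M = cSR V (SOME N. N \<in> {N \<in> structures V. isomorphic V M N})" if "M \<in> X" for M
  proof -
    have "M \<in> {N \<in> structures V. isomorphic V M N}"
      using that assms(2) isomorphic_refl by blast
    then have "(SOME N. N \<in> {N \<in> structures V. isomorphic V M N}) \<in> {N \<in> structures V. isomorphic V M N}"
      by (rule someI)
    then show ?thesis
      using cSR_iso that assms(2) by blast
  qed
  then have "cSR V ` X \<subseteq> (\<lambda>C. cSR V (SOME N. N \<in> C)) ` iso_types V X"
    unfolding iso_types_def by (auto simp: image_iff)
  then show ?thesis
    using assms(1) countable_image countable_subset by blast
qed

text \<open>For the minimum in \<open>f_bound\<close> to be attained some bound is needed: outside
  the big class there are countably many classes, each with countably many isomorphism types, so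
  countably many ranks occur.\<close>

lemma cSR_less_f_bound:
  assumes mc: "minimal_counterexample V \<phi>" and M: "M \<in> models V \<phi>" "M \<notin> big_class V \<phi> \<alpha>"
  shows "cSR V M < f_bound V \<phi> \<alpha>"
proof -
  let ?E = "equiv_classes V \<phi> \<alpha> - {big_class V \<phi> \<alpha>}"
  have "countable (equiv_classes V \<phi> \<alpha>)"
    using mc unfolding minimal_counterexample_def by blast
  then have "countable ?E"
    by (rule countable_Diff)
  moreover have "countable (cSR V ` C)" if "C \<in> ?E" for C
  proof (rule countable_cSR)
    show "countable (iso_types V C)"
      using that big_class(3)[OF mc, of C \<alpha>] by blast
    show "C \<subseteq> structures V"
      using that by (auto simp: equiv_classes_def models_def)
  qed
  ultimately have "countable (\<Union>C\<in>?E. cSR V ` C)"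
    by (rule countable_UN)
  from om1_bounded[OF this] obtain \<beta> where \<beta>: "\<forall>\<gamma>\<in>(\<Union>C\<in>?E. cSR V ` C). \<gamma> < \<beta>" ..
  have "\<forall>M \<in> models V \<phi>. M \<notin> big_class V \<phi> \<alpha> \<longrightarrow> cSR V M < \<beta>"
  proof (intro ballI impI)
    fix N
    assume N: "N \<in> models V \<phi>" "N \<notin> big_class V \<phi> \<alpha>"
    let ?C = "{P \<in> models V \<phi>. equiv_lvl V \<alpha> N P}"
    have "N \<in> ?C" "?C \<in> equiv_classes V \<phi> \<alpha>"
      using N(1) by (auto simp: equiv_classes_def equiv_lvl_def)
    then show "cSR V N < \<beta>"
      using \<beta> N(2) by blast
  qed
  then have "\<forall>M \<in> models V \<phi>. M \<notin> big_class V \<phi> \<alpha> \<longrightarrow> cSR V M < f_bound V \<phi> \<alpha>"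
    unfolding f_bound_def by (rule LeastI)
  then show ?thesis
    using M by blast
qed

lemma big_class_equiv:
  assumes mc: "minimal_counterexample V \<phi>" and "M \<in> big_class V \<phi> \<beta>" "N \<in> big_class V \<phi> \<beta>"
  shows "equiv_lvl V \<beta> M N" "M \<in> models V \<phi>"
  using big_class(1)[OF mc, of \<beta>] assms(2,3) unfolding equiv_classes_def
  by (auto intro: equiv_lvl_trans equiv_lvl_sym)

text \<open>The coarser class that contains the uncountable class of level \<beta> is uncountable
  itself, and only one class of level \<alpha> is.\<close>

lemma big_class_antimono:
  assumes mc: "minimal_counterexample V \<phi>" and "\<alpha> < \<beta>" "0 < \<alpha>"
  shows "big_class V \<phi> \<beta> \<subseteq> big_class V \<phi> \<alpha>"
proof -
  obtain M where M: "M \<in> models V \<phi>" "big_class V \<phi> \<beta> = {N \<in> models V \<phi>. equiv_lvl V \<beta> M N}"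
    using big_class(1)[OF mc, of \<beta>] unfolding equiv_classes_def by blast
  let ?C = "{N \<in> models V \<phi>. equiv_lvl V \<alpha> M N}"
  have sub: "big_class V \<phi> \<beta> \<subseteq> ?C"
    using M(2) equiv_lvl_mono[OF _ assms(2,3)] by blast
  have "uncountable (iso_types V ?C)"
    using big_class(2)[OF mc, of \<beta>] iso_types_mono[OF sub] countable_subset by blast
  moreover have "?C \<in> equiv_classes V \<phi> \<alpha>"
    using M(1) by (auto simp: equiv_classes_def)
  ultimately have "?C = big_class V \<phi> \<alpha>"
    by (intro big_class(3)[OF mc])
  then show ?thesis
    using sub by simp
qed

text \<open>Well-foundedness provides a member of least rank, so the choice is made from a non-empty
  set.\<close>

lemma K_label_in_big_class:
  assumes mc: "minimal_counterexample V \<phi>"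
  shows "K_label V \<phi> \<beta> \<in> big_class V \<phi> \<beta>"
proof -
  let ?R = "\<lambda>M. M \<in> big_class V \<phi> \<beta>"
  have "\<exists>M. ?R M"
    using big_class(2)[OF mc, of \<beta>] by (auto simp: iso_types_def)
  then obtain \<alpha> where "\<exists>M. ?R M \<and> cSR V M = \<alpha>"
    by blast
  then have "\<exists>M. ?R M \<and> cSR V M = (LEAST \<alpha>. \<exists>M. ?R M \<and> cSR V M = \<alpha>)"
    by (rule LeastI)
  then have "\<exists>M. ?R M \<and> (\<forall>N \<in> big_class V \<phi> \<beta>. cSR V M \<le> cSR V N)"
    by (metis (mono_tags, lifting) Least_le)
  from someI_ex[OF this] show ?thesis
    unfolding K_label_def by blast
qed

lemma no_scott_sentence_in_big_class:
  assumes mc: "minimal_counterexample V \<phi>" and M: "M \<in> big_class V \<phi> \<beta>"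
    and F: "Pi_in V \<beta> F" "scott_sentence V M F"
  shows False
proof -
  have sub: "big_class V \<phi> \<beta> \<subseteq> structures V"
    using big_class_equiv(2)[OF mc] by (auto simp: models_def)
  have "{P \<in> structures V. isomorphic V N P} = {P \<in> structures V. isomorphic V M P}"
    if "N \<in> big_class V \<phi> \<beta>" for N
  proof -
    have "M \<Turnstile> F"
      using F(2) M sub isomorphic_refl unfolding scott_sentence_def by blast
    then have "N \<Turnstile> F"
      using big_class_equiv(1)[OF mc M that] F unfolding equiv_lvl_def scott_sentence_def by blast
    then have "isomorphic V M N"
      using F(2) that sub unfolding scott_sentence_def by blast
    then show ?thesis
      using isomorphic_sym[of V M N] isomorphic_trans M sub by blast
  qed
  then have "iso_types V (big_class V \<phi> \<beta>) \<subseteq> {{P \<in> structures V. isomorphic V M P}}"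
    unfolding iso_types_def by blast
  then have "countable (iso_types V (big_class V \<phi> \<beta>))"
    by (rule countable_subset) simp
  then show False
    using big_class(2)[OF mc, of \<beta>] by simp
qed

lemma realizes_iso:
  assumes "isomorphic V M N" "M \<in> structures V" "realizes M p" "p \<subseteq> formulas V"
  shows "realizes N p"
proof -
  obtain h where h: "h ` univ M = univ N"
    "\<And>F e. e \<in> envs M \<Longrightarrow> wf_symbols V F \<Longrightarrow> sat M F e = sat N F (h \<circ> e)"
    by (rule isomorphic_sat[OF assms(1,2)], rule that)
  obtain e where e: "e \<in> envs M" "\<forall>F\<in>p. sat M F e"
    using assms(3) unfolding realizes_def by blast
  have "h \<circ> e \<in> envs N"
    using e(1) h(1) by (auto simp: envs_def)
  moreover have "sat N F (h \<circ> e)" if "F \<in> p" for F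
    using h(2)[OF e(1), of F] e(2) that assms(4) by (auto simp: formulas_def)
  ultimately show ?thesis
    unfolding realizes_def by blast
qed

text \<open>Every structure is computed by its own atomic diagram, so the minimum is taken over a
  non-empty set and is the value of some real.\<close>

lemma omega1_attained:
  assumes "M \<in> structures V"
  shows "\<exists>X. omega1 V M = omega1_real X"
proof -
  have "computes_copy V (atomic_diagram V M) M"
    unfolding computes_copy_def using assms isomorphic_refl computable_from_self by blast
  then have "\<exists>\<alpha> X. computes_copy V X M \<and> \<alpha> = omega1_real X"
    by blast
  from LeastI_ex[OF this] show ?thesis
    unfolding omega1_def by blast
qed

theorem mainTheorem11:
  fixes V :: vocab and \<phi> :: fml
    and Lb Tb :: "om1 \<Rightarrow> fml set" and C53 :: "om1 set" and \<kappa> :: om1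
  assumes "minimal_counterexample V \<phi>"
    and "sacks_branch V \<phi> Lb Tb"
    and "sacks_club V \<phi> Lb Tb C53"
    and "\<kappa> \<in> S_circ V \<phi> C53"
    and "y_g V \<phi> \<kappa>"
  shows "trace_of V (Lb \<kappa>) (Tb \<kappa>) (K_label V \<phi> (osuc \<kappa>)) \<noteq> {}"
proof
  assume trace: "trace_of V (Lb \<kappa>) (Tb \<kappa>) (K_label V \<phi> (osuc \<kappa>)) = {}"
  note mc = assms(1)
  interpret branch V \<phi> Lb Tb
    by unfold_locales (rule assms(2))
  interpret T: complete_theory V "Lb \<kappa>" "Tb \<kappa>"
    by (rule branch_complete_theory)
  have \<kappa>: "f_bound V \<phi> \<kappa> \<le> \<kappa>" "\<kappa> \<in> C53" "qr \<phi> < \<kappa>"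
    using assms(4) by (auto simp: S_circ_def F_set_def)
  obtain B where "omega < \<kappa>" and np: "nonprincipal_types V (Lb \<kappa>) (Tb \<kappa>) \<noteq> {}"
    and B: "B \<in> structures V" "\<forall>F \<in> Tb \<kappa>. B \<Turnstile> F" "omega1 V B = \<kappa>"
      "\<forall>p \<in> nonprincipal_types V (Lb \<kappa>) (Tb \<kappa>). realizes B p"
    using assms(3) \<kappa>(2) unfolding sacks_club_def by blast
  \<comment> \<open>Through B the ordinal \<kappa> inherits the closure properties of computable
    well-orderings.\<close>
  obtain X where X: "\<kappa> = omega1_real X"
    using omega1_attained[OF B(1)] B(3) by auto
  have lim: "is_limit \<kappa>"
    using is_limit_omega1_real \<open>omega < \<kappa>\<close> X by simp
  have pos: "0 < \<kappa>"
    using \<kappa>(3) by (rule le_less_trans[OF zero_le_om1])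
  have rank: "\<exists>\<gamma><\<kappa>. rank_le V \<gamma> F" if "F \<in> Lb \<kappa>" for F
    using branch_rank[of X F] that \<kappa>(3) \<open>omega < \<kappa>\<close> by (simp flip: X)
  obtain A where A: "atomic_model V (Lb \<kappa>) (Tb \<kappa>) A"
    using branch_atomic by blast
  have A': "models_branch \<kappa> A" "A \<in> structures V"
    using A by (auto simp: models_branch_def atomic_model_def)
  have B': "models_branch \<kappa> B"
    using B by (simp add: models_branch_def)
  obtain \<Theta> where \<Theta>: "Pi_in V (osuc \<kappa>) \<Theta>" "scott_sentence V A \<Theta>"
    using T.atomic_scott_sentence[OF A pos rank] by blast
  have A_class: "A \<in> big_class V \<phi> \<kappa>"
  proof (rule ccontr)
    assume "A \<notin> big_class V \<phi> \<kappa>"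
    moreover have "A \<in> models V \<phi>"
      using A' base_in_branch by (auto simp: models_branch_def models_def)
    ultimately have "cSR V A < \<kappa>"
      using cSR_less_f_bound[OF mc] \<kappa>(1) less_le_trans by blast
    \<comment> \<open>\<open>cSR\<close> is one below the level of the Scott sentence; that this
      level is still below \<kappa> uses that \<kappa> is a limit.\<close>
    then have less: "osuc (cSR V A) < \<kappa>"
      using lim by (simp add: is_limit_def)
    \<comment> \<open>\<open>\<Theta>\<close> witnesses that some level works, so the minimum in
      \<open>cSR\<close> is attained.\<close>
    obtain F where F: "Pi_in V (osuc (cSR V A)) F" "scott_sentence V A F"
      using LeastI_ex[of "\<lambda>\<alpha>. \<exists>F. Pi_in V (osuc \<alpha>) F \<and> scott_sentence V A F"] \<Theta>
      unfolding cSR_def by blast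
    then have fv: "fv F = {}"
      by (simp add: scott_sentence_def sentences_def)
    have AF: "A \<Turnstile> F"
      using F(2) A'(2) isomorphic_refl unfolding scott_sentence_def by blast
    have models: "models_branch (osuc (cSR V A)) A" "models_branch (osuc (cSR V A)) B"
      using A'(1) B' models_branch_mono less_imp_le[OF less] by blast+
    obtain e e' where e: "e \<in> envs A" "e' \<in> envs B"
      using envs_nonempty A'(2) B(1) by blast
    \<comment> \<open>A sentence is a formula about the empty tuple, whose type is the same in all
      models of one theory of the branch.\<close>
    have "ctype (Lb (osuc (cSR V A))) A 0 e = ctype (Lb (osuc (cSR V A))) B 0 e'"
      using complete_theory.ctype_zero[OF branch_complete_theory _ _ e] models by (simp add: is_model_iff)
    then have "sat B F e'"
      using same_type_in_hierarchy[OF models(1) e(1) models(2) e(2) _ F(1)] AF e(1) fv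
      by (simp add: holds_def)
    then have "B \<Turnstile> F"
      using holds_iff_sat[OF fv e(2)] by simp
    then have "isomorphic V A B"
      using F(2) B(1) unfolding scott_sentence_def by blast
    then have "isomorphic V B A"
      using isomorphic_sym A'(2) by blast
    obtain p where p: "p \<in> nonprincipal_types V (Lb \<kappa>) (Tb \<kappa>)"
      using np by blast
    then have "p \<subseteq> formulas V"
      using fragment_dest(2)[OF branch_fragment, of \<kappa>] by (auto simp: nonprincipal_types_def ntype_def)
    then have "realizes A p"
      using realizes_iso[OF \<open>isomorphic V B A\<close> B(1)] B(4) p by blast
    then show False
      using T.atomic_no_nonprincipal[OF A p] by blast
  qed
  let ?K = "K_label V \<phi> (osuc \<kappa>)"
  have K: "?K \<in> big_class V \<phi> (osuc \<kappa>)"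
    by (rule K_label_in_big_class[OF mc])
  then have "?K \<in> big_class V \<phi> \<kappa>"
    using big_class_antimono[OF mc less_osuc pos] by blast
  then have equiv: "equiv_lvl V \<kappa> A ?K" and K_structure: "?K \<in> structures V"
    using big_class_equiv[OF mc] A_class by (auto simp: models_def)
  have "?K \<Turnstile> F" if "F \<in> Tb \<kappa>" for F
  proof -
    have F: "F \<in> Lb \<kappa>" "fv F = {}"
      using T.sentences[OF that] by simp_all
    then obtain \<gamma> where "\<gamma> < \<kappa>" "rank_le V \<gamma> F"
      using rank by blast
    \<comment> \<open>Equivalence at level \<kappa> speaks of normal forms only, so F is exchanged
      for an equivalent \<Pi> sentence of exactly that level.\<close>
    then have "pi_def V \<kappa> {} (\<lambda>M. sat M F)"
      using pi_def_mono[of V \<gamma> "{}" "\<lambda>M. sat M F" \<kappa>] F(2) by (simp add: rank_le_def)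
    then obtain G where G: "Pi_in V \<kappa> G" "fv G = {}" "\<And>M e. sat M G e \<longleftrightarrow> sat M F e"
      unfolding pi_def_def by blast
    have "A \<Turnstile> G"
      using A'(1) that G(3) by (auto simp: models_branch_def holds_def)
    moreover have "G \<in> sentences V"
      using Pi_in_formulas[OF G(1)] G(2) by (simp add: sentences_def)
    ultimately have "?K \<Turnstile> G"
      using equiv G(1) unfolding equiv_lvl_def by blast
    then show ?thesis
      using G(3) by (simp add: holds_def)
  qed
  then have "T.is_model ?K"
    using K_structure by (simp add: T.is_model_def)
  then have "atomic_model V (Lb \<kappa>) (Tb \<kappa>) ?K"
    using trace by (rule T.atomic_if_no_nonprincipal)
  then have "isomorphic V A ?K"
    by (rule T.atomic_models_isomorphic[OF A])
  \<comment> \<open>\<open>\<Theta>\<close> sits exactly at level \<kappa> + 1, where K cannot be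
    told apart from the other members of its class.\<close>
  then have "scott_sentence V ?K \<Theta>"
    using scott_sentence_iso A'(2) \<Theta>(2) by blast
  then show False
    by (rule no_scott_sentence_in_big_class[OF mc K \<Theta>(1)])
qed

end
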